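(* Let $S$ be a numerical semigroup minimally generated by $n_1,\ldots,n_d$, where $n_1<n_i$ for all $i\ge 2$. The following statements are equivalent. (1) $S$ is homogeneous and $G(S)$ is Cohen-Macaulay. (2) For all $x^{\mathbf a}-x^{\mathbf b}\in I_S$ with $|\mathbf a|>|\mathbf b|$, we have $s(\mathbf a)\notin \mathrm{AP}(S,n_1)$; moreover, if $\bar{\mathbf b}$ is a maximal factorization (of $s(\bar{\mathbf b})$), then $a_1\ge b_1$. (3) There exists a minimal set of binomial generators $E$ for $I_S$ such that for all $x^{\mathbf a}-x^{\mathbf b}\in E$ with $|\mathbf a|>|\mathbf b|$, we have $a_1\neq 0$. (4) There exists a minimal set of binomial generators $E$ for $I_S$ which is a standard basis and such that for all $x^{\mathbf a}-x^{\mathbf b}\in E$ with $|\mathbf a|>|\mathbf b|$, we have $a_1\neq 0$. (5) There exists a minimal Gröbner basis $G$ of $I_S$ with respect to $<_{ds}$, consisting of binomials, such that $x_1$ belongs to the support of all non-homogeneous elements of $G$ and $x_1$ does not divide $\mathrm{lm}_{<_{ds}}(f)$ for all $f\in G$.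
   Context: A numerical semigroup is a submonoid of $(\mathbb N,+)$ ($0\in\mathbb N$) with finite complement. Let $\Bbbk$ be a field and $P=\Bbbk[x_1,\ldots,x_d]$ with the standard grading ($\deg x_i=1$). $I_S$ is the kernel of $P\to\Bbbk[t]$, $x_i\mapsto t^{n_i}$, so $P/I_S\cong \Bbbk[S]=\Bbbk[t^{n_1},\ldots,t^{n_d}]$. For $\mathbf a\in\mathbb N^d$ put $x^{\mathbf a}=x_1^{a_1}\cdots x_d^{a_d}$, $|\mathbf a|=\sum_i a_i$, $s(\mathbf a)=\sum_i a_in_i$. A binomial is a difference $x^{\mathbf a}-x^{\mathbf b}$; its support is $\{x_i: a_i+b_i\ne 0\}$; "homogeneous" polynomials refers to the standard grading. A factorization of $s\in S$ is $\mathbf a\in\mathbb N^d$ with $s(\mathbf a)=s$; it is maximal if $|\mathbf a|$ is the largest among all factorizations of $s$. For $\mathbf b\in\mathbb N^d$ put $\bar{\mathbf b}=\mathbf b$ if $b_1=0$ and $\bar{\mathbf b}=(b_1-1,b_2,\ldots,b_d)$ if $b_1>0$. $\mathrm{AP}(S,s)=\{x\in S: x-s\notin S\}$. A subset $T\subset S$ is homogeneous if for every $0\ne s\in T$ all factorizations $\mathbf a$ of $s$ have the same $|\mathbf a|$ (the empty set is homogeneous). $S$ is homogeneous if $\mathrm{AP}(S,n_1)$ is homogeneous. For $0\ne f\in P$, $f_*$ is the homogeneous summand of $f$ of least degree, and for an ideal $I$, $I_*$ is the ideal generated by all $f_*$, $0\neq f\in I$. A finite subset $\{f_1,\ldots,f_r\}$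 of $I$ is a standard basis of $I$ if $(f_1)_*,\ldots,(f_r)_*$ generate $I_*$. $G(S)$ is the associated graded ring of $\Bbbk[S]$ with respect to $(t^{n_1},\ldots,t^{n_d})$; $G(S)\cong P/(I_S)_*$. The local monomial order $<_{ds}$ (negative degree reverse lexicographic with $x_2>\cdots>x_d>x_1$) is: $x^{\mathbf b}<_{ds}x^{\mathbf a}$ iff $|\mathbf b|>|\mathbf a|$; or $|\mathbf b|=|\mathbf a|$ and $b_1>a_1$; or $|\mathbf b|=|\mathbf a|$, $b_1=a_1$, and for some $2\le i\le d$, $b_d=a_d,\ldots,b_{i+1}=a_{i+1}$, $b_i>a_i$. $\mathrm{lm}_{<_{ds}}(f)$ is the $<_{ds}$-largest monomial occurring in $f$. A finite subset $G$ of $I$ is a minimal Gröbner basis of $I$ if the leading monomials of its elements are distinct and form the minimal monomial generating set of the monomial ideal generated by $\{\mathrm{lm}_{<_{ds}}(f): 0\ne f\in I\}$. *)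

theory Defs
  imports
    "HOL-Library.Poly_Mapping"
    "HOL-Library.Extended_Nat"
    "HOL-Computational_Algebra.Polynomial"
    "HOL-Algebra.QuotRing"
    "HOL-Algebra.Ideal_Product"
    "HOL-Algebra.Ring_Divisibility"
    "HOL-Algebra.Algebraic_Closure_Type"
begin

definition submonoid_of_nat :: "nat set \<Rightarrow> bool" where
  "submonoid_of_nat M \<longleftrightarrow> 0 \<in> M \<and> (\<forall>x\<in>M. \<forall>y\<in>M. x + y \<in> M)"

definition numerical_semigroup :: "nat set \<Rightarrow> bool" where
  "numerical_semigroup S \<longleftrightarrow> submonoid_of_nat S \<and> finite (- S)"

text \<open>Minimality is stated for the indexed family \<open>n 1, \<dots>, n d\<close>: no proper subfamily generates
  \<open>S\<close>, so in particular the \<open>n i\<close> are pairwise distinct and nonzero.\<close>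

definition minimally_generated :: "nat set \<Rightarrow> nat \<Rightarrow> (nat \<Rightarrow> nat) \<Rightarrow> bool" where
  "minimally_generated S d n \<longleftrightarrow>
     submonoid_of_nat hull (n ` {1..d}) = S \<and>
     (\<forall>J. J \<subset> {1..d} \<longrightarrow> submonoid_of_nat hull (n ` J) \<noteq> S)"

text \<open>\<open>x - s \<notin> S\<close> is meant for the difference in the integers, hence not expressed by
  truncated subtraction.\<close>

definition apery :: "nat set \<Rightarrow> nat \<Rightarrow> nat set" where
  "apery S s = {x \<in> S. \<not> (\<exists>y\<in>S. x = y + s)}"

definition exps :: "nat \<Rightarrow> (nat \<Rightarrow>\<^sub>0 nat) set" where
  "exps d = {a. Poly_Mapping.keys a \<subseteq> {1..d}}"

definition total_deg :: "nat \<Rightarrow> (nat \<Rightarrow>\<^sub>0 nat) \<Rightarrow> nat" where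
  "total_deg d a = (\<Sum>i=1..d. Poly_Mapping.lookup a i)"

definition weight :: "nat \<Rightarrow> (nat \<Rightarrow> nat) \<Rightarrow> (nat \<Rightarrow>\<^sub>0 nat) \<Rightarrow> nat" where
  "weight d n a = (\<Sum>i=1..d. Poly_Mapping.lookup a i * n i)"

definition factorizations :: "nat \<Rightarrow> (nat \<Rightarrow> nat) \<Rightarrow> nat \<Rightarrow> (nat \<Rightarrow>\<^sub>0 nat) set" where
  "factorizations d n s = {a \<in> exps d. weight d n a = s}"

definition maximal_factorization ::
    "nat \<Rightarrow> (nat \<Rightarrow> nat) \<Rightarrow> nat \<Rightarrow> (nat \<Rightarrow>\<^sub>0 nat) \<Rightarrow> bool" where
  "maximal_factorization d n s a \<longleftrightarrow>
     a \<in> factorizations d n s \<and> (\<forall>c\<in>factorizations d n s. total_deg d c \<le> total_deg d a)"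

definition drop_first :: "(nat \<Rightarrow>\<^sub>0 nat) \<Rightarrow> (nat \<Rightarrow>\<^sub>0 nat)" where
  "drop_first b =
     (if Poly_Mapping.lookup b 1 = 0 then b else b - Poly_Mapping.single 1 1)"

definition homogeneous_subset :: "nat \<Rightarrow> (nat \<Rightarrow> nat) \<Rightarrow> nat set \<Rightarrow> bool" where
  "homogeneous_subset d n T \<longleftrightarrow>
     (\<forall>s\<in>T. s \<noteq> 0 \<longrightarrow>
        (\<forall>a\<in>factorizations d n s. \<forall>b\<in>factorizations d n s. total_deg d a = total_deg d b))"

definition homogeneous_semigroup :: "nat set \<Rightarrow> nat \<Rightarrow> (nat \<Rightarrow> nat) \<Rightarrow> bool" where
  "homogeneous_semigroup S d n \<longleftrightarrow> homogeneous_subset d n (apery S (n 1))"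

type_synonym 'k mpol = "(nat \<Rightarrow>\<^sub>0 nat) \<Rightarrow>\<^sub>0 'k"

definition mpol_ring :: "nat \<Rightarrow> ('k::field) mpol ring" where
  "mpol_ring d = ring_of_type_algebra\<lparr>carrier := {f. Poly_Mapping.keys f \<subseteq> exps d}\<rparr>"

definition xpow :: "(nat \<Rightarrow>\<^sub>0 nat) \<Rightarrow> ('k::field) mpol" where
  "xpow a = Poly_Mapping.single a 1"

text \<open>The homomorphism to \<open>k[t]\<close> sending \<open>x_i\<close> to \<open>t^(n i)\<close>.\<close>

definition toric_hom :: "nat \<Rightarrow> (nat \<Rightarrow> nat) \<Rightarrow> ('k::field) mpol \<Rightarrow> 'k poly" where
  "toric_hom d n f =
     (\<Sum>a\<in>Poly_Mapping.keys f. Polynomial.smult (Poly_Mapping.lookup f a)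
        (\<Prod>i=1..d. Polynomial.monom 1 (n i) ^ Poly_Mapping.lookup a i))"

definition semigroup_ideal :: "nat \<Rightarrow> (nat \<Rightarrow> nat) \<Rightarrow> ('k::field) mpol set" where
  "semigroup_ideal d n = a_kernel (mpol_ring d) ring_of_type_algebra (toric_hom d n)"

definition is_binomial :: "nat \<Rightarrow> ('k::field) mpol \<Rightarrow> bool" where
  "is_binomial d f \<longleftrightarrow> (\<exists>a\<in>exps d. \<exists>b\<in>exps d. f = xpow a - xpow b)"

definition binomial_support :: "nat \<Rightarrow> (nat \<Rightarrow>\<^sub>0 nat) \<Rightarrow> (nat \<Rightarrow>\<^sub>0 nat) \<Rightarrow> nat set" where
  "binomial_support d a b =
     {i \<in> {1..d}. Poly_Mapping.lookup a i + Poly_Mapping.lookup b i \<noteq> 0}"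

definition homogeneous_mpol :: "nat \<Rightarrow> ('k::field) mpol \<Rightarrow> bool" where
  "homogeneous_mpol d f \<longleftrightarrow> (\<exists>m. \<forall>a\<in>Poly_Mapping.keys f. total_deg d a = m)"

definition minimal_generating_set :: "('a, 'b) ring_scheme \<Rightarrow> 'a set \<Rightarrow> 'a set \<Rightarrow> bool" where
  "minimal_generating_set R E I \<longleftrightarrow>
     E \<subseteq> carrier R \<and> Idl\<^bsub>R\<^esub> E = I \<and> (\<forall>E'. E' \<subset> E \<longrightarrow> Idl\<^bsub>R\<^esub> E' \<noteq> I)"

definition hom_component :: "nat \<Rightarrow> nat \<Rightarrow> ('k::field) mpol \<Rightarrow> 'k mpol" where
  "hom_component d m f =
     (\<Sum>a\<in>{a \<in> Poly_Mapping.keys f. total_deg d a = m}.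
        Poly_Mapping.single a (Poly_Mapping.lookup f a))"

text \<open>Only meaningful for nonzero \<open>f\<close>.\<close>

definition initial_form :: "nat \<Rightarrow> ('k::field) mpol \<Rightarrow> 'k mpol" where
  "initial_form d f = hom_component d (Min (total_deg d ` Poly_Mapping.keys f)) f"

definition initial_ideal :: "nat \<Rightarrow> ('k::field) mpol set \<Rightarrow> 'k mpol set" where
  "initial_ideal d I = Idl\<^bsub>mpol_ring d\<^esub> (initial_form d ` (I - {0}))"

definition standard_basis :: "nat \<Rightarrow> ('k::field) mpol set \<Rightarrow> 'k mpol set \<Rightarrow> bool" where
  "standard_basis d I F \<longleftrightarrow>
     finite F \<and> F \<subseteq> I - {0} \<and> Idl\<^bsub>mpol_ring d\<^esub> (initial_form d ` F) = initial_ideal d I"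

definition ds_less :: "nat \<Rightarrow> (nat \<Rightarrow>\<^sub>0 nat) \<Rightarrow> (nat \<Rightarrow>\<^sub>0 nat) \<Rightarrow> bool" where
  "ds_less d b a \<longleftrightarrow>
     total_deg d b > total_deg d a \<or>
     (total_deg d b = total_deg d a \<and> Poly_Mapping.lookup b 1 > Poly_Mapping.lookup a 1) \<or>
     (total_deg d b = total_deg d a \<and> Poly_Mapping.lookup b 1 = Poly_Mapping.lookup a 1 \<and>
      (\<exists>i\<in>{2..d}. (\<forall>j\<in>{i<..d}. Poly_Mapping.lookup b j = Poly_Mapping.lookup a j) \<and>
         Poly_Mapping.lookup b i > Poly_Mapping.lookup a i))"

text \<open>The exponent of the leading monomial; only meaningful for nonzero \<open>f\<close>.\<close>

definition lead_exp :: "nat \<Rightarrow> ('k::field) mpol \<Rightarrow> (nat \<Rightarrow>\<^sub>0 nat)" where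
  "lead_exp d f =
     (THE a. a \<in> Poly_Mapping.keys f \<and> (\<forall>b\<in>Poly_Mapping.keys f. b \<noteq> a \<longrightarrow> ds_less d b a))"

definition lead_mon :: "nat \<Rightarrow> ('k::field) mpol \<Rightarrow> 'k mpol" where
  "lead_mon d f = xpow (lead_exp d f)"

definition minimal_groebner_basis :: "nat \<Rightarrow> ('k::field) mpol set \<Rightarrow> 'k mpol set \<Rightarrow> bool" where
  "minimal_groebner_basis d I G \<longleftrightarrow>
     finite G \<and> G \<subseteq> I - {0} \<and> inj_on (lead_mon d) G \<and>
     minimal_generating_set (mpol_ring d) (lead_mon d ` G)
       (Idl\<^bsub>mpol_ring d\<^esub> (lead_mon d ` (I - {0})))"

definition regular_sequence :: "('a, 'b) ring_scheme \<Rightarrow> 'a list \<Rightarrow> bool" where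
  "regular_sequence R xs \<longleftrightarrow>
     set xs \<subseteq> carrier R \<and> Idl\<^bsub>R\<^esub> (set xs) \<noteq> carrier R \<and>
     (\<forall>i<length xs. \<forall>y\<in>carrier R.
        xs ! i \<otimes>\<^bsub>R\<^esub> y \<in> Idl\<^bsub>R\<^esub> (set (take i xs)) \<longrightarrow> y \<in> Idl\<^bsub>R\<^esub> (set (take i xs)))"

definition ideal_depth :: "('a, 'b) ring_scheme \<Rightarrow> 'a set \<Rightarrow> enat" where
  "ideal_depth R I = Sup {enat (length xs) | xs. regular_sequence R xs \<and> set xs \<subseteq> I}"

definition prime_height :: "('a, 'b) ring_scheme \<Rightarrow> 'a set \<Rightarrow> enat" where
  "prime_height R P =
     Sup {enat l | l. \<exists>Q :: nat \<Rightarrow> 'a set. (\<forall>i\<le>l. primeideal (Q i) R) \<and>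
                        (\<forall>i<l. Q i \<subset> Q (Suc i)) \<and> Q l = P}"

text \<open>The definition for arbitrary Noetherian rings in Eisenbud, Commutative Algebra, Section 18.2;
  for a maximal ideal \<open>M\<close> the two numbers are the depth and the dimension of the localization
  at \<open>M\<close>.\<close>

definition cohen_macaulay :: "('a, 'b) ring_scheme \<Rightarrow> bool" where
  "cohen_macaulay R \<longleftrightarrow> cring R \<and> noetherian_ring R \<and>
     (\<forall>M. maximalideal M R \<longrightarrow> ideal_depth R M = prime_height R M)"

primrec ideal_pow :: "('a, 'b) ring_scheme \<Rightarrow> 'a set \<Rightarrow> nat \<Rightarrow> 'a set" where
  "ideal_pow R I 0 = carrier R"
| "ideal_pow R I (Suc m) = ideal_prod R I (ideal_pow R I m)"

text \<open>An element of the associated graded ring is the family of its homogeneous components, the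
  \<open>m\<close>-th one being a coset of \<open>I^(m+1)\<close> in \<open>I^m\<close>. As in \<^const>\<open>rcoset_mult\<close>, the product is
  the union over all representatives, all of which contribute the same coset.\<close>

definition graded_piece :: "('a, 'b) ring_scheme \<Rightarrow> 'a set \<Rightarrow> nat \<Rightarrow> 'a set set" where
  "graded_piece R I m = (\<lambda>x. ideal_pow R I (Suc m) +>\<^bsub>R\<^esub> x) ` ideal_pow R I m"

definition assoc_graded_ring :: "('a, 'b) ring_scheme \<Rightarrow> 'a set \<Rightarrow> (nat \<Rightarrow> 'a set) ring" where
  "assoc_graded_ring R I =
     \<lparr>carrier = {g. (\<forall>m. g m \<in> graded_piece R I m) \<and> finite {m. g m \<noteq> ideal_pow R I (Suc m)}},
      monoid.mult = (\<lambda>g h m. \<Union>a\<in>Pi UNIV g. \<Union>b\<in>Pi UNIV h.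
                ideal_pow R I (Suc m) +>\<^bsub>R\<^esub> (\<Oplus>\<^bsub>R\<^esub>i\<in>{..m}. a i \<otimes>\<^bsub>R\<^esub> b (m - i))),
      one = (\<lambda>m. if m = 0 then ideal_pow R I (Suc 0) +>\<^bsub>R\<^esub> \<one>\<^bsub>R\<^esub> else ideal_pow R I (Suc m)),
      ring.zero = (\<lambda>m. ideal_pow R I (Suc m)),
      add = (\<lambda>g h m. g m <+>\<^bsub>R\<^esub> h m)\<rparr>"

definition semigroup_ring :: "nat set \<Rightarrow> ('k::field) poly ring" where
  "semigroup_ring S = ring_of_type_algebra\<lparr>carrier := {p. \<forall>s. Polynomial.coeff p s \<noteq> 0 \<longrightarrow> s \<in> S}\<rparr>"

definition semigroup_assoc_graded ::
    "nat set \<Rightarrow> nat \<Rightarrow> (nat \<Rightarrow> nat) \<Rightarrow> (nat \<Rightarrow> ('k::field) poly set) ring" where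
  "semigroup_assoc_graded S d n =
     assoc_graded_ring (semigroup_ring S)
       (Idl\<^bsub>semigroup_ring S\<^esub> ((\<lambda>i. Polynomial.monom 1 (n i)) ` {1..d}))"

end

theory Submission
  imports Defs
begin

text \<open>Let \<open>ord s\<close> be the maximal length of a factorization of \<open>s\<close>. All five conditions are compared
  with the conjunction of homogeneity of the Apery set and \<open>ord (s + n 1) = ord s + 1\<close> for all
  \<open>s \<in> S\<close>, which is an elementary reformulation of (2).

  For (1), the associated graded ring \<open>G\<close> has the classes \<open>e s\<close> of \<open>t\<^sup>s\<close> as a basis, and \<open>e s\<close> is
  nilpotent unless \<open>s\<close> is a multiple of \<open>n 1\<close>, because \<open>n 1\<close> copies of \<open>x\<^sub>i\<close> can be traded for the
  larger number \<open>n i\<close> of copies of \<open>x\<^sub>1\<close>. So \<open>G = k[y] \<oplus> N\<close> with \<open>y = e (n 1)\<close> and \<open>N\<close> nil; all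
  maximal ideals have height 1, and \<open>G\<close> is Cohen-Macaulay iff \<open>y\<close> is a nonzerodivisor.

  For (3) \<open>\<Longrightarrow>\<close> (2) and for the standard basis property, two factorizations of \<open>s\<close> are joined by
  moves along the generators, and the first move that changes the length involves \<open>x\<^sub>1\<close> on the longer
  side. For (2) \<open>\<Longrightarrow>\<close> (5), the leading monomials are the factorizations that are not least in their
  fibre, and the minimal ones among these do not involve \<open>x\<^sub>1\<close>.\<close>

subsection \<open>Evaluation of polynomial mappings\<close>

text \<open>An ideal is bounded from above by linear functionals that annihilate it
  (\<open>pm_eval\<close>) and from below by rewriting monomials inside one fibre of
  \<open>weight\<close>; finiteness of the fibres replaces well-foundedness.

  Condition (3) does not make \<open>E\<close> finite, whereas a standard basis has to be.
  Finiteness is recovered after the combinatorial condition has been deduced, because that condition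
  yields a finite Groebner basis.

  The field is arbitrary and the Cohen-Macaulay property is tested at every maximal ideal of
  \<open>G\<close>, not only at the irrelevant one. Primes of \<open>G\<close> are determined by
  their contraction to \<open>k[y]\<close>; this settles the heights, and a computation with powers
  bounds the depth. From Cohen-Macaulay to regularity the maximal ideal over \<open>y = 0\<close>
  suffices. Conversely, every nonzero element of \<open>k[y]\<close> has to act injectively on
  \<open>G\<close>, and Noetherianity has to be proved as well: under regularity \<open>G\<close> is
  spanned over \<open>k[y]\<close> by the classes of the finite Apery set.\<close>

definition pm_eval :: "('k::zero \<Rightarrow> 'b::comm_semiring_1) \<Rightarrow> ('a \<Rightarrow> 'b) \<Rightarrow> ('a \<Rightarrow>\<^sub>0 'k) \<Rightarrow> 'b" where
  "pm_eval c h f = (\<Sum>a\<in>Poly_Mapping.keys f. c (Poly_Mapping.lookup f a) * h a)"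

lemma pm_eval_superset:
  assumes "finite A" "Poly_Mapping.keys f \<subseteq> A" "c 0 = 0"
  shows "pm_eval c h f = (\<Sum>a\<in>A. c (Poly_Mapping.lookup f a) * h a)"
  unfolding pm_eval_def using assms by (intro sum.mono_neutral_left) (auto simp: in_keys_iff)

lemma pm_eval_zero [simp]: "pm_eval c h 0 = 0"
  by (simp add: pm_eval_def)

lemma pm_eval_single: "c 0 = 0 \<Longrightarrow> pm_eval c h (Poly_Mapping.single a k) = c k * h a"
  by (simp add: pm_eval_def)

lemma pm_eval_add:
  assumes "c 0 = 0" "\<And>x y. c (x + y) = c x + c y"
  shows "pm_eval c h (f + g) = pm_eval c h f + pm_eval c h g"
proof -
  let ?A = "Poly_Mapping.keys f \<union> Poly_Mapping.keys g"
  have "pm_eval c h (f + g) = (\<Sum>a\<in>?A. c (Poly_Mapping.lookup (f + g) a) * h a)"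
    using assms(1) keys_add[of f g] by (intro pm_eval_superset) auto
  also have "\<dots> = pm_eval c h f + pm_eval c h g"
    using assms pm_eval_superset[of ?A f c h] pm_eval_superset[of ?A g c h]
    by (simp add: lookup_add distrib_right sum.distrib)
  finally show ?thesis .
qed

lemma pm_eval_sum:
  assumes "c 0 = 0" "\<And>x y. c (x + y) = c x + c y"
  shows "pm_eval c h (sum F A) = (\<Sum>x\<in>A. pm_eval c h (F x))"
  by (induction A rule: infinite_finite_induct) (simp_all add: pm_eval_add[OF assms])

lemma pm_sum_monomials:
  "(\<Sum>a\<in>Poly_Mapping.keys f. Poly_Mapping.single a (Poly_Mapping.lookup f a)) = f"
proof (rule poly_mapping_eqI)
  fix k
  have "(\<Sum>a\<in>Poly_Mapping.keys f. Poly_Mapping.lookup f a when a = k) = Poly_Mapping.lookup f k"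
  proof (cases "k \<in> Poly_Mapping.keys f")
    case True
    then have "(\<Sum>a\<in>Poly_Mapping.keys f. Poly_Mapping.lookup f a when a = k) =
        (\<Sum>a\<in>{k}. Poly_Mapping.lookup f a when a = k)"
      by (intro sum.mono_neutral_right) auto
    then show ?thesis by simp
  next
    case False
    then have "(\<Sum>a\<in>Poly_Mapping.keys f. Poly_Mapping.lookup f a when a = k) = 0"
      by (intro sum.neutral) (auto simp: when_def)
    then show ?thesis using False by (simp add: in_keys_iff)
  qed
  then show "Poly_Mapping.lookup
      (\<Sum>a\<in>Poly_Mapping.keys f. Poly_Mapping.single a (Poly_Mapping.lookup f a)) k = Poly_Mapping.lookup f k"
    by (simp add: lookup_sum lookup_single)
qed

text \<open>The monomial case is asked for only at the terms of the given \<open>f\<close>, so that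
  assumptions on its keys remain usable inside the induction.\<close>

lemma pm_induct:
  fixes f :: "'a \<Rightarrow>\<^sub>0 'b::comm_monoid_add"
  assumes "P 0" "\<And>f g. P f \<Longrightarrow> P g \<Longrightarrow> P (f + g)" "\<And>a. a \<in> Poly_Mapping.keys f \<Longrightarrow> P (Poly_Mapping.single a (Poly_Mapping.lookup f a))"
  shows "P f"
proof -
  have "P (\<Sum>a\<in>A. Poly_Mapping.single a (Poly_Mapping.lookup f a))" if "A \<subseteq> Poly_Mapping.keys f" for A
    using that by (induction A rule: infinite_finite_induct) (simp_all add: assms)
  from this[OF order_refl] show ?thesis by (simp only: pm_sum_monomials)
qed

text \<open>This covers the evaluations that serve as ring homomorphisms, \<open>bigraded\<close>
  and \<open>axis_part\<close>; there \<open>c\<close> embeds constants and \<open>h\<close> turns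
  addition of exponents into multiplication.\<close>

lemma pm_eval_mult:
  fixes f g :: "'a::comm_monoid_add \<Rightarrow>\<^sub>0 'k::comm_semiring_1"
  assumes c: "c 0 = 0" "\<And>x y. c (x + y) = c x + c y" "\<And>x y. c (x * y) = c x * c y"
    and h: "\<And>a b. h (a + b) = h a * h b"
  shows "pm_eval c h (f * g) = pm_eval c h f * pm_eval c h g"
proof -
  let ?F = "Poly_Mapping.keys f" and ?G = "Poly_Mapping.keys g"
  have "f * g = (\<Sum>a\<in>?F. \<Sum>b\<in>?G.
      Poly_Mapping.single (a + b) (Poly_Mapping.lookup f a * Poly_Mapping.lookup g b))"
    by (subst pm_sum_monomials[of f, symmetric], subst pm_sum_monomials[of g, symmetric])
      (simp add: sum_product mult_single)
  then have "pm_eval c h (f * g) = (\<Sum>a\<in>?F. \<Sum>b\<in>?G.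
      c (Poly_Mapping.lookup f a) * h a * (c (Poly_Mapping.lookup g b) * h b))"
    by (simp add: pm_eval_sum[OF c(1,2)] pm_eval_single c h mult_ac)
  also have "\<dots> = pm_eval c h f * pm_eval c h g"
    by (simp add: pm_eval_def sum_product)
  finally show ?thesis .
qed

text \<open>Multiplying by a monomial translates the functional. Hence a family of functionals
  closed under translation has an ideal as its common kernel.\<close>

lemma pm_eval_id_mult_single:
  fixes f :: "'a::comm_monoid_add \<Rightarrow>\<^sub>0 'k::comm_semiring_1"
  shows "pm_eval (\<lambda>x. x) h (Poly_Mapping.single m c * f) = c * pm_eval (\<lambda>x. x) (\<lambda>a. h (m + a)) f"
proof -
  have "Poly_Mapping.single m c * f = (\<Sum>a\<in>Poly_Mapping.keys f.
      Poly_Mapping.single (m + a) (c * Poly_Mapping.lookup f a))"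
    by (subst pm_sum_monomials[of f, symmetric]) (simp add: sum_distrib_left mult_single)
  then show ?thesis
    by (simp add: pm_eval_sum pm_eval_single) (simp add: pm_eval_def sum_distrib_left mult_ac)
qed

subsection \<open>The polynomial ring and its ideals\<close>

lemma ring_of_type_algebra_simps [simp]:
  "carrier (ring_of_type_algebra :: 'a::ring_1 ring) = UNIV"
  "monoid.mult (ring_of_type_algebra :: 'a ring) = (*)"
  "monoid.one (ring_of_type_algebra :: 'a ring) = 1"
  "ring.zero (ring_of_type_algebra :: 'a ring) = 0"
  "ring.add (ring_of_type_algebra :: 'a ring) = (+)"
  by (simp_all add: ring_of_type_algebra_def)

lemma mpol_ring_simps [simp]:
  "carrier (mpol_ring d :: ('k::field) mpol ring) = {f. Poly_Mapping.keys f \<subseteq> exps d}"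
  "monoid.mult (mpol_ring d :: 'k mpol ring) = (*)"
  "monoid.one (mpol_ring d :: 'k mpol ring) = 1"
  "ring.zero (mpol_ring d :: 'k mpol ring) = 0"
  "ring.add (mpol_ring d :: 'k mpol ring) = (+)"
  by (simp_all add: mpol_ring_def)

lemma zero_in_exps [simp]: "0 \<in> exps d"
  by (simp add: exps_def)

lemma keys_add_nat:
  fixes a b :: "'a \<Rightarrow>\<^sub>0 nat"
  shows "Poly_Mapping.keys (a + b) = Poly_Mapping.keys a \<union> Poly_Mapping.keys b"
  by (auto simp: in_keys_iff lookup_add)

lemma add_in_exps_iff [simp]: "a + b \<in> exps d \<longleftrightarrow> a \<in> exps d \<and> b \<in> exps d"
  by (auto simp: exps_def keys_add_nat)

lemma single_in_exps [simp]: "i \<in> {1..d} \<Longrightarrow> Poly_Mapping.single i k \<in> exps d"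
  by (auto simp: exps_def)

lemma cring_mpol_ring: "cring (mpol_ring d :: ('k::field) mpol ring)"
proof (rule cringI)
  show "abelian_group (mpol_ring d :: 'k mpol ring)"
  proof (rule abelian_groupI)
    fix x y :: "'k mpol"
    assume "x \<in> carrier (mpol_ring d)" "y \<in> carrier (mpol_ring d)"
    then show "x \<oplus>\<^bsub>mpol_ring d\<^esub> y \<in> carrier (mpol_ring d)"
      using keys_add[of x y] by auto
  next
    fix x :: "'k mpol"
    assume "x \<in> carrier (mpol_ring d)"
    then show "\<exists>y\<in>carrier (mpol_ring d). y \<oplus>\<^bsub>mpol_ring d\<^esub> x = \<zero>\<^bsub>mpol_ring d\<^esub>"
      by (intro bexI[of _ "- x"]) (auto simp: in_keys_iff)
  qed (auto simp: add_ac)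
  show "comm_monoid (mpol_ring d :: 'k mpol ring)"
  proof (rule comm_monoidI)
    fix x y :: "'k mpol"
    assume "x \<in> carrier (mpol_ring d)" "y \<in> carrier (mpol_ring d)"
    then show "x \<otimes>\<^bsub>mpol_ring d\<^esub> y \<in> carrier (mpol_ring d)"
      using keys_mult[of x y] by auto fastforce
  qed (auto simp: mult_ac)
qed (auto simp: distrib_right)

lemma mpol_ideal_add:
  assumes "ideal K (mpol_ring d :: ('k::field) mpol ring)" "f \<in> K" "g \<in> K"
  shows "f + g \<in> K"
  using additive_subgroup.a_closed[OF ideal.axioms(1)[OF assms(1)] assms(2,3)] by simp

lemma mpol_ideal_zero: "ideal K (mpol_ring d :: ('k::field) mpol ring) \<Longrightarrow> 0 \<in> K"
  using additive_subgroup.zero_closed[OF ideal.axioms(1)] by fastforce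

lemma mpol_ideal_mult:
  assumes "ideal K (mpol_ring d :: ('k::field) mpol ring)" "f \<in> K" "Poly_Mapping.keys g \<subseteq> exps d"
  shows "g * f \<in> K"
  using ideal.I_l_closed[OF assms(1,2), of g] assms(3) by simp

lemma mpol_ideal_single:
  assumes "ideal K (mpol_ring d :: ('k::field) mpol ring)" "f \<in> K" "a \<in> exps d"
  shows "Poly_Mapping.single a c * f \<in> K"
  using assms by (intro mpol_ideal_mult) (auto)

lemma mpol_ideal_scale:
  assumes "ideal K (mpol_ring d :: ('k::field) mpol ring)" "f \<in> K"
  shows "Poly_Mapping.single 0 c * f \<in> K"
  using assms by (intro mpol_ideal_single) auto

lemma mpol_ideal_uminus:
  assumes "ideal K (mpol_ring d :: ('k::field) mpol ring)" "f \<in> K"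
  shows "- f \<in> K"
proof -
  have "Poly_Mapping.single 0 (-1) = (- 1 :: 'k mpol)"
    by (simp add: single_uminus)
  then show ?thesis using mpol_ideal_scale[OF assms, of "-1"] by simp
qed

lemma mpol_ideal_sum:
  assumes "ideal K (mpol_ring d :: ('k::field) mpol ring)" "\<And>x. x \<in> A \<Longrightarrow> F x \<in> K"
  shows "sum F A \<in> K"
  using assms(2)
  by (induction A rule: infinite_finite_induct)
    (auto intro: mpol_ideal_zero[OF assms(1)] mpol_ideal_add[OF assms(1)])

text \<open>Every polynomial is a sum of terms, so closure under multiplication by single terms
  suffices; negation is multiplication by the constant -1.\<close>

lemma mpol_idealI:
  fixes K :: "('k::field) mpol set"
  assumes carr: "\<And>f. f \<in> K \<Longrightarrow> Poly_Mapping.keys f \<subseteq> exps d"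
    and zero: "0 \<in> K" and add: "\<And>f g. f \<in> K \<Longrightarrow> g \<in> K \<Longrightarrow> f + g \<in> K"
    and single: "\<And>f a c. f \<in> K \<Longrightarrow> a \<in> exps d \<Longrightarrow> Poly_Mapping.single a c * f \<in> K"
  shows "ideal K (mpol_ring d)"
proof -
  interpret P: cring "mpol_ring d :: 'k mpol ring" by (rule cring_mpol_ring)
  have mult: "g * f \<in> K" if f: "f \<in> K" and g: "Poly_Mapping.keys g \<subseteq> exps d" for f g
  proof -
    have "g * f = (\<Sum>a\<in>Poly_Mapping.keys g. Poly_Mapping.single a (Poly_Mapping.lookup g a) * f)"
      by (subst pm_sum_monomials[of g, symmetric]) (simp add: sum_distrib_right)
    moreover have "(\<Sum>a\<in>A. Poly_Mapping.single a (Poly_Mapping.lookup g a) * f) \<in> K"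
      if "A \<subseteq> exps d" for A
      using that by (induction A rule: infinite_finite_induct) (auto intro: zero add single f)
    ultimately show ?thesis using g by metis
  qed
  have um: "- f \<in> K" if "f \<in> K" for f
  proof -
    have "Poly_Mapping.single 0 (-1) = (- 1 :: 'k mpol)"
      by (simp add: single_uminus)
    then show ?thesis using single[OF that, of 0 "-1"] by simp
  qed
  show ?thesis
  proof (rule idealI[OF P.ring_axioms])
    have inv: "inv\<^bsub>add_monoid (mpol_ring d)\<^esub> f = - f" if "f \<in> K" for f
      using carr[OF that] carr[OF um[OF that]] P.minus_equality[of "- f" f]
      by (simp add: a_inv_def)
    show "subgroup K (add_monoid (mpol_ring d))"
      by (rule subgroup.intro) (use carr zero add um inv in auto)
  qed (use mult in \<open>auto simp: mult.commute\<close>)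
qed

lemma mpol_Idl_ideal:
  assumes "E \<subseteq> carrier (mpol_ring d :: ('k::field) mpol ring)"
  shows "ideal (Idl\<^bsub>mpol_ring d\<^esub> E) (mpol_ring d)"
  by (rule ring.genideal_ideal[OF cring.axioms(1)[OF cring_mpol_ring] assms])

lemma mpol_Idl_self:
  assumes "E \<subseteq> carrier (mpol_ring d :: ('k::field) mpol ring)" "f \<in> E"
  shows "f \<in> Idl\<^bsub>mpol_ring d\<^esub> E"
  using ring.genideal_self[OF cring.axioms(1)[OF cring_mpol_ring] assms(1)] assms(2) by blast

lemma mpol_Idl_minimal:
  assumes "ideal K (mpol_ring d :: ('k::field) mpol ring)" "E \<subseteq> K"
  shows "Idl\<^bsub>mpol_ring d\<^esub> E \<subseteq> K"
  by (rule ring.genideal_minimal[OF cring.axioms(1)[OF cring_mpol_ring] assms])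

lemma mpol_Idl_mono:
  assumes "F \<subseteq> carrier (mpol_ring d :: ('k::field) mpol ring)" "E \<subseteq> F"
  shows "Idl\<^bsub>mpol_ring d\<^esub> E \<subseteq> Idl\<^bsub>mpol_ring d\<^esub> F"
  by (rule mpol_Idl_minimal[OF mpol_Idl_ideal[OF assms(1)]])
    (use assms mpol_Idl_self[OF assms(1)] in blast)

text \<open>The elements generated by finite subsets of \<open>E\<close> already form an ideal
  containing \<open>E\<close>. Needed because a minimal generating set is not finite by
  definition.\<close>

lemma mpol_Idl_finite_subset:
  fixes E :: "('k::field) mpol set"
  assumes E: "E \<subseteq> carrier (mpol_ring d)" and f: "f \<in> Idl\<^bsub>mpol_ring d\<^esub> E"
  shows "\<exists>F. finite F \<and> F \<subseteq> E \<and> f \<in> Idl\<^bsub>mpol_ring d\<^esub> F"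
proof -
  let ?K = "{f. \<exists>F. finite F \<and> F \<subseteq> E \<and> f \<in> Idl\<^bsub>mpol_ring d\<^esub> F}"
  have idl: "ideal (Idl\<^bsub>mpol_ring d\<^esub> F) (mpol_ring d)" if "F \<subseteq> E" for F
    using that E by (intro mpol_Idl_ideal) auto
  have "ideal ?K (mpol_ring d)"
  proof (rule mpol_idealI)
    fix f assume "f \<in> ?K"
    then obtain F where "F \<subseteq> E" "f \<in> Idl\<^bsub>mpol_ring d\<^esub> F" by blast
    then show "Poly_Mapping.keys f \<subseteq> exps d"
      using ideal.Icarr[OF idl, of F f] by simp
  next
    show "0 \<in> ?K" using mpol_ideal_zero[OF idl, of "{}"] by blast
  next
    fix f g assume "f \<in> ?K" "g \<in> ?K"
    then obtain F G where F: "finite F" "F \<subseteq> E" "f \<in> Idl\<^bsub>mpol_ring d\<^esub> F"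
      and G: "finite G" "G \<subseteq> E" "g \<in> Idl\<^bsub>mpol_ring d\<^esub> G" by blast
    have "F \<union> G \<subseteq> E" using F G by blast
    then have sub: "F \<union> G \<subseteq> carrier (mpol_ring d)" using E by (rule subset_trans)
    have "f \<in> Idl\<^bsub>mpol_ring d\<^esub> (F \<union> G)" "g \<in> Idl\<^bsub>mpol_ring d\<^esub> (F \<union> G)"
      using mpol_Idl_mono[OF sub, of F] mpol_Idl_mono[OF sub, of G] F(3) G(3) by blast+
    then have "f + g \<in> Idl\<^bsub>mpol_ring d\<^esub> (F \<union> G)"
      by (rule mpol_ideal_add[OF idl[OF \<open>F \<union> G \<subseteq> E\<close>]])
    then show "f + g \<in> ?K" using F(1) G(1) \<open>F \<union> G \<subseteq> E\<close> by blast
  next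
    fix f a c assume "f \<in> ?K" and a: "a \<in> exps d"
    then obtain F where F: "finite F" "F \<subseteq> E" "f \<in> Idl\<^bsub>mpol_ring d\<^esub> F" by blast
    have "Poly_Mapping.single a c * f \<in> Idl\<^bsub>mpol_ring d\<^esub> F"
      by (rule mpol_ideal_single[OF idl[OF F(2)] F(3) a])
    then show "Poly_Mapping.single a c * f \<in> ?K" using F by blast
  qed
  moreover have "E \<subseteq> ?K"
  proof
    fix f assume "f \<in> E"
    then have "f \<in> Idl\<^bsub>mpol_ring d\<^esub> {f}" using E by (intro mpol_Idl_self) auto
    then show "f \<in> ?K" using \<open>f \<in> E\<close> by blast
  qed
  ultimately have "Idl\<^bsub>mpol_ring d\<^esub> E \<subseteq> ?K" by (rule mpol_Idl_minimal)
  then show ?thesis using f by blast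
qed

lemma keys_xpow [simp]: "Poly_Mapping.keys (xpow a :: ('k::field) mpol) = {a}"
  by (simp add: xpow_def)

lemma lookup_xpow: "Poly_Mapping.lookup (xpow a :: ('k::field) mpol) b = (if a = b then 1 else 0)"
  by (simp add: xpow_def lookup_single when_def)

lemma xpow_eq_iff [simp]: "xpow a = (xpow b :: ('k::field) mpol) \<longleftrightarrow> a = b"
  by (metis keys_xpow singleton_inject)

lemma keys_binomial: "a \<noteq> b \<Longrightarrow> Poly_Mapping.keys (xpow a - xpow b :: ('k::field) mpol) = {a, b}"
  by (auto simp: in_keys_iff lookup_minus lookup_xpow split: if_splits)

lemma keys_binomial_subset: "Poly_Mapping.keys (xpow a - xpow b :: ('k::field) mpol) \<subseteq> {a, b}"
  by (cases "a = b") (auto simp: keys_binomial)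

lemma xpow_add: "xpow (a + b) = xpow a * (xpow b :: ('k::field) mpol)"
  by (simp add: xpow_def mult_single)

lemma xpow_shift_binomial:
  "xpow (m + a) - xpow (m + b) = Poly_Mapping.single m 1 * (xpow a - xpow b :: ('k::field) mpol)"
  by (simp add: xpow_add right_diff_distrib) (simp add: xpow_def)

lemma pm_eval_binomial:
  "pm_eval (\<lambda>x. x) h (xpow a - xpow b :: ('k::field) mpol) = h a - h b"
proof (cases "a = b")
  case False
  then show ?thesis
    by (simp add: pm_eval_def keys_binomial lookup_minus lookup_xpow)
qed simp

lemma binomial_eq_iff:
  assumes "a \<noteq> b" "xpow a - xpow b = (xpow a' - xpow b' :: ('k::field) mpol)"
  shows "{a, b} = {a', b'}"
proof -
  have "a' \<noteq> b'" using assms by auto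
  then show ?thesis using keys_binomial[OF assms(1), where 'k='k] keys_binomial[of a' b', where 'k='k] assms by metis
qed

subsection \<open>Factorizations\<close>

lemma weight_zero [simp]: "weight d n 0 = 0"
  by (simp add: weight_def)

lemma weight_add [simp]: "weight d n (a + b) = weight d n a + weight d n b"
  by (simp add: weight_def lookup_add distrib_right sum.distrib)

lemma weight_single [simp]: "i \<in> {1..d} \<Longrightarrow> weight d n (Poly_Mapping.single i k) = k * n i"
  by (simp add: weight_def lookup_single when_def if_distrib[of "\<lambda>x. x * _"] cong: if_cong)

lemma total_deg_zero [simp]: "total_deg d 0 = 0"
  by (simp add: total_deg_def)

lemma total_deg_add [simp]: "total_deg d (a + b) = total_deg d a + total_deg d b"
  by (simp add: total_deg_def lookup_add sum.distrib)

lemma total_deg_single [simp]: "i \<in> {1..d} \<Longrightarrow> total_deg d (Poly_Mapping.single i k) = k"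
  by (simp add: total_deg_def lookup_single when_def)

lemma exps_eqI:
  assumes "a \<in> exps d" "b \<in> exps d"
    and "\<And>i. i \<in> {1..d} \<Longrightarrow> Poly_Mapping.lookup a i = Poly_Mapping.lookup b i"
  shows "a = b"
proof (rule poly_mapping_eqI)
  fix i
  show "Poly_Mapping.lookup a i = Poly_Mapping.lookup b i"
  proof (cases "i \<in> {1..d}")
    case False
    then have "i \<notin> Poly_Mapping.keys a" "i \<notin> Poly_Mapping.keys b"
      using assms(1,2) by (auto simp: exps_def)
    then show ?thesis by (simp add: in_keys_iff)
  qed (rule assms(3))
qed

lemma minus_single_add:
  fixes a :: "'a \<Rightarrow>\<^sub>0 nat"
  assumes "Poly_Mapping.lookup a i \<noteq> 0"
  shows "a = (a - Poly_Mapping.single i 1) + Poly_Mapping.single i 1"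
  by (rule poly_mapping_eqI) (use assms in \<open>auto simp: lookup_add lookup_minus lookup_single when_def\<close>)

lemma pm_le_iff_add:
  fixes a b :: "'a \<Rightarrow>\<^sub>0 nat"
  assumes "\<And>i. Poly_Mapping.lookup a i \<le> Poly_Mapping.lookup b i"
  shows "b = a + (b - a)"
  by (rule poly_mapping_eqI) (use assms in \<open>auto simp: lookup_add lookup_minus\<close>)

subsection \<open>The local monomial order\<close>

lemma ds_less_irrefl: "\<not> ds_less d a a"
  by (simp add: ds_less_def)

lemma ds_less_trans:
  assumes "ds_less d a b" "ds_less d b c"
  shows "ds_less d a c"
proof -
  consider "total_deg d a > total_deg d c"
    | "total_deg d a = total_deg d c" "Poly_Mapping.lookup a 1 > Poly_Mapping.lookup c 1"
    | i j where "total_deg d a = total_deg d c" "Poly_Mapping.lookup a 1 = Poly_Mapping.lookup c 1"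
      "i \<in> {2..d}" "\<forall>j\<in>{i<..d}. Poly_Mapping.lookup a j = Poly_Mapping.lookup b j"
      "Poly_Mapping.lookup a i > Poly_Mapping.lookup b i"
      "j \<in> {2..d}" "\<forall>i\<in>{j<..d}. Poly_Mapping.lookup b i = Poly_Mapping.lookup c i"
      "Poly_Mapping.lookup b j > Poly_Mapping.lookup c j"
    using assms unfolding ds_less_def by fastforce
  then show ?thesis
  proof cases
    case 3
    \<comment> \<open>Beyond the larger index all three exponents agree, and at the larger index at
      least one of the two comparisons is strict.\<close>
    have "(\<forall>k\<in>{max i j<..d}. Poly_Mapping.lookup a k = Poly_Mapping.lookup c k) \<and>
        Poly_Mapping.lookup a (max i j) > Poly_Mapping.lookup c (max i j)"
      using 3 by (cases i j rule: linorder_cases) (auto simp: max_def)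
    moreover have "max i j \<in> {2..d}" using 3 by auto
    ultimately show ?thesis using 3 unfolding ds_less_def by blast
  qed (auto simp: ds_less_def)
qed

lemma ds_less_total:
  assumes "a \<in> exps d" "b \<in> exps d" "a \<noteq> b"
  shows "ds_less d a b \<or> ds_less d b a"
proof (rule ccontr)
  assume neg: "\<not> ?thesis"
  then have eq: "total_deg d a = total_deg d b" "Poly_Mapping.lookup a 1 = Poly_Mapping.lookup b 1"
    by (auto simp: ds_less_def)
  let ?D = "{i\<in>{1..d}. Poly_Mapping.lookup a i \<noteq> Poly_Mapping.lookup b i}"
  have "?D \<noteq> {}"
    using exps_eqI[OF assms(1,2)] assms(3) by blast
  \<comment> \<open>The last differing variable decides a reverse lexicographic comparison. It is
    not \<open>x_1\<close>, whose exponents agree by \<open>eq\<close>.\<close>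
  define i where "i = Max ?D"
  have i: "i \<in> ?D" unfolding i_def using \<open>?D \<noteq> {}\<close> by (intro Max_in) auto
  have "i \<noteq> 1" using i eq(2) by auto
  then have "i \<in> {2..d}" using i by auto
  have above: "Poly_Mapping.lookup a j = Poly_Mapping.lookup b j" if "j \<in> {i<..d}" for j
  proof (rule ccontr)
    assume "Poly_Mapping.lookup a j \<noteq> Poly_Mapping.lookup b j"
    then have "j \<in> ?D" using that by auto
    then have "j \<le> i" unfolding i_def by (intro Max_ge) auto
    then show False using that by auto
  qed
  have above': "\<forall>j\<in>{i<..d}. Poly_Mapping.lookup a j = Poly_Mapping.lookup b j"
    "\<forall>j\<in>{i<..d}. Poly_Mapping.lookup b j = Poly_Mapping.lookup a j"
    using above by simp_all
  have "\<not> Poly_Mapping.lookup a i > Poly_Mapping.lookup b i" "\<not> Poly_Mapping.lookup b i > Poly_Mapping.lookup a i"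
    using neg above' \<open>i \<in> {2..d}\<close> unfolding ds_less_def eq by blast+
  then show False using i by auto
qed

lemma ds_less_add: "ds_less d (a + c) (b + c) \<longleftrightarrow> ds_less d a b"
  by (auto simp: ds_less_def lookup_add)

lemma ds_less_total_deg: "ds_less d b a \<Longrightarrow> total_deg d b \<ge> total_deg d a"
  by (auto simp: ds_less_def)

text \<open>Restricted to finite sets: smaller means of larger degree, so there are infinite
  descending chains of monomials.\<close>

lemma ds_least_exists:
  assumes "finite A" "A \<noteq> {}" "A \<subseteq> exps d"
  shows "\<exists>a\<in>A. \<forall>b\<in>A. b \<noteq> a \<longrightarrow> ds_less d a b"
  using assms
proof (induction A rule: finite_ne_induct)
  case (insert x F)
  then obtain a where a: "a \<in> F" "\<forall>b\<in>F. b \<noteq> a \<longrightarrow> ds_less d a b" by auto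
  show ?case
  proof (cases "ds_less d a x")
    case True
    then show ?thesis using a by auto
  next
    case False
    have "a \<noteq> x" using insert.hyps a(1) by blast
    then have x: "ds_less d x a" using False ds_less_total[of a d x] a insert.prems by auto
    have "ds_less d x b" if "b \<in> F" for b
      using x a(2) that ds_less_trans[OF x, of b] by (cases "b = a") auto
    then show ?thesis by auto
  qed
qed auto

lemma ds_greatest_exists:
  assumes "finite A" "A \<noteq> {}" "A \<subseteq> exps d"
  shows "\<exists>a\<in>A. \<forall>b\<in>A. b \<noteq> a \<longrightarrow> ds_less d b a"
  using assms
proof (induction A rule: finite_ne_induct)
  case (insert x F)
  then obtain a where a: "a \<in> F" "\<forall>b\<in>F. b \<noteq> a \<longrightarrow> ds_less d b a" by auto
  show ?case
  proof (cases "ds_less d x a")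
    case True
    then show ?thesis using a by auto
  next
    case False
    have "a \<noteq> x" using insert.hyps a(1) by blast
    then have x: "ds_less d a x" using False ds_less_total[of a d x] a insert.prems by auto
    have "ds_less d b x" if "b \<in> F" for b
      using x a(2) that ds_less_trans[OF _ x, of b] by (cases "b = a") auto
    then show ?thesis by auto
  qed
qed auto

lemma lead_exp_eqI:
  assumes "a \<in> Poly_Mapping.keys f" "\<And>b. b \<in> Poly_Mapping.keys f \<Longrightarrow> b \<noteq> a \<Longrightarrow> ds_less d b a"
  shows "lead_exp d f = a"
  unfolding lead_exp_def
proof (rule the_equality)
  fix b assume b: "b \<in> Poly_Mapping.keys f \<and> (\<forall>c\<in>Poly_Mapping.keys f. c \<noteq> b \<longrightarrow> ds_less d c b)"
  show "b = a"
  proof (rule ccontr)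
    assume "b \<noteq> a"
    then have "ds_less d b a" "ds_less d a b" using assms b by auto
    then show False using ds_less_trans ds_less_irrefl by blast
  qed
qed (use assms in auto)

lemma lead_exp_in_keys:
  assumes "f \<noteq> 0" "Poly_Mapping.keys f \<subseteq> exps d"
  shows "lead_exp d f \<in> Poly_Mapping.keys f"
    and "b \<in> Poly_Mapping.keys f \<Longrightarrow> b \<noteq> lead_exp d f \<Longrightarrow> ds_less d b (lead_exp d f)"
proof -
  have "Poly_Mapping.keys f \<noteq> {}"
    using assms(1) pm_sum_monomials[of f] by force
  then obtain a where a: "a \<in> Poly_Mapping.keys f" "\<And>b. b \<in> Poly_Mapping.keys f \<Longrightarrow> b \<noteq> a \<Longrightarrow> ds_less d b a"
    using ds_greatest_exists[of "Poly_Mapping.keys f" d] assms(2) by auto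
  have "lead_exp d f = a" by (rule lead_exp_eqI[OF a])
  with a show "lead_exp d f \<in> Poly_Mapping.keys f"
    and "b \<in> Poly_Mapping.keys f \<Longrightarrow> b \<noteq> lead_exp d f \<Longrightarrow> ds_less d b (lead_exp d f)" by auto
qed

subsection \<open>Membership in the semigroup ideal\<close>

lemma monom_power: "Polynomial.monom (1::'k::comm_semiring_1) m ^ k = Polynomial.monom 1 (k * m)"
  by (induction k) (simp_all add: mult_monom)

lemma prod_monom_weight:
  "(\<Prod>i=1..d. Polynomial.monom (1::'k::comm_semiring_1) (n i) ^ Poly_Mapping.lookup a i) =
    Polynomial.monom 1 (weight d n a)"
proof -
  have "(\<Prod>i\<in>A. Polynomial.monom (1::'k) (n i) ^ Poly_Mapping.lookup a i) =
      Polynomial.monom 1 (\<Sum>i\<in>A. Poly_Mapping.lookup a i * n i)" if "finite A" for A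
    using that by (induction A) (auto simp: monom_power mult_monom)
  then show ?thesis by (simp add: weight_def)
qed

lemma coeff_toric_hom:
  "Polynomial.coeff (toric_hom d n f) s =
    pm_eval (\<lambda>x. x) (\<lambda>a. if weight d n a = s then 1 else 0) (f :: ('k::field) mpol)"
  unfolding toric_hom_def pm_eval_def prod_monom_weight
  by (simp add: coeff_sum coeff_monom)

text \<open>The coefficient of \<open>t^s\<close> in the image is the sum of the coefficients of
  \<open>f\<close> over the fibre of \<open>s\<close>. Indicators of fibres detect these sums, and
  any \<open>h\<close> is a combination of indicators on the finitely many weights that occur.
  Allowing all \<open>h\<close> makes the criterion stable under translation of weights.\<close>

lemma semigroup_ideal_iff:
  fixes f :: "('k::field) mpol"
  shows "f \<in> semigroup_ideal d n \<longleftrightarrow>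
    Poly_Mapping.keys f \<subseteq> exps d \<and> (\<forall>h :: nat \<Rightarrow> 'k. pm_eval (\<lambda>x. x) (\<lambda>a. h (weight d n a)) f = 0)"
proof -
  have "toric_hom d n f = 0 \<longleftrightarrow>
      (\<forall>s. pm_eval (\<lambda>x. x) (\<lambda>a. if weight d n a = s then 1 else 0) f = 0)"
    by (simp add: poly_eq_iff coeff_toric_hom)
  also have "\<dots> \<longleftrightarrow> (\<forall>h :: nat \<Rightarrow> 'k. pm_eval (\<lambda>x. x) (\<lambda>a. h (weight d n a)) f = 0)"
  proof (intro iffI allI)
    fix h :: "nat \<Rightarrow> 'k"
    assume 0: "\<forall>s. pm_eval (\<lambda>x. x) (\<lambda>a. if weight d n a = s then 1 else 0) f = 0"
    let ?K = "Poly_Mapping.keys f"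
    have "pm_eval (\<lambda>x. x) (\<lambda>a. h (weight d n a)) f =
        (\<Sum>s\<in>weight d n ` ?K. \<Sum>a\<in>{a\<in>?K. weight d n a = s}. Poly_Mapping.lookup f a * h (weight d n a))"
      unfolding pm_eval_def by (rule sum.image_gen) simp
    also have "\<dots> = (\<Sum>s\<in>weight d n ` ?K. h s *
        pm_eval (\<lambda>x. x) (\<lambda>a. if weight d n a = s then 1 else 0) f)"
      by (intro sum.cong refl)
        (simp add: pm_eval_def sum_distrib_left sum.inter_filter mult.commute if_distrib cong: if_cong)
    also have "\<dots> = 0" using 0 by simp
    finally show "pm_eval (\<lambda>x. x) (\<lambda>a. h (weight d n a)) f = 0" .
  next
    fix s
    assume "\<forall>h :: nat \<Rightarrow> 'k. pm_eval (\<lambda>x. x) (\<lambda>a. h (weight d n a)) f = 0"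
    then show "pm_eval (\<lambda>x. x) (\<lambda>a. if weight d n a = s then 1 else 0) f = 0"
      by (drule_tac x="\<lambda>t. if t = s then 1 else 0" in spec) simp
  qed
  finally show ?thesis
    by (auto simp: semigroup_ideal_def a_kernel_def')
qed

lemma keys_single_mult_exps:
  fixes f :: "('k::field) mpol"
  assumes "a \<in> exps d" "Poly_Mapping.keys f \<subseteq> exps d"
  shows "Poly_Mapping.keys (Poly_Mapping.single a c * f) \<subseteq> exps d"
proof
  fix x assume "x \<in> Poly_Mapping.keys (Poly_Mapping.single a c * f)"
  then obtain b where "b \<in> Poly_Mapping.keys f" "x = a + b"
    using keys_mult[of "Poly_Mapping.single a c" f] by (auto split: if_splits)
  then show "x \<in> exps d" using assms by auto
qed

lemma semigroup_ideal_is_ideal: "ideal (semigroup_ideal d n :: ('k::field) mpol set) (mpol_ring d)"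
proof (rule mpol_idealI)
  fix f g :: "'k mpol"
  assume f: "f \<in> semigroup_ideal d n"
  then show "Poly_Mapping.keys f \<subseteq> exps d" by (simp add: semigroup_ideal_iff)
  {
    assume "g \<in> semigroup_ideal d n"
    then show "f + g \<in> semigroup_ideal d n"
      using f keys_add[of f g] by (auto simp: semigroup_ideal_iff pm_eval_add)
  }
  fix a c assume a: "a \<in> exps d"
  have "Poly_Mapping.keys (Poly_Mapping.single a c * f) \<subseteq> exps d"
    using a f by (intro keys_single_mult_exps) (auto simp: semigroup_ideal_iff)
  moreover have "pm_eval (\<lambda>x. x) (\<lambda>b. h (weight d n b)) (Poly_Mapping.single a c * f) = 0" for h :: "nat \<Rightarrow> 'k"
    using f by (auto simp: semigroup_ideal_iff pm_eval_id_mult_single dest: spec[of _ "\<lambda>t. h (weight d n a + t)"])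
  ultimately show "Poly_Mapping.single a c * f \<in> semigroup_ideal d n"
    by (simp add: semigroup_ideal_iff)
qed (simp add: semigroup_ideal_iff)

lemma binomial_in_semigroup_ideal_iff:
  assumes "a \<in> exps d" "b \<in> exps d"
  shows "xpow a - xpow b \<in> (semigroup_ideal d n :: ('k::field) mpol set) \<longleftrightarrow> weight d n a = weight d n b"
proof
  assume "xpow a - xpow b \<in> (semigroup_ideal d n :: 'k mpol set)"
  then have "(if weight d n a = weight d n a then 1 else 0) - (if weight d n b = weight d n a then 1 else 0) = (0::'k)"
    unfolding semigroup_ideal_iff
    by (auto simp: pm_eval_binomial split: if_splits dest!: spec[of _ "\<lambda>t. if t = weight d n a then 1 else 0"])
  then show "weight d n a = weight d n b" by (auto split: if_splits)
next
  assume "weight d n a = weight d n b"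
  moreover have "{a, b} \<subseteq> exps d" using assms by auto
  ultimately show "xpow a - xpow b \<in> (semigroup_ideal d n :: 'k mpol set)"
    using keys_binomial_subset[of a b, where 'k='k]
    by (auto simp: semigroup_ideal_iff pm_eval_binomial)
qed

lemma keys_semigroup_ideal: "f \<in> (semigroup_ideal d n :: ('k::field) mpol set) \<Longrightarrow> Poly_Mapping.keys f \<subseteq> exps d"
  by (simp add: semigroup_ideal_iff)

section \<open>Moves along binomials inside a fibre\<close>

definition move :: "nat \<Rightarrow> ('k::field) mpol set \<Rightarrow> (nat \<Rightarrow>\<^sub>0 nat) \<Rightarrow> (nat \<Rightarrow>\<^sub>0 nat) \<Rightarrow> bool" where
  "move d E a b \<longleftrightarrow> (\<exists>m\<in>exps d. \<exists>u\<in>exps d. \<exists>v\<in>exps d.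
     (xpow u - xpow v \<in> E \<or> xpow v - xpow u \<in> E) \<and> a = m + u \<and> b = m + v)"

lemma moveI:
  assumes "m \<in> exps d" "u \<in> exps d" "v \<in> exps d" "xpow u - xpow v \<in> E \<or> xpow v - xpow u \<in> E"
  shows "move d E (m + u) (m + v)"
  using assms unfolding move_def by blast

lemma moveE:
  assumes "move d E a b"
  obtains m u v where "m \<in> exps d" "u \<in> exps d" "v \<in> exps d"
    "xpow u - xpow v \<in> E \<or> xpow v - xpow u \<in> E" "a = m + u" "b = m + v"
  using assms unfolding move_def by blast

lemma move_add:
  assumes "move d E a b" "c \<in> exps d"
  shows "move d E (c + a) (c + b)"
  using assms(1)
proof (rule moveE)
  fix m u v assume "m \<in> exps d" "u \<in> exps d" "v \<in> exps d"
    "xpow u - xpow v \<in> E \<or> xpow v - xpow u \<in> E" "a = m + u" "b = m + v"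
  then show ?thesis using moveI[of "c + m" d u v E] assms(2) by (simp add: add.assoc)
qed

lemma move_sym: "move d E a b \<Longrightarrow> move d E b a"
  by (erule moveE) (metis moveI)

lemma move_weight:
  fixes E :: "('k::field) mpol set"
  assumes "E \<subseteq> semigroup_ideal d n" "move d E a b"
  shows "weight d n a = weight d n b" "a \<in> exps d" "b \<in> exps d"
proof -
  obtain m u v where muv: "m \<in> exps d" "u \<in> exps d" "v \<in> exps d"
    "xpow u - xpow v \<in> E \<or> xpow v - xpow u \<in> E" "a = m + u" "b = m + v"
    using assms(2) by (rule moveE)
  then have "weight d n u = weight d n v"
    using assms(1) binomial_in_semigroup_ideal_iff[of u d v n, where 'k='k]
      binomial_in_semigroup_ideal_iff[of v d u n, where 'k='k] by fastforce
  then show "weight d n a = weight d n b" "a \<in> exps d" "b \<in> exps d" using muv by auto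
qed

text \<open>The polynomials annihilated by all functionals that are constant along moves form an ideal.\<close>

lemma moves_connect_fibres:
  fixes E :: "('k::field) mpol set"
  assumes E: "\<forall>f\<in>E. is_binomial d f" and gen: "Idl\<^bsub>mpol_ring d\<^esub> E = semigroup_ideal d n"
    and ab: "a \<in> exps d" "b \<in> exps d" "weight d n a = weight d n b"
  shows "(move d E)\<^sup>*\<^sup>* a b"
proof -
  let ?inv = "\<lambda>h :: (nat \<Rightarrow>\<^sub>0 nat) \<Rightarrow> 'k. \<forall>a b. move d E a b \<longrightarrow> h a = h b"
  let ?K = "{f. Poly_Mapping.keys f \<subseteq> exps d \<and> (\<forall>h. ?inv h \<longrightarrow> pm_eval (\<lambda>x. x) h f = 0)}"
  have "ideal ?K (mpol_ring d)"
  proof (rule mpol_idealI)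
    fix f g :: "'k mpol"
    assume f: "f \<in> ?K"
    then show "Poly_Mapping.keys f \<subseteq> exps d" by simp
    {
      assume "g \<in> ?K"
      then show "f + g \<in> ?K" using f keys_add[of f g] by (auto simp: pm_eval_add)
    }
    fix m c assume m: "m \<in> exps d"
    have "Poly_Mapping.keys (Poly_Mapping.single m c * f) \<subseteq> exps d"
      using m f by (intro keys_single_mult_exps) auto
    moreover have "pm_eval (\<lambda>x. x) h (Poly_Mapping.single m c * f) = 0" if "?inv h" for h
    proof -
      have "?inv (\<lambda>a. h (m + a))" using that by (metis move_add m)
      then have "pm_eval (\<lambda>x. x) (\<lambda>a. h (m + a)) f = 0" using f by simp
      then show ?thesis by (simp add: pm_eval_id_mult_single)
    qed
    ultimately show "Poly_Mapping.single m c * f \<in> ?K" by simp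
  qed simp
  moreover have "E \<subseteq> ?K"
  proof
    fix f assume "f \<in> E"
    then obtain u v where uv: "u \<in> exps d" "v \<in> exps d" "f = xpow u - xpow v"
      using E unfolding is_binomial_def by blast
    then have "move d E u v" using moveI[of 0 d u v E] \<open>f \<in> E\<close> by simp
    then show "f \<in> ?K"
      using uv keys_binomial_subset[of u v, where 'k='k] by (auto simp: pm_eval_binomial)
  qed
  ultimately have "semigroup_ideal d n \<subseteq> ?K"
    using mpol_Idl_minimal[of ?K d E] gen by simp
  moreover have "xpow a - xpow b \<in> (semigroup_ideal d n :: 'k mpol set)"
    using ab by (simp add: binomial_in_semigroup_ideal_iff)
  ultimately have K: "xpow a - xpow b \<in> ?K" by (rule subsetD)
  \<comment> \<open>The indicator of the connected component of \<open>a\<close> is constant along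
    moves, so \<open>h a - h b = 0\<close> puts \<open>b\<close> into that component.\<close>
  define h :: "(nat \<Rightarrow>\<^sub>0 nat) \<Rightarrow> 'k" where "h = (\<lambda>c. if (move d E)\<^sup>*\<^sup>* a c then 1 else 0)"
  have "(move d E)\<^sup>*\<^sup>* a x \<longleftrightarrow> (move d E)\<^sup>*\<^sup>* a y" if "move d E x y" for x y
    using rtranclp.rtrancl_into_rtrancl[of "move d E" a x y] that
      rtranclp.rtrancl_into_rtrancl[of "move d E" a y x] move_sym[OF that] by blast
  then have "?inv h" unfolding h_def by simp
  then have "h a - h b = 0"
    using K by (simp add: pm_eval_binomial)
  then show ?thesis by (auto simp: h_def split: if_splits)
qed

text \<open>The part of the walk before the exit is kept as a walk inside \<open>Q\<close>, because
  differences along it are summed up in an ideal later.\<close>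

lemma rtranclp_first_exit:
  assumes "r\<^sup>*\<^sup>* a b" "Q a" "\<not> Q b"
  shows "\<exists>p q. (\<lambda>x y. r x y \<and> Q x \<and> Q y)\<^sup>*\<^sup>* a p \<and> Q p \<and> r p q \<and> \<not> Q q"
  using assms
proof (induction rule: converse_rtranclp_induct)
  case (step y z)
  show ?case
  proof (cases "Q z")
    case True
    obtain p q where pq: "(\<lambda>x y. r x y \<and> Q x \<and> Q y)\<^sup>*\<^sup>* z p" "Q p" "r p q" "\<not> Q q"
      using step.IH[OF True step.prems(2)] by (elim exE conjE)
    have "r y z \<and> Q y \<and> Q z"
      using step.hyps(1) step.prems(1) True by simp
    then have "(\<lambda>x y. r x y \<and> Q x \<and> Q y)\<^sup>*\<^sup>* y p"
      by (rule converse_rtranclp_into_rtranclp[OF _ pq(1)])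
    then show ?thesis using pq(2-4) by (intro exI conjI)
  next
    case False
    have "(\<lambda>x y. r x y \<and> Q x \<and> Q y)\<^sup>*\<^sup>* y y" by simp
    then show ?thesis using step.hyps(1) step.prems(1) False by (intro exI conjI)
  qed
qed auto

subsection \<open>Numerical semigroups with a minimal system of generators\<close>

locale semigroup_generators =
  fixes S :: "nat set" and d :: nat and n :: "nat \<Rightarrow> nat"
  assumes numerical: "numerical_semigroup S"
    and generated: "minimally_generated S d n"
    and multiplicity_less: "\<And>i. i \<in> {2..d} \<Longrightarrow> n 1 < n i"
begin

definition e1 :: "nat \<Rightarrow>\<^sub>0 nat" where
  "e1 = Poly_Mapping.single 1 1"

lemma S_submonoid: "0 \<in> S" "x \<in> S \<Longrightarrow> y \<in> S \<Longrightarrow> x + y \<in> S"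
  using numerical by (auto simp: numerical_semigroup_def submonoid_of_nat_def)

lemma S_eq: "S = weight d n ` exps d"
proof
  have "S = submonoid_of_nat hull (n ` {1..d})"
    using generated by (simp add: minimally_generated_def)
  also have "\<dots> \<subseteq> weight d n ` exps d"
  proof (rule hull_minimal)
    show "n ` {1..d} \<subseteq> weight d n ` exps d"
    proof
      fix x assume "x \<in> n ` {1..d}"
      then obtain i where i: "i \<in> {1..d}" "x = n i" by blast
      then have "x = weight d n (Poly_Mapping.single i 1)" by simp
      then show "x \<in> weight d n ` exps d" using single_in_exps[OF i(1)] by (rule image_eqI)
    qed
    show "submonoid_of_nat (weight d n ` exps d)"
      unfolding submonoid_of_nat_def
    proof (intro conjI ballI)
      show "0 \<in> weight d n ` exps d" by (rule image_eqI[of _ _ 0]) auto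
      fix x y assume "x \<in> weight d n ` exps d" "y \<in> weight d n ` exps d"
      then obtain a b where "a \<in> exps d" "b \<in> exps d" "x = weight d n a" "y = weight d n b" by blast
      then show "x + y \<in> weight d n ` exps d" by (intro image_eqI[of _ _ "a + b"]) auto
    qed
  qed
  finally show "S \<subseteq> weight d n ` exps d" .
  have gen: "n i \<in> S" if "i \<in> {1..d}" for i
  proof -
    have "n i \<in> submonoid_of_nat hull (n ` {1..d})"
      using hull_subset[of "n ` {1..d}" submonoid_of_nat] imageI[OF that] by (rule subsetD)
    then show ?thesis using generated by (simp only: minimally_generated_def)
  qed
  have mult: "k * x \<in> S" if "x \<in> S" for k x
    by (induction k) (simp_all add: that S_submonoid)
  have "(\<Sum>i\<in>A. Poly_Mapping.lookup a i * n i) \<in> S" if "A \<subseteq> {1..d}" for A a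
    using that by (induction A rule: infinite_finite_induct) (simp_all add: S_submonoid gen mult)
  then show "weight d n ` exps d \<subseteq> S" unfolding weight_def by blast
qed

lemma weight_in_S: "a \<in> exps d \<Longrightarrow> weight d n a \<in> S"
  by (auto simp: S_eq)

text \<open>Without generators \<open>S\<close> would be \<open>{0}\<close>, whose complement is
  infinite.\<close>

lemma d_pos: "1 \<in> {1..d}"
proof (rule ccontr)
  assume "1 \<notin> {1..d}"
  then have "exps d = {0}" by (auto simp: exps_def)
  then have "S = {0}" using S_eq by simp
  then show False using numerical finite_compl[of S] by (simp add: numerical_semigroup_def)
qed

text \<open>A zero generator could be dropped without changing the generated submonoid, contrary to
  minimality.\<close>

lemma n1_pos: "n 1 > 0"
proof (rule ccontr)
  assume "\<not> n 1 > 0"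
  then have sub: "n ` {1..d} \<subseteq> insert 0 (n ` ({1..d} - {1}))" by auto
  have sub': "n ` ({1..d} - {1}) \<subseteq> n ` {1..d}" by (rule image_mono) simp
  have "n ` ({1..d} - {1}) \<subseteq> t \<longleftrightarrow> n ` {1..d} \<subseteq> t" if "submonoid_of_nat t" for t
  proof
    assume "n ` ({1..d} - {1}) \<subseteq> t"
    then have "insert 0 (n ` ({1..d} - {1})) \<subseteq> t" using that by (simp add: submonoid_of_nat_def)
    then show "n ` {1..d} \<subseteq> t" using sub by (rule subset_trans[rotated])
  qed (rule subset_trans[OF sub'])
  then have "submonoid_of_nat hull (n ` ({1..d} - {1})) = submonoid_of_nat hull (n ` {1..d})"
    unfolding hull_def by (intro arg_cong[of _ _ Inter] Collect_cong conj_cong refl) simp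
  moreover have "{1..d} - {1} \<subset> {1..d}"
    using DiffD2[of 1 "{1..d}" "{1}"] d_pos by (intro psubsetI Diff_subset) force
  ultimately show False using generated unfolding minimally_generated_def by metis
qed

lemma n_ge: "i \<in> {1..d} \<Longrightarrow> n 1 \<le> n i"
  using multiplicity_less[of i] by (cases "i = 1") auto

lemma e1_exps [simp]: "e1 \<in> exps d"
  using single_in_exps[OF d_pos] by (simp only: e1_def)

lemma lookup_e1 [simp]: "Poly_Mapping.lookup e1 1 = 1" "Poly_Mapping.lookup e1 (Suc 0) = 1"
  by (simp_all add: e1_def)

lemma weight_e1 [simp]: "weight d n e1 = n 1"
  using weight_single[OF d_pos, of n 1] by (simp only: e1_def mult_1)

lemma total_deg_e1 [simp]: "total_deg d e1 = 1"
  using total_deg_single[OF d_pos] by (simp only: e1_def)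

lemma total_deg_weight_le: "total_deg d a * n 1 \<le> weight d n a"
  unfolding total_deg_def weight_def sum_distrib_right
  by (intro sum_mono mult_left_mono n_ge) simp_all

text \<open>All generators are at least 1, so the weight bounds every exponent. Maxima of lengths,
  least elements of fibres and termination of reductions all depend on this.\<close>

lemma finite_fibre: "finite {a \<in> exps d. weight d n a = s}"
proof -
  let ?r = "\<lambda>a. restrict (Poly_Mapping.lookup a) {1..d}"
  have bound: "Poly_Mapping.lookup a i \<le> weight d n a" if "i \<in> {1..d}" for a i
  proof -
    have "1 \<le> n i" using n_ge[OF that] n1_pos by simp
    then have "Poly_Mapping.lookup a i \<le> Poly_Mapping.lookup a i * n i" by simp
    also have "\<dots> \<le> weight d n a"
      unfolding weight_def using that by (intro member_le_sum) auto
    finally show ?thesis .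
  qed
  have "?r ` {a \<in> exps d. weight d n a = s} \<subseteq> (\<Pi>\<^sub>E i\<in>{1..d}. {..s})"
    using bound by auto
  then have "finite (?r ` {a \<in> exps d. weight d n a = s})"
    by (rule finite_subset) (auto intro: finite_PiE)
  moreover have "inj_on ?r {a \<in> exps d. weight d n a = s}"
  proof (rule inj_onI)
    fix a b assume ab: "a \<in> {a \<in> exps d. weight d n a = s}" "b \<in> {a \<in> exps d. weight d n a = s}"
      and eq: "?r a = ?r b"
    show "a = b"
    proof (rule exps_eqI)
      fix i assume "i \<in> {1..d}"
      then show "Poly_Mapping.lookup a i = Poly_Mapping.lookup b i" using fun_cong[OF eq, of i] by simp
    qed (use ab in auto)
  qed
  ultimately show ?thesis by (rule finite_imageD)
qed

section \<open>Maximal factorizations and the order function\<close>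

definition maxfac :: "(nat \<Rightarrow>\<^sub>0 nat) \<Rightarrow> bool" where
  "maxfac a \<longleftrightarrow> a \<in> exps d \<and>
     (\<forall>c\<in>exps d. weight d n c = weight d n a \<longrightarrow> total_deg d c \<le> total_deg d a)"

text \<open>The order of \<open>t^s\<close> with respect to the powers of the ideal generated by the
  \<open>t^(n i)\<close>; see \<open>ideal_pow_eq_filt\<close>.\<close>

definition ord :: "nat \<Rightarrow> nat" where
  "ord s = Max (total_deg d ` {a \<in> exps d. weight d n a = s})"

lemma maximal_factorization_iff: "maximal_factorization d n (weight d n a) a \<longleftrightarrow> maxfac a"
  by (auto simp: maximal_factorization_def factorizations_def maxfac_def)

lemma total_deg_le_ord: "a \<in> exps d \<Longrightarrow> total_deg d a \<le> ord (weight d n a)"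
  unfolding ord_def using finite_fibre by (intro Max_ge) auto

lemma maxfac_iff_ord: "maxfac a \<longleftrightarrow> a \<in> exps d \<and> total_deg d a = ord (weight d n a)"
proof
  assume m: "maxfac a"
  then have "ord (weight d n a) \<le> total_deg d a"
    unfolding ord_def maxfac_def using finite_fibre by (subst Max_le_iff) auto
  then show "a \<in> exps d \<and> total_deg d a = ord (weight d n a)"
    using m total_deg_le_ord[of a] by (auto simp: maxfac_def)
next
  assume a: "a \<in> exps d \<and> total_deg d a = ord (weight d n a)"
  then show "maxfac a"
    unfolding maxfac_def using total_deg_le_ord by metis
qed

lemma maxfac_exists:
  assumes "s \<in> S"
  obtains a where "maxfac a" "weight d n a = s" "total_deg d a = ord s" "a \<in> exps d"
proof -
  have "ord s \<in> total_deg d ` {a \<in> exps d. weight d n a = s}"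
    unfolding ord_def using assms finite_fibre by (intro Max_in) (auto simp: S_eq)
  then obtain a where "a \<in> exps d" "weight d n a = s" "total_deg d a = ord s" by auto
  then show ?thesis using that maxfac_iff_ord by auto
qed

lemma remove_e1:
  assumes "a \<in> exps d" "Poly_Mapping.lookup a 1 \<noteq> 0"
  shows "\<exists>b\<in>exps d. a = b + e1"
  using minus_single_add[OF assms(2), folded e1_def] assms(1) by (metis add_in_exps_iff)

text \<open>A longer factorization of the weight of \<open>a\<close> could be substituted inside
  \<open>a + b\<close>.\<close>

lemma maxfac_remove: "maxfac (a + b) \<Longrightarrow> maxfac a"
  unfolding maxfac_def
proof (intro conjI ballI impI)
  fix c
  assume *: "a + b \<in> exps d \<and> (\<forall>c\<in>exps d. weight d n c = weight d n (a + b) \<longrightarrow> total_deg d c \<le> total_deg d (a + b))"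
    and c: "c \<in> exps d" "weight d n c = weight d n a"
  then have "total_deg d (c + b) \<le> total_deg d (a + b)"
    by (intro *[THEN conjunct2, rule_format]) auto
  then show "total_deg d c \<le> total_deg d a" by simp
qed auto

lemma apery_iff: "s \<in> apery S (n 1) \<longleftrightarrow> s \<in> S \<and> (\<forall>a\<in>exps d. weight d n a = s \<longrightarrow> Poly_Mapping.lookup a 1 = 0)"
proof
  assume s: "s \<in> apery S (n 1)"
  have "Poly_Mapping.lookup a 1 = 0" if a: "a \<in> exps d" "weight d n a = s" for a
  proof (rule ccontr)
    assume "Poly_Mapping.lookup a 1 \<noteq> 0"
    then obtain b where "b \<in> exps d" "a = b + e1" using remove_e1[OF a(1)] by auto
    then have "s = weight d n b + n 1" "weight d n b \<in> S" using a weight_in_S by auto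
    then show False using s by (auto simp: apery_def)
  qed
  then show "s \<in> S \<and> (\<forall>a\<in>exps d. weight d n a = s \<longrightarrow> Poly_Mapping.lookup a 1 = 0)"
    using s by (auto simp: apery_def)
next
  assume s: "s \<in> S \<and> (\<forall>a\<in>exps d. weight d n a = s \<longrightarrow> Poly_Mapping.lookup a 1 = 0)"
  have False if y: "y \<in> S" "s = y + n 1" for y
  proof -
    obtain b where b: "b \<in> exps d" "y = weight d n b" using y(1) S_eq by auto
    then have "b + e1 \<in> exps d" "weight d n (b + e1) = s" using y(2) by auto
    then have "Poly_Mapping.lookup (b + e1) 1 = 0" using s by blast
    then show False by (simp add: lookup_add)
  qed
  then show "s \<in> apery S (n 1)" using s by (auto simp: apery_def)
qed

lemma finite_apery: "finite (apery S (n 1))"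
proof (rule finite_subset)
  show "apery S (n 1) \<subseteq> {..<n 1} \<union> (\<lambda>x. x + n 1) ` (- S)"
  proof
    fix s assume s: "s \<in> apery S (n 1)"
    show "s \<in> {..<n 1} \<union> (\<lambda>x. x + n 1) ` (- S)"
    proof (cases "s < n 1")
      case False
      then have "s = (s - n 1) + n 1" by simp
      moreover from this have "s - n 1 \<notin> S" using s by (auto simp: apery_def)
      ultimately show ?thesis by blast
    qed simp
  qed
  show "finite ({..<n 1} \<union> (\<lambda>x. x + n 1) ` (- S))"
    using numerical by (simp add: numerical_semigroup_def)
qed

text \<open>Equality of lengths in a fibre is expressed as maximality of each of its members, to
  match \<open>ord_regular\<close>.\<close>

definition apery_homogeneous :: bool where
  "apery_homogeneous \<longleftrightarrow> (\<forall>a\<in>exps d. weight d n a \<in> apery S (n 1) \<longrightarrow> maxfac a)"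

text \<open>Says that the class of \<open>t^(n 1)\<close> in the associated graded ring sends no
  basis element to zero.\<close>

definition ord_regular :: bool where
  "ord_regular \<longleftrightarrow> (\<forall>a. maxfac a \<longrightarrow> maxfac (a + e1))"

lemma ord_regular_iff: "ord_regular \<longleftrightarrow> (\<forall>s\<in>S. ord (s + n 1) = ord s + 1)"
proof
  assume r: ord_regular
  show "\<forall>s\<in>S. ord (s + n 1) = ord s + 1"
  proof
    fix s assume "s \<in> S"
    then obtain a where a: "maxfac a" "weight d n a = s" "total_deg d a = ord s" by (rule maxfac_exists)
    then have "maxfac (a + e1)" using r by (simp add: ord_regular_def)
    then show "ord (s + n 1) = ord s + 1" using a by (simp add: maxfac_iff_ord)
  qed
next
  assume "\<forall>s\<in>S. ord (s + n 1) = ord s + 1"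
  then show ord_regular by (auto simp: ord_regular_def maxfac_iff_ord weight_in_S)
qed

lemma homogeneous_iff: "homogeneous_semigroup S d n \<longleftrightarrow> apery_homogeneous"
proof
  assume h: "homogeneous_semigroup S d n"
  show apery_homogeneous unfolding apery_homogeneous_def
  proof (intro ballI impI)
    fix a assume a: "a \<in> exps d" "weight d n a \<in> apery S (n 1)"
    show "maxfac a"
    proof (cases "weight d n a = 0")
      \<comment> \<open>\<open>homogeneous_subset\<close> exempts \<open>s = 0\<close>, so this
        weight needs its own argument: only length 0 is possible.\<close>
      case True
      then have "total_deg d c = 0" if "weight d n c = weight d n a" for c
        using total_deg_weight_le[of c] that n1_pos by simp
      then show ?thesis using a by (simp add: maxfac_def)
    next
      case False
      then have "total_deg d c = total_deg d a" if "c \<in> exps d" "weight d n c = weight d n a" for c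
        using h a that unfolding homogeneous_semigroup_def homogeneous_subset_def factorizations_def
        by blast
      then show ?thesis unfolding maxfac_def using a(1) by (intro conjI ballI impI eq_refl)
    qed
  qed
next
  assume h: apery_homogeneous
  show "homogeneous_semigroup S d n"
    unfolding homogeneous_semigroup_def homogeneous_subset_def factorizations_def
    using h by (auto simp: apery_homogeneous_def maxfac_iff_ord)
qed

text \<open>The clause on \<open>drop_first\<close> encodes \<open>ord_regular\<close>. If
  \<open>c\<close> is maximal and \<open>a\<close> is longer than \<open>b = c + e1\<close> in the
  same fibre, the clause gives \<open>a\<close> a factor \<open>x_1\<close>, and cancelling it
  contradicts maximality of \<open>c\<close>. Conversely, if \<open>b\<close> involves
  \<open>x_1\<close> and \<open>drop_first b\<close> is maximal, then so is \<open>b\<close> by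
  regularity, and no longer \<open>a\<close> exists.\<close>

lemma factorization_condition_iff:
  "(\<forall>a\<in>exps d. \<forall>b\<in>exps d.
      xpow a - xpow b \<in> (semigroup_ideal d n :: ('k::field) mpol set) \<and> total_deg d a > total_deg d b \<longrightarrow>
      weight d n a \<notin> apery S (n 1) \<and>
      (maximal_factorization d n (weight d n (drop_first b)) (drop_first b) \<longrightarrow>
         Poly_Mapping.lookup a 1 \<ge> Poly_Mapping.lookup b 1)) \<longleftrightarrow>
    apery_homogeneous \<and> ord_regular" (is "?C \<longleftrightarrow> _")
proof
  assume C: ?C
  have Cab: "weight d n a \<notin> apery S (n 1)"
    "maxfac (drop_first b) \<Longrightarrow> Poly_Mapping.lookup a 1 \<ge> Poly_Mapping.lookup b 1"
    if ab: "a \<in> exps d" "b \<in> exps d" "weight d n a = weight d n b" "total_deg d b < total_deg d a" for a b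
    using bspec[OF bspec[OF C ab(1)] ab(2)] ab binomial_in_semigroup_ideal_iff[OF ab(1,2), of n, where 'k='k]
    by (simp_all only: maximal_factorization_iff simp_thms)
  have apery_homogeneous unfolding apery_homogeneous_def maxfac_def
  proof (intro conjI ballI impI)
    fix b a
    assume b: "b \<in> exps d" and w: "weight d n b \<in> apery S (n 1)"
      and a: "a \<in> exps d" "weight d n a = weight d n b"
    show "total_deg d a \<le> total_deg d b"
    proof (rule ccontr)
      assume "\<not> total_deg d a \<le> total_deg d b"
      then have "weight d n a \<notin> apery S (n 1)"
        using a b by (intro Cab(1)[of a b]) auto
      then show False using a w by simp
    qed
  qed
  moreover have ord_regular unfolding ord_regular_def
  proof (intro allI impI)
    fix c assume c: "maxfac c"
    then have ce: "c + e1 \<in> exps d" by (simp add: maxfac_def)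
    show "maxfac (c + e1)"
      unfolding maxfac_def
    proof (intro conjI ballI impI ce)
      fix a assume a: "a \<in> exps d" "weight d n a = weight d n (c + e1)"
      show "total_deg d a \<le> total_deg d (c + e1)"
      proof (rule ccontr)
        assume len: "\<not> ?thesis"
        have "drop_first (c + e1) = c" by (simp add: drop_first_def lookup_add flip: e1_def[simplified])
        then have "Poly_Mapping.lookup a 1 \<ge> Poly_Mapping.lookup (c + e1) 1"
          using a ce len c by (intro Cab(2)) auto
        then have "Poly_Mapping.lookup a 1 \<noteq> 0" by (simp add: lookup_add)
        then obtain b where b: "b \<in> exps d" "a = b + e1" using remove_e1[OF a(1)] by auto
        then have "total_deg d b \<le> total_deg d c" using c a by (simp add: maxfac_def)
        then show False using len b by simp
      qed
    qed
  qed
  ultimately show "apery_homogeneous \<and> ord_regular" ..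
next
  assume hr: "apery_homogeneous \<and> ord_regular"
  show ?C
  proof (intro ballI impI, elim conjE)
    fix a b
    assume a: "a \<in> exps d" and b: "b \<in> exps d" and I: "xpow a - xpow b \<in> (semigroup_ideal d n :: 'k mpol set)"
      and len: "total_deg d b < total_deg d a"
    have w: "weight d n a = weight d n b"
      using I binomial_in_semigroup_ideal_iff[OF a b] by blast
    have nb: "\<not> maxfac b" using a w len by (auto simp: maxfac_def)
    then have "weight d n a \<notin> apery S (n 1)" using hr b w by (auto simp: apery_homogeneous_def)
    moreover have "Poly_Mapping.lookup a 1 \<ge> Poly_Mapping.lookup b 1" if "maxfac (drop_first b)"
    proof (cases "Poly_Mapping.lookup b 1 = 0")
      case False
      then have "b = drop_first b + e1" using minus_single_add[OF False] False by (simp add: drop_first_def e1_def)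
      then have "maxfac b" using hr that unfolding ord_regular_def by metis
      then show ?thesis using nb by contradiction
    qed simp
    ultimately show "weight d n a \<notin> apery S (n 1) \<and>
      (maximal_factorization d n (weight d n (drop_first b)) (drop_first b) \<longrightarrow>
         Poly_Mapping.lookup a 1 \<ge> Poly_Mapping.lookup b 1)"
      by (simp add: maximal_factorization_iff)
  qed
qed

end

lemma exps_lookup_index:
  assumes "a \<in> exps d" "Poly_Mapping.lookup a i \<noteq> 0"
  shows "i \<in> {1..d}"
  using assms unfolding exps_def in_keys_iff[symmetric] by blast

context semigroup_generators
begin

subsection \<open>Standard monomials of the semigroup ideal\<close>

text \<open>Standard monomials: in an ideal spanned by differences within fibres, a monomial escapes
  being a leading one exactly when it is least in its fibre.\<close>

definition is_nf :: "(nat \<Rightarrow>\<^sub>0 nat) \<Rightarrow> bool" where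
  "is_nf a \<longleftrightarrow> a \<in> exps d \<and>
     (\<forall>b\<in>exps d. weight d n b = weight d n a \<longrightarrow> b \<noteq> a \<longrightarrow> ds_less d a b)"

definition nf :: "nat \<Rightarrow> (nat \<Rightarrow>\<^sub>0 nat)" where
  "nf s = (SOME a. is_nf a \<and> weight d n a = s)"

lemma is_nf_unique:
  assumes "is_nf a" "is_nf b" "weight d n a = weight d n b"
  shows "a = b"
proof (rule ccontr)
  assume "a \<noteq> b"
  then have "ds_less d a b" "ds_less d b a" using assms unfolding is_nf_def by (metis, metis)
  then show False using ds_less_trans ds_less_irrefl by metis
qed

lemma is_nf_nf:
  assumes "s \<in> S"
  shows "is_nf (nf s)" "weight d n (nf s) = s"
proof -
  let ?A = "{a \<in> exps d. weight d n a = s}"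
  obtain c where "c \<in> exps d" "weight d n c = s" using assms S_eq by auto
  then have "?A \<noteq> {}" by blast
  then obtain a where "a \<in> ?A" "\<forall>b\<in>?A. b \<noteq> a \<longrightarrow> ds_less d a b"
    using ds_least_exists[OF finite_fibre[of s], of d] by auto
  then have "is_nf a \<and> weight d n a = s" by (simp add: is_nf_def)
  then have "is_nf (nf s) \<and> weight d n (nf s) = s" unfolding nf_def by (rule someI)
  then show "is_nf (nf s)" "weight d n (nf s) = s" by simp_all
qed

lemma nf_weight:
  assumes "a \<in> exps d"
  shows "is_nf (nf (weight d n a))" "weight d n (nf (weight d n a)) = weight d n a"
    "nf (weight d n a) \<in> exps d"
  using is_nf_nf[OF weight_in_S[OF assms]] by (simp_all add: is_nf_def)

lemma is_nf_iff: "a \<in> exps d \<Longrightarrow> is_nf a \<longleftrightarrow> nf (weight d n a) = a"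
  using is_nf_unique[of a "nf (weight d n a)"] nf_weight[of a] by metis

lemma nf_less:
  assumes "a \<in> exps d" "\<not> is_nf a"
  shows "ds_less d (nf (weight d n a)) a"
proof -
  have "nf (weight d n a) \<noteq> a" using assms is_nf_iff by blast
  then show ?thesis using nf_weight[OF assms(1)] assms(1) unfolding is_nf_def by metis
qed

text \<open>In a local order the least element has the largest degree.\<close>

lemma is_nf_maxfac: "is_nf a \<Longrightarrow> maxfac a"
  unfolding is_nf_def maxfac_def using ds_less_total_deg by (metis order_refl)

text \<open>The order is compatible with addition, so standard monomials are closed under passing to
  divisors.\<close>

lemma is_nf_add:
  assumes "is_nf (a + c)"
  shows "is_nf a"
  unfolding is_nf_def
proof (intro conjI ballI impI)
  show "a \<in> exps d" using assms by (simp add: is_nf_def)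
  fix b assume b: "b \<in> exps d" "weight d n b = weight d n a" "b \<noteq> a"
  have "c \<in> exps d" using assms by (simp add: is_nf_def)
  then have "b + c \<in> exps d" "weight d n (b + c) = weight d n (a + c)" "b + c \<noteq> a + c"
    using b by simp_all
  then have "ds_less d (a + c) (b + c)" using assms unfolding is_nf_def by blast
  then show "ds_less d a b" by (simp add: ds_less_add)
qed

lemma is_nf_zero: "is_nf 0"
proof -
  have "b = 0" if "b \<in> exps d" "weight d n b = 0" for b
  proof (rule exps_eqI)
    fix i assume i: "i \<in> {1..d}"
    then have "Poly_Mapping.lookup b i * n i = 0"
      using that(2) unfolding weight_def by (subst (asm) sum_eq_0_iff) auto
    then show "Poly_Mapping.lookup b i = Poly_Mapping.lookup 0 i"
      using n_ge[OF i] n1_pos by auto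
  qed (use that in auto)
  then show ?thesis by (auto simp: is_nf_def)
qed

text \<open>Outside the Apery set regularity provides a maximal factorization that involves
  \<open>x_1\<close>. Among factorizations of equal length a larger exponent of \<open>x_1\<close>
  means a smaller monomial, so the least one involves \<open>x_1\<close> too.\<close>

lemma nf_first_nonzero:
  assumes reg: ord_regular and b: "is_nf b" "weight d n b \<notin> apery S (n 1)"
  shows "Poly_Mapping.lookup b 1 \<noteq> 0"
proof
  assume 0: "Poly_Mapping.lookup b 1 = 0"
  have bx: "b \<in> exps d" using b by (simp add: is_nf_def)
  then obtain y where y: "y \<in> S" "weight d n b = y + n 1"
    using b(2) weight_in_S unfolding apery_def by blast
  obtain c where c: "maxfac c" "weight d n c = y" using maxfac_exists[OF y(1)] by blast
  have m: "maxfac (c + e1)" using reg c(1) by (simp add: ord_regular_def)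
  have w: "weight d n (c + e1) = weight d n b" using y c by simp
  have cx: "c + e1 \<in> exps d" using m by (simp add: maxfac_def)
  have "c + e1 \<noteq> b" using 0 by (auto simp: lookup_add)
  then have "ds_less d b (c + e1)" using b(1) cx w unfolding is_nf_def by blast
  moreover have "total_deg d b = total_deg d (c + e1)"
    using is_nf_maxfac[OF b(1)] m w by (simp only: maxfac_iff_ord)
  ultimately show False using 0 by (auto simp: ds_less_def lookup_add)
qed

text \<open>The minimal generators of the leading monomial ideal. Division by single variables is
  enough to test, by \<open>is_nf_add\<close>.\<close>

definition min_nonstd :: "(nat \<Rightarrow>\<^sub>0 nat) set" where
  "min_nonstd = {a \<in> exps d. \<not> is_nf a \<and>
     (\<forall>i. Poly_Mapping.lookup a i \<noteq> 0 \<longrightarrow> is_nf (a - Poly_Mapping.single i 1))}"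

lemma min_nonstd_exists:
  assumes "a \<in> exps d" "\<not> is_nf a"
  shows "\<exists>b\<in>min_nonstd. \<exists>c\<in>exps d. a = b + c"
  using assms
proof (induction "total_deg d a" arbitrary: a rule: less_induct)
  case less
  show ?case
  proof (cases "a \<in> min_nonstd")
    case True
    then show ?thesis by (intro bexI[of _ a] bexI[of _ 0]) auto
  next
    case False
    then obtain i where i: "Poly_Mapping.lookup a i \<noteq> 0" "\<not> is_nf (a - Poly_Mapping.single i 1)"
      using less.prems unfolding min_nonstd_def by blast
    let ?b = "a - Poly_Mapping.single i 1"
    have a: "a = ?b + Poly_Mapping.single i 1" by (rule minus_single_add[OF i(1)])
    have "i \<in> {1..d}"
      by (rule exps_lookup_index[OF less.prems(1) i(1)])
    then have deg: "total_deg d (Poly_Mapping.single i 1) = 1" by (rule total_deg_single)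
    have "?b + Poly_Mapping.single i 1 \<in> exps d" using a less.prems(1) by metis
    then have bx: "?b \<in> exps d" "Poly_Mapping.single i 1 \<in> exps d" by simp_all
    have "total_deg d (?b + Poly_Mapping.single i 1) = total_deg d ?b + 1"
      by (simp only: total_deg_add deg)
    then have "total_deg d a = total_deg d ?b + 1" using a by metis
    then have "total_deg d ?b < total_deg d a" by linarith
    then obtain b c where bc: "b \<in> min_nonstd" "c \<in> exps d" "?b = b + c"
      using less.hyps[OF _ bx(1) i(2)] by blast
    have "a = b + (c + Poly_Mapping.single i 1)" using a bc(3) by (metis add.assoc)
    moreover have "c + Poly_Mapping.single i 1 \<in> exps d" using bc bx by simp
    ultimately show ?thesis using bc(1) by blast
  qed
qed

lemma min_nonstd_antichain:
  assumes "a \<in> min_nonstd" "b \<in> min_nonstd" "a = b + c"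
  shows "a = b"
proof (rule ccontr)
  assume "a \<noteq> b"
  then have "c \<noteq> 0" using assms(3) by auto
  then obtain i where i: "Poly_Mapping.lookup c i \<noteq> 0" by (metis lookup_zero poly_mapping_eqI)
  then have "is_nf (a - Poly_Mapping.single i 1)"
    using assms by (simp add: min_nonstd_def lookup_add)
  moreover have "a - Poly_Mapping.single i 1 = b + (c - Poly_Mapping.single i 1)"
    using assms(3) i by (intro poly_mapping_eqI)
      (auto simp: lookup_add lookup_minus lookup_single when_def)
  ultimately have "is_nf b" using is_nf_add by metis
  then show False using assms(2) by (simp add: min_nonstd_def)
qed

text \<open>If \<open>x_1\<close> divided \<open>a\<close>, then \<open>a\<close> without one
  \<open>x_1\<close> would be standard, hence maximal, and \<open>a\<close> would be maximal by
  regularity. The normal form of \<open>a\<close> then has the same length and, being smaller, at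
  least as many factors \<open>x_1\<close>. Cancelling one \<open>x_1\<close> on both sides yields
  something smaller than a standard monomial in its fibre.\<close>

lemma min_nonstd_first_zero:
  assumes reg: ord_regular and a: "a \<in> min_nonstd"
  shows "Poly_Mapping.lookup a 1 = 0"
proof (rule ccontr)
  assume nz: "Poly_Mapping.lookup a 1 \<noteq> 0"
  let ?b = "a - Poly_Mapping.single 1 1"
  have ab: "a = ?b + e1" using minus_single_add[OF nz] by (simp only: e1_def)
  have ax: "a \<in> exps d" "\<not> is_nf a" using a by (simp_all add: min_nonstd_def)
  have nfb: "is_nf ?b" using a nz unfolding min_nonstd_def by blast
  then have "maxfac a" using reg is_nf_maxfac ab unfolding ord_regular_def by metis
  define c where "c = nf (weight d n a)"
  have c: "c \<in> exps d" "weight d n c = weight d n a" "is_nf c"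
    using nf_weight[OF ax(1)] by (simp_all add: c_def)
  have less: "ds_less d c a" using nf_less[OF ax] by (simp add: c_def)
  have "total_deg d c = total_deg d a"
    using is_nf_maxfac[OF c(3)] \<open>maxfac a\<close> c(2) by (simp only: maxfac_iff_ord)
  then have "Poly_Mapping.lookup c 1 \<noteq> 0" using less nz by (auto simp: ds_less_def)
  then obtain b where b: "b \<in> exps d" "c = b + e1" using remove_e1[OF c(1)] by auto
  have "ds_less d b ?b" using less ab b(2) ds_less_add by metis
  moreover have "weight d n b = weight d n ?b"
  proof -
    have "weight d n (b + e1) = weight d n (?b + e1)" using c(2) ab b(2) by metis
    then show ?thesis by (simp only: weight_add)
  qed
  moreover have "b \<noteq> ?b" using calculation(1) ds_less_irrefl by metis
  ultimately show False
    using nfb b(1) ds_less_trans ds_less_irrefl unfolding is_nf_def by metis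
qed

text \<open>Takes the place of Dickson's lemma. A minimal nonstandard exponent is a standard one
  plus one variable; neither involves \<open>x_1\<close>, so the standard part is the normal form of
  an element of the finite Apery set.\<close>

lemma finite_min_nonstd:
  assumes reg: ord_regular
  shows "finite min_nonstd"
proof (rule finite_subset)
  show "min_nonstd \<subseteq> (\<lambda>(s, i). nf s + Poly_Mapping.single i 1) ` (apery S (n 1) \<times> {1..d})"
  proof
    fix a assume a: "a \<in> min_nonstd"
    then have ax: "a \<in> exps d" "\<not> is_nf a" by (simp_all add: min_nonstd_def)
    then have "a \<noteq> 0" using is_nf_zero by auto
    then obtain i where i: "Poly_Mapping.lookup a i \<noteq> 0" by (metis lookup_zero poly_mapping_eqI)
    have id: "i \<in> {1..d}"
      by (rule exps_lookup_index[OF ax(1) i])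
    define b where "b = a - Poly_Mapping.single i 1"
    have b: "is_nf b" "a = b + Poly_Mapping.single i 1"
      using a i minus_single_add[OF i] by (simp_all only: min_nonstd_def b_def) blast
    have "Poly_Mapping.lookup b 1 = 0"
      using min_nonstd_first_zero[OF reg a] b(2) by (simp add: lookup_add)
    then have "weight d n b \<in> apery S (n 1)" using nf_first_nonzero[OF reg b(1)] by blast
    moreover have "b = nf (weight d n b)" using b(1) is_nf_iff by (metis is_nf_def)
    ultimately show "a \<in> (\<lambda>(s, i). nf s + Poly_Mapping.single i 1) ` (apery S (n 1) \<times> {1..d})"
      using b(2) id by (intro image_eqI[of _ _ "(weight d n b, i)"]) auto
  qed
qed (use finite_apery in simp)

text \<open>If the leading exponent were least in its fibre, any other exponent of \<open>f\<close>
  in that fibre would be both larger and smaller. So the fibre would contribute a single nonzero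
  coefficient, whereas the coefficients over a fibre sum to zero.\<close>

lemma semigroup_ideal_lead_exp:
  fixes f :: "('k::field) mpol"
  assumes f: "f \<in> semigroup_ideal d n" "f \<noteq> 0"
  shows "lead_exp d f \<in> exps d" "\<not> is_nf (lead_exp d f)"
proof -
  let ?a = "lead_exp d f"
  have keys: "Poly_Mapping.keys f \<subseteq> exps d" using f(1) by (rule keys_semigroup_ideal)
  have a: "?a \<in> Poly_Mapping.keys f" by (rule lead_exp_in_keys(1)[OF f(2) keys])
  then show ax: "?a \<in> exps d" using keys by blast
  show "\<not> is_nf ?a"
  proof
    assume nf: "is_nf ?a"
    have only: "b = ?a" if b: "b \<in> Poly_Mapping.keys f" "weight d n b = weight d n ?a" for b
    proof (rule ccontr)
      assume "b \<noteq> ?a"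
      then have "ds_less d b ?a" "ds_less d ?a b"
        using lead_exp_in_keys(2)[OF f(2) keys b(1)] nf b keys unfolding is_nf_def by auto
      then show False using ds_less_trans ds_less_irrefl by metis
    qed
    have "0 = pm_eval (\<lambda>x. x) (\<lambda>b. if weight d n b = weight d n ?a then 1 else 0) f"
      using f(1) unfolding semigroup_ideal_iff
      by (auto dest!: spec[of _ "\<lambda>t. if t = weight d n ?a then 1 else 0"])
    also have "\<dots> = (\<Sum>b\<in>Poly_Mapping.keys f. if b = ?a then Poly_Mapping.lookup f b else 0)"
      unfolding pm_eval_def using only by (intro sum.cong) auto
    also have "\<dots> = Poly_Mapping.lookup f ?a" using a by simp
    finally show False using a by (simp add: in_keys_iff)
  qed
qed

lemma lead_exp_nf_binomial:
  assumes "a \<in> exps d" "\<not> is_nf a"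
  shows "lead_exp d (xpow a - xpow (nf (weight d n a)) :: ('k::field) mpol) = a"
proof (rule lead_exp_eqI)
  have "a \<noteq> nf (weight d n a)" using assms is_nf_iff by metis
  then have keys: "Poly_Mapping.keys (xpow a - xpow (nf (weight d n a)) :: 'k mpol) = {a, nf (weight d n a)}"
    by (rule keys_binomial)
  then show "a \<in> Poly_Mapping.keys (xpow a - xpow (nf (weight d n a)) :: 'k mpol)" by simp
  fix b assume "b \<in> Poly_Mapping.keys (xpow a - xpow (nf (weight d n a)) :: 'k mpol)" "b \<noteq> a"
  then have "b = nf (weight d n a)" using keys by simp
  then show "ds_less d b a" using nf_less[OF assms] by simp
qed

lemma nf_binomial_in_ideal:
  assumes "a \<in> exps d"
  shows "xpow a - xpow (nf (weight d n a)) \<in> (semigroup_ideal d n :: ('k::field) mpol set)"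
  using assms nf_weight[OF assms] by (simp add: binomial_in_semigroup_ideal_iff)

text \<open>Modulo the binomials \<open>x\<^sup>a - x\<^bsup>nf\<^esup>\<close>, every polynomial is a combination of normal forms, and
  its coefficients are sums over fibres.\<close>

lemma mem_ideal_by_fibres:
  fixes f :: "('k::field) mpol"
  assumes K: "ideal K (mpol_ring d)" and keys: "Poly_Mapping.keys f \<subseteq> exps d"
    and bin: "\<And>a. a \<in> Poly_Mapping.keys f \<Longrightarrow> Q a \<Longrightarrow> xpow a - xpow (nf (weight d n a)) \<in> K"
    and mon: "\<And>a. a \<in> Poly_Mapping.keys f \<Longrightarrow> \<not> Q a \<Longrightarrow> xpow a \<in> K"
    and fib: "\<And>h :: nat \<Rightarrow> 'k. pm_eval (\<lambda>x. x) (\<lambda>a. if Q a then h (weight d n a) else 0) f = 0"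
  shows "f \<in> K"
proof -
  let ?F = "Poly_Mapping.keys f" and ?c = "\<lambda>a. Poly_Mapping.single 0 (Poly_Mapping.lookup f a)"
  \<comment> \<open>Terms outside \<open>Q\<close> lie in \<open>K\<close> already, so they are
    represented by 0. With \<open>Q\<close> everywhere true this is plain reduction to normal forms;
    the ideal of initial forms needs \<open>Q = maxfac\<close>.\<close>
  let ?g = "\<lambda>a. if Q a then xpow (nf (weight d n a)) else 0 :: 'k mpol"
  have "f = (\<Sum>a\<in>?F. ?c a * xpow a)"
    by (subst pm_sum_monomials[of f, symmetric]) (simp add: xpow_def mult_single)
  also have "\<dots> = (\<Sum>a\<in>?F. ?c a * (xpow a - ?g a)) + (\<Sum>a\<in>?F. ?c a * ?g a)"
    by (simp add: right_diff_distrib sum_subtractf)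
  also have "(\<Sum>a\<in>?F. ?c a * ?g a) = 0"
  proof (rule poly_mapping_eqI)
    fix k
    have "Poly_Mapping.lookup (?c a * ?g a) k =
        Poly_Mapping.lookup f a * (if Q a then if nf (weight d n a) = k then 1 else 0 else 0)" for a
      by (simp add: xpow_def mult_single lookup_single when_def)
    then have "Poly_Mapping.lookup (\<Sum>a\<in>?F. ?c a * ?g a) k =
        pm_eval (\<lambda>x. x) (\<lambda>a. if Q a then if nf (weight d n a) = k then 1 else 0 else 0) f"
      by (simp add: lookup_sum pm_eval_def)
    \<comment> \<open>The instance of \<open>fib\<close> for the indicator of the weights whose
      normal form is \<open>k\<close>.\<close>
    also have "\<dots> = 0" by (rule fib)
    finally show "Poly_Mapping.lookup (\<Sum>a\<in>?F. ?c a * ?g a) k = Poly_Mapping.lookup 0 k" by simp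
  qed
  finally have eq: "f = (\<Sum>a\<in>?F. ?c a * (xpow a - ?g a))" by simp
  have "(\<Sum>a\<in>?F. ?c a * (xpow a - ?g a)) \<in> K"
    using bin mon by (intro mpol_ideal_sum[OF K] mpol_ideal_scale[OF K]) auto
  then show ?thesis by (subst eq)
qed

lemma semigroup_ideal_subsetI:
  assumes K: "ideal K (mpol_ring d :: ('k::field) mpol ring)"
    and bin: "\<And>a. a \<in> exps d \<Longrightarrow> xpow a - xpow (nf (weight d n a)) \<in> K"
  shows "semigroup_ideal d n \<subseteq> K"
proof
  fix f :: "'k mpol" assume f: "f \<in> semigroup_ideal d n"
  show "f \<in> K"
    by (rule mem_ideal_by_fibres[OF K, where Q = "\<lambda>_. True"])
      (use f bin in \<open>auto simp: semigroup_ideal_iff\<close>)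
qed

end

lemma keys_monomial_ideal:
  fixes f :: "('k::field) mpol"
  assumes A: "A \<subseteq> exps d" and f: "f \<in> Idl\<^bsub>mpol_ring d\<^esub> (xpow ` A)"
    and k: "k \<in> Poly_Mapping.keys f"
  shows "\<exists>a\<in>A. \<exists>c\<in>exps d. k = a + c"
proof -
  let ?K = "{f :: 'k mpol. \<forall>k\<in>Poly_Mapping.keys f. \<exists>a\<in>A. \<exists>c\<in>exps d. k = a + c}"
  have "ideal ?K (mpol_ring d)"
  proof (rule mpol_idealI)
    fix f g :: "'k mpol"
    assume f: "f \<in> ?K"
    then show "Poly_Mapping.keys f \<subseteq> exps d" using A by fastforce
    {
      assume "g \<in> ?K"
      then show "f + g \<in> ?K" using f keys_add[of f g] by blast
    }
    fix m c assume m: "m \<in> exps d"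
    show "Poly_Mapping.single m c * f \<in> ?K"
    proof (intro CollectI ballI)
      fix k assume "k \<in> Poly_Mapping.keys (Poly_Mapping.single m c * f)"
      then obtain l where l: "l \<in> Poly_Mapping.keys f" "k = m + l"
        using keys_mult[of "Poly_Mapping.single m c" f] by (auto split: if_splits)
      then obtain a e where "a \<in> A" "e \<in> exps d" "l = a + e" using f by blast
      then show "\<exists>a\<in>A. \<exists>c\<in>exps d. k = a + c"
        using l m by (intro bexI[of _ a] bexI[of _ "m + e"]) (auto simp: add_ac)
    qed
  qed simp
  moreover have "xpow ` A \<subseteq> ?K"
  proof
    fix f :: "'k mpol" assume "f \<in> xpow ` A"
    then obtain a where "a \<in> A" "f = xpow a" by blast
    moreover have "\<exists>b\<in>A. \<exists>c\<in>exps d. a = b + c"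
      by (rule bexI[of _ a], rule bexI[of _ 0]) (simp_all add: \<open>a \<in> A\<close>)
    ultimately show "f \<in> ?K" by simp
  qed
  ultimately have "Idl\<^bsub>mpol_ring d\<^esub> (xpow ` A) \<subseteq> ?K" by (rule mpol_Idl_minimal)
  then show ?thesis using f k by blast
qed

lemma xpow_mult_in_ideal:
  assumes "ideal K (mpol_ring d :: ('k::field) mpol ring)" "xpow a \<in> K" "c \<in> exps d"
  shows "xpow (a + c) \<in> K"
  using mpol_ideal_single[OF assms, of 1] by (simp add: xpow_def mult_single add.commute)

context semigroup_generators
begin

subsection \<open>Groebner bases\<close>

text \<open>The reduced Groebner basis: the tails are standard monomials.\<close>

definition nf_basis :: "('k::field) mpol set" where
  "nf_basis = (\<lambda>a. xpow a - xpow (nf (weight d n a))) ` min_nonstd"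

lemma min_nonstd_exps: "a \<in> min_nonstd \<Longrightarrow> a \<in> exps d" "a \<in> min_nonstd \<Longrightarrow> \<not> is_nf a"
  by (simp_all add: min_nonstd_def)

lemma lead_exp_nf_basis:
  "a \<in> min_nonstd \<Longrightarrow> lead_exp d (xpow a - xpow (nf (weight d n a)) :: ('k::field) mpol) = a"
  by (rule lead_exp_nf_binomial) (simp_all add: min_nonstd_exps)

lemma lead_mon_nf_basis: "lead_mon d ` nf_basis = (xpow ` min_nonstd :: ('k::field) mpol set)"
  unfolding nf_basis_def image_image lead_mon_def
  by (intro image_cong refl arg_cong[of _ _ xpow] lead_exp_nf_basis)

lemma minimal_groebner_nf_basis:
  assumes fin: "finite min_nonstd"
  shows "minimal_groebner_basis d (semigroup_ideal d n) (nf_basis :: ('k::field) mpol set)"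
proof -
  let ?I = "semigroup_ideal d n :: 'k mpol set"
  let ?P = "mpol_ring d :: 'k mpol ring"
  let ?L = "xpow ` min_nonstd :: 'k mpol set"
  have L_carrier: "?L \<subseteq> carrier ?P" using min_nonstd_exps(1) by auto
  have L_ideal: "ideal (Idl\<^bsub>?P\<^esub> ?L) ?P" by (rule mpol_Idl_ideal[OF L_carrier])
  have sub: "nf_basis \<subseteq> ?I - {0}"
  proof
    fix f :: "'k mpol" assume "f \<in> nf_basis"
    then obtain a where a: "a \<in> min_nonstd" "f = xpow a - xpow (nf (weight d n a))"
      unfolding nf_basis_def by blast
    have "a \<noteq> nf (weight d n a)" using is_nf_iff min_nonstd_exps[OF a(1)] by metis
    then have "f \<noteq> 0" using a(2) by simp
    then show "f \<in> ?I - {0}" using nf_binomial_in_ideal[OF min_nonstd_exps(1)[OF a(1)]] a(2) by simp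
  qed
  have lead_carrier: "lead_mon d ` (?I - {0}) \<subseteq> carrier ?P"
    using semigroup_ideal_lead_exp(1) by (auto simp: lead_mon_def)
  have Idl_eq: "Idl\<^bsub>?P\<^esub> (lead_mon d ` (?I - {0})) = Idl\<^bsub>?P\<^esub> ?L"
  proof
    show "Idl\<^bsub>?P\<^esub> (lead_mon d ` (?I - {0})) \<subseteq> Idl\<^bsub>?P\<^esub> ?L"
    proof (rule mpol_Idl_minimal[OF L_ideal], rule image_subsetI)
      fix f assume f: "f \<in> ?I - {0}"
      then obtain b c where bc: "b \<in> min_nonstd" "c \<in> exps d" "lead_exp d f = b + c"
        using min_nonstd_exists[OF semigroup_ideal_lead_exp[of f]] by blast
      have "xpow b \<in> Idl\<^bsub>?P\<^esub> ?L" using bc(1) by (intro mpol_Idl_self[OF L_carrier]) simp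
      then show "lead_mon d f \<in> Idl\<^bsub>?P\<^esub> ?L"
        unfolding lead_mon_def bc(3) by (rule xpow_mult_in_ideal[OF L_ideal _ bc(2)])
    qed
    show "Idl\<^bsub>?P\<^esub> ?L \<subseteq> Idl\<^bsub>?P\<^esub> (lead_mon d ` (?I - {0}))"
      using sub by (intro mpol_Idl_mono[OF lead_carrier]) (simp add: image_mono flip: lead_mon_nf_basis)
  qed
  have "Idl\<^bsub>?P\<^esub> E' \<noteq> Idl\<^bsub>?P\<^esub> ?L" if E': "E' \<subset> ?L" for E'
  proof
    assume eq: "Idl\<^bsub>?P\<^esub> E' = Idl\<^bsub>?P\<^esub> ?L"
    define A where "A = {a \<in> min_nonstd. xpow a \<in> E'}"
    have E'_eq: "E' = xpow ` A" using E' unfolding A_def by auto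
    obtain a where a: "a \<in> min_nonstd" "xpow a \<notin> E'" using E' by blast
    have "xpow a \<in> Idl\<^bsub>?P\<^esub> ?L" using a(1) by (intro mpol_Idl_self[OF L_carrier]) simp
    then have "xpow a \<in> Idl\<^bsub>?P\<^esub> (xpow ` A)" using eq E'_eq by simp
    moreover have "A \<subseteq> exps d" using min_nonstd_exps(1) by (auto simp: A_def)
    ultimately have "\<exists>b\<in>A. \<exists>c\<in>exps d. a = b + c"
      by (intro keys_monomial_ideal[of A d "xpow a :: 'k mpol"]) auto
    then obtain b c where bc: "b \<in> A" "a = b + c" by blast
    then have "b \<in> min_nonstd" "xpow b \<in> E'" by (simp_all add: A_def)
    \<comment> \<open>No minimal generator divides another, so dropping one monomial loses it from
      the ideal.\<close>
    then have "a = b" using min_nonstd_antichain[OF a(1) _ bc(2)] by simp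
    then show False using a(2) \<open>xpow b \<in> E'\<close> by simp
  qed
  moreover have "inj_on (lead_mon d) (nf_basis :: 'k mpol set)"
  proof (rule inj_onI)
    fix f g :: "'k mpol"
    assume "f \<in> nf_basis" "g \<in> nf_basis" and eq: "lead_mon d f = lead_mon d g"
    then obtain a b where a: "a \<in> min_nonstd" "f = xpow a - xpow (nf (weight d n a))"
      and b: "b \<in> min_nonstd" "g = xpow b - xpow (nf (weight d n b))"
      unfolding nf_basis_def by blast
    have "a = b" using eq lead_exp_nf_basis[OF a(1), where 'k='k] lead_exp_nf_basis[OF b(1), where 'k='k]
      by (simp add: lead_mon_def a(2) b(2))
    then show "f = g" using a b by simp
  qed
  moreover have "finite (nf_basis :: 'k mpol set)" using fin by (simp add: nf_basis_def)
  ultimately show ?thesis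
    using sub L_carrier
    unfolding minimal_groebner_basis_def minimal_generating_set_def lead_mon_nf_basis Idl_eq by blast
qed

text \<open>Reduction terminates although the order is local, because it stays inside a finite fibre.\<close>

lemma groebner_basis_generates:
  fixes G :: "('k::field) mpol set"
  assumes gb: "minimal_groebner_basis d (semigroup_ideal d n) G" and bin: "\<forall>f\<in>G. is_binomial d f"
  shows "Idl\<^bsub>mpol_ring d\<^esub> G = semigroup_ideal d n"
proof
  let ?I = "semigroup_ideal d n :: 'k mpol set"
  let ?P = "mpol_ring d :: 'k mpol ring"
  have G: "G \<subseteq> ?I - {0}" using gb by (simp add: minimal_groebner_basis_def)
  then show "Idl\<^bsub>?P\<^esub> G \<subseteq> ?I" by (intro mpol_Idl_minimal[OF semigroup_ideal_is_ideal]) blast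
  have GI: "\<And>f. f \<in> G \<Longrightarrow> f \<in> ?I" "\<And>f. f \<in> G \<Longrightarrow> f \<noteq> 0" using G by auto
  have G_carrier: "G \<subseteq> carrier ?P" using keys_semigroup_ideal GI(1) by fastforce
  have GJ: "ideal (Idl\<^bsub>?P\<^esub> G) ?P" by (rule mpol_Idl_ideal[OF G_carrier])
  have L_exps: "lead_exp d ` G \<subseteq> exps d" using GI semigroup_ideal_lead_exp(1) by blast
  have leadG: "lead_mon d ` G = xpow ` lead_exp d ` G" by (simp add: image_image lead_mon_def)
  have Idl_lead: "Idl\<^bsub>?P\<^esub> (lead_mon d ` G) = Idl\<^bsub>?P\<^esub> (lead_mon d ` (?I - {0}))"
    using gb by (simp add: minimal_groebner_basis_def minimal_generating_set_def)
  have lead_carrier: "lead_mon d ` (?I - {0}) \<subseteq> carrier ?P"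
    using semigroup_ideal_lead_exp(1) by (auto simp: lead_mon_def)
  \<comment> \<open>One reduction step: \<open>a\<close> leads the binomial with its normal form,
    hence is a multiple of the leading monomial of some \<open>f\<close> in \<open>G\<close>, and is
    replaced by the same multiple of the other term of \<open>f\<close>.\<close>
  have step: "\<exists>b\<in>exps d. weight d n b = weight d n a \<and> ds_less d b a \<and> xpow a - xpow b \<in> Idl\<^bsub>?P\<^esub> G"
    if a: "a \<in> exps d" "\<not> is_nf a" for a
  proof -
    let ?f = "xpow a - xpow (nf (weight d n a)) :: 'k mpol"
    have "a \<noteq> nf (weight d n a)" using is_nf_iff a by metis
    then have "?f \<in> ?I - {0}" using nf_binomial_in_ideal[OF a(1), where 'k='k] by simp
    then have "lead_mon d ?f \<in> Idl\<^bsub>?P\<^esub> (xpow ` lead_exp d ` G)"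
      unfolding leadG[symmetric] Idl_lead by (intro mpol_Idl_self[OF lead_carrier] imageI)
    moreover have "lead_exp d ?f = a" by (rule lead_exp_nf_binomial[OF a])
    ultimately have "xpow a \<in> Idl\<^bsub>?P\<^esub> (xpow ` lead_exp d ` G)" by (simp only: lead_mon_def)
    then have "\<exists>u\<in>lead_exp d ` G. \<exists>c\<in>exps d. a = u + c"
      by (intro keys_monomial_ideal[OF L_exps, of "xpow a"]) simp_all
    then obtain f c where f: "f \<in> G" and c: "c \<in> exps d" "a = lead_exp d f + c" by blast
    obtain u v where uv: "u \<in> exps d" "v \<in> exps d" "f = xpow u - xpow v"
      using bin f unfolding is_binomial_def by blast
    have ne: "u \<noteq> v" using GI(2)[OF f] uv(3) by auto
    have keys: "Poly_Mapping.keys f = {u, v}" unfolding uv(3) by (rule keys_binomial[OF ne])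
    have keys': "Poly_Mapping.keys f \<subseteq> exps d" using keys uv by simp
    have w: "weight d n u = weight d n v"
      using GI(1)[OF f] uv binomial_in_semigroup_ideal_iff by blast
    have lead: "lead_exp d f \<in> {u, v}" "\<And>b. b \<in> {u, v} \<Longrightarrow> b \<noteq> lead_exp d f \<Longrightarrow> ds_less d b (lead_exp d f)"
      using lead_exp_in_keys[OF GI(2)[OF f] keys'] keys by auto
    have fc: "Poly_Mapping.single c k * f \<in> Idl\<^bsub>?P\<^esub> G" for k
      by (rule mpol_ideal_single[OF GJ mpol_Idl_self[OF G_carrier f] c(1)])
    from lead(1) consider "lead_exp d f = u" | "lead_exp d f = v" by blast
    then show ?thesis
    proof cases
      case 1
      then have "ds_less d v u" using lead(2)[of v] ne by simp
      then have "ds_less d (v + c) a" using c 1 by (simp add: ds_less_add)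
      moreover have "a = u + c" using c(2) 1 by simp
      then have "xpow a - xpow (v + c) = Poly_Mapping.single c 1 * f"
        using xpow_shift_binomial[of c u v, where 'k='k] by (simp add: uv(3) add.commute)
      ultimately show ?thesis using fc[of 1] uv c w 1 by (intro bexI[of _ "v + c"]) auto
    next
      case 2
      then have "ds_less d u v" using lead(2)[of u] ne by simp
      then have "ds_less d (u + c) a" using c 2 by (simp add: ds_less_add)
      moreover have "a = v + c" using c(2) 2 by simp
      then have "xpow a - xpow (u + c) = - (xpow (c + u) - xpow (c + v) :: 'k mpol)"
        by (simp add: add.commute)
      then have "xpow a - xpow (u + c) = - (Poly_Mapping.single c 1 * f)"
        unfolding xpow_shift_binomial uv(3) .
      ultimately show ?thesis using mpol_ideal_uminus[OF GJ fc[of 1]] uv c w 2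
        by (intro bexI[of _ "u + c"]) auto
    qed
  qed
  show "?I \<subseteq> Idl\<^bsub>?P\<^esub> G"
  proof (rule semigroup_ideal_subsetI[OF GJ])
    fix a assume "a \<in> exps d"
    then show "xpow a - xpow (nf (weight d n a)) \<in> Idl\<^bsub>?P\<^esub> G"
    proof (induction "card {b \<in> exps d. weight d n b = weight d n a \<and> ds_less d b a}" arbitrary: a rule: less_induct)
      case less
      show ?case
      proof (cases "is_nf a")
        case True
        then have "nf (weight d n a) = a" using is_nf_iff[OF less.prems] by simp
        then show ?thesis using mpol_ideal_zero[OF GJ] by simp
      next
        case False
        then obtain b where b: "b \<in> exps d" "weight d n b = weight d n a" "ds_less d b a"
          "xpow a - xpow b \<in> Idl\<^bsub>?P\<^esub> G" using step[OF less.prems] by blast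
        have "{c \<in> exps d. weight d n c = weight d n b \<and> ds_less d c b}
            \<subset> {c \<in> exps d. weight d n c = weight d n a \<and> ds_less d c a}"
          using b ds_less_trans[OF _ b(3)] ds_less_irrefl[of d b] by auto
        moreover have "finite {c \<in> exps d. weight d n c = weight d n a \<and> ds_less d c a}"
          by (rule finite_subset[OF _ finite_fibre[of "weight d n a"]]) auto
        ultimately have "xpow b - xpow (nf (weight d n b)) \<in> Idl\<^bsub>?P\<^esub> G"
          by (intro less.hyps[OF _ b(1)] psubset_card_mono)
        then have "(xpow a - xpow b) + (xpow b - xpow (nf (weight d n b))) \<in> Idl\<^bsub>?P\<^esub> G"
          by (rule mpol_ideal_add[OF GJ b(4)])
        then show ?thesis using b(2) by simp
      qed
    qed
  qed
qed

text \<open>A generating subset of least cardinality has no proper generating subset.\<close>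

lemma (in -) minimal_generating_subset_exists:
  assumes "finite G" "G \<subseteq> carrier R" "Idl\<^bsub>R\<^esub> G = I"
  shows "\<exists>E\<subseteq>G. minimal_generating_set R E I"
proof -
  let ?P = "\<lambda>E. E \<subseteq> G \<and> Idl\<^bsub>R\<^esub> E = I"
  have "?P G" using assms by simp
  then obtain E where E: "?P E" and min: "\<And>E'. ?P E' \<Longrightarrow> card E \<le> card E'"
    using ex_has_least_nat[of ?P G card] by blast
  have "Idl\<^bsub>R\<^esub> E' \<noteq> I" if "E' \<subset> E" for E'
  proof
    assume "Idl\<^bsub>R\<^esub> E' = I"
    then have "card E \<le> card E'" using that E by (intro min) auto
    moreover have "card E' < card E"
      using that E finite_subset[OF _ assms(1)] by (intro psubset_card_mono) auto
    ultimately show False by simp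
  qed
  then show ?thesis using E assms(2) unfolding minimal_generating_set_def by (intro exI[of _ E]) auto
qed

section \<open>Conditions (3), (4) and (5) as predicates\<close>

definition good_generators :: "('k::field) mpol set \<Rightarrow> bool" where
  "good_generators E \<longleftrightarrow> (\<forall>f\<in>E. is_binomial d f) \<and>
     minimal_generating_set (mpol_ring d) E (semigroup_ideal d n) \<and>
     (\<forall>a\<in>exps d. \<forall>b\<in>exps d.
        (xpow a - xpow b \<in> E \<or> xpow b - xpow a \<in> E) \<and>
        total_deg d a > total_deg d b \<longrightarrow> Poly_Mapping.lookup a 1 \<noteq> 0)"

definition good_standard_basis :: "('k::field) mpol set \<Rightarrow> bool" where
  "good_standard_basis E \<longleftrightarrow> (\<forall>f\<in>E. is_binomial d f) \<and>
     minimal_generating_set (mpol_ring d) E (semigroup_ideal d n) \<and>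
     standard_basis d (semigroup_ideal d n) E \<and>
     (\<forall>a\<in>exps d. \<forall>b\<in>exps d.
        (xpow a - xpow b \<in> E \<or> xpow b - xpow a \<in> E) \<and>
        total_deg d a > total_deg d b \<longrightarrow> Poly_Mapping.lookup a 1 \<noteq> 0)"

definition good_groebner_basis :: "('k::field) mpol set \<Rightarrow> bool" where
  "good_groebner_basis G \<longleftrightarrow> minimal_groebner_basis d (semigroup_ideal d n) G \<and>
     (\<forall>f\<in>G. is_binomial d f) \<and>
     (\<forall>a\<in>exps d. \<forall>b\<in>exps d.
        xpow a - xpow b \<in> G \<and> \<not> homogeneous_mpol d (xpow a - xpow b :: 'k mpol) \<longrightarrow>
          1 \<in> binomial_support d a b) \<and>
     (\<forall>f\<in>G. \<not> (xpow (Poly_Mapping.single 1 1) divides\<^bsub>mpol_ring d\<^esub> lead_mon d f))"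

lemma x1_divides_iff:
  assumes "a \<in> exps d"
  shows "xpow (Poly_Mapping.single 1 1) divides\<^bsub>mpol_ring d\<^esub> (xpow a :: ('k::field) mpol) \<longleftrightarrow>
    Poly_Mapping.lookup a 1 \<noteq> 0"
proof
  assume "xpow (Poly_Mapping.single 1 1) divides\<^bsub>mpol_ring d\<^esub> (xpow a :: 'k mpol)"
  then obtain c :: "'k mpol" where "xpow a = xpow (Poly_Mapping.single 1 1) * c"
    unfolding factor_def by auto
  then have "a \<in> Poly_Mapping.keys (xpow (Poly_Mapping.single 1 1) * c)" by (metis keys_xpow singletonI)
  then obtain b where "a = Poly_Mapping.single 1 1 + b"
    using keys_mult[of "xpow (Poly_Mapping.single 1 1)" c] by auto
  then show "Poly_Mapping.lookup a 1 \<noteq> 0" by (simp add: lookup_add)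
next
  assume "Poly_Mapping.lookup a 1 \<noteq> 0"
  then obtain b where b: "b \<in> exps d" "a = b + e1" using remove_e1[OF assms] by auto
  then have "xpow a = xpow (Poly_Mapping.single 1 1) * (xpow b :: 'k mpol)"
    by (simp only: e1_def xpow_add mult.commute)
  then show "xpow (Poly_Mapping.single 1 1) divides\<^bsub>mpol_ring d\<^esub> (xpow a :: 'k mpol)"
    unfolding factor_def using b(1) by (intro bexI[of _ "xpow b"]) auto
qed

lemma homogeneous_binomial_iff:
  "homogeneous_mpol d (xpow a - xpow b :: ('k::field) mpol) \<longleftrightarrow> total_deg d a = total_deg d b"
proof (cases "a = b")
  case True
  then show ?thesis by (simp add: homogeneous_mpol_def)
next
  case False
  then show ?thesis unfolding homogeneous_mpol_def keys_binomial[OF False] by auto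
qed

text \<open>In a non-homogeneous element the tail supplies \<open>x_1\<close>: it is a longest
  factorization, so the leading exponent is not maximal, its weight is outside the Apery set by
  homogeneity, and normal forms over such weights involve \<open>x_1\<close>.\<close>

lemma good_groebner_basis_nf_basis:
  assumes hom: apery_homogeneous and reg: ord_regular
  shows "good_groebner_basis (nf_basis :: ('k::field) mpol set)"
  unfolding good_groebner_basis_def
proof (intro conjI ballI impI)
  show "minimal_groebner_basis d (semigroup_ideal d n) (nf_basis :: 'k mpol set)"
    by (rule minimal_groebner_nf_basis[OF finite_min_nonstd[OF reg]])
next
  fix f :: "'k mpol" assume "f \<in> nf_basis"
  then obtain a where a: "a \<in> min_nonstd" "f = xpow a - xpow (nf (weight d n a))"
    unfolding nf_basis_def by blast
  have ax: "a \<in> exps d" by (rule min_nonstd_exps(1)[OF a(1)])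
  show "is_binomial d f" unfolding is_binomial_def a(2) using ax nf_weight(3)[OF ax] by blast
  have "lead_mon d f = xpow a" unfolding lead_mon_def a(2) lead_exp_nf_basis[OF a(1)] ..
  then show "\<not> (xpow (Poly_Mapping.single 1 1) divides\<^bsub>mpol_ring d\<^esub> lead_mon d f)"
    using x1_divides_iff[OF ax, where 'k='k] min_nonstd_first_zero[OF reg a(1)] by simp
next
  fix a b
  assume ab: "a \<in> exps d" "b \<in> exps d" and
    "xpow a - xpow b \<in> (nf_basis :: 'k mpol set) \<and> \<not> homogeneous_mpol d (xpow a - xpow b :: 'k mpol)"
  then obtain u where u: "u \<in> min_nonstd" "xpow a - xpow b = (xpow u - xpow (nf (weight d n u)) :: 'k mpol)"
    and len: "total_deg d a \<noteq> total_deg d b"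
    unfolding nf_basis_def homogeneous_binomial_iff by blast
  let ?v = "nf (weight d n u)"
  have ux: "u \<in> exps d" by (rule min_nonstd_exps(1)[OF u(1)])
  have "a \<noteq> b" using len by auto
  then have eq: "{a, b} = {u, ?v}" using binomial_eq_iff[OF _ u(2)] by simp
  then have "total_deg d u \<noteq> total_deg d ?v" using len by (auto simp: doubleton_eq_iff)
  then have "\<not> maxfac u"
    using is_nf_maxfac[OF nf_weight(1)[OF ux]] nf_weight(2)[OF ux] by (simp add: maxfac_iff_ord)
  then have "weight d n u \<notin> apery S (n 1)" using hom ux by (auto simp: apery_homogeneous_def)
  then have "Poly_Mapping.lookup ?v 1 \<noteq> 0"
    using nf_first_nonzero[OF reg nf_weight(1)[OF ux]] nf_weight(2)[OF ux] by simp
  then have "Poly_Mapping.lookup a 1 + Poly_Mapping.lookup b 1 \<noteq> 0"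
    using eq by (auto simp: doubleton_eq_iff)
  then show "1 \<in> binomial_support d a b" unfolding binomial_support_def using d_pos by blast
qed

text \<open>For a local order the shorter term of a binomial leads. It is free of
  \<open>x_1\<close>, so if \<open>x_1\<close> is in the support it must divide the longer term, as
  (3) demands.\<close>

lemma good_groebner_basis_imp_generators:
  fixes G :: "('k::field) mpol set"
  assumes G: "good_groebner_basis G"
  shows "\<exists>E\<subseteq>G. good_generators E"
proof -
  have gb: "minimal_groebner_basis d (semigroup_ideal d n) G" and bin: "\<forall>f\<in>G. is_binomial d f"
    using G by (simp_all add: good_groebner_basis_def)
  have GI: "finite G" "G \<subseteq> semigroup_ideal d n - {0}" using gb by (simp_all add: minimal_groebner_basis_def)
  have G_carrier: "G \<subseteq> carrier (mpol_ring d)"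
    using GI(2) keys_semigroup_ideal[where 'k='k and d = d and n = n] by auto
  obtain E where E: "E \<subseteq> G" "minimal_generating_set (mpol_ring d) E (semigroup_ideal d n)"
    using minimal_generating_subset_exists[OF GI(1) G_carrier groebner_basis_generates[OF gb bin]] by blast
  have "Poly_Mapping.lookup a 1 \<noteq> 0"
    if ab: "a \<in> exps d" "b \<in> exps d" and f: "f = xpow a - xpow b \<or> f = xpow b - xpow a" "f \<in> G"
      and len: "total_deg d b < total_deg d a" for a b f
  proof -
    have ne: "a \<noteq> b" using len by auto
    have keys: "Poly_Mapping.keys f = {a, b}" using f(1) keys_binomial[OF ne] keys_binomial[OF ne[symmetric]] by auto
    have "ds_less d a b" using len by (simp add: ds_less_def)
    then have "lead_exp d f = b" by (intro lead_exp_eqI) (auto simp: keys)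
    then have "\<not> (xpow (Poly_Mapping.single 1 1) divides\<^bsub>mpol_ring d\<^esub> (xpow b :: 'k mpol))"
      using G f(2) unfolding good_groebner_basis_def lead_mon_def by metis
    then have "Poly_Mapping.lookup b 1 = 0" using x1_divides_iff[OF ab(2)] by blast
    moreover have "1 \<in> binomial_support d a b \<or> 1 \<in> binomial_support d b a"
      using f(1)
    proof
      assume "f = xpow a - xpow b"
      then have "1 \<in> binomial_support d a b"
        using G f(2) ab len homogeneous_binomial_iff[of a b, where 'k='k] unfolding good_groebner_basis_def by auto
      then show ?thesis ..
    next
      assume "f = xpow b - xpow a"
      then have "1 \<in> binomial_support d b a"
        using G f(2) ab len homogeneous_binomial_iff[of b a, where 'k='k] unfolding good_groebner_basis_def by auto
      then show ?thesis ..
    qed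
    ultimately show ?thesis by (auto simp: binomial_support_def)
  qed
  then have "good_generators E" using E bin unfolding good_generators_def by blast
  then show ?thesis using E(1) by blast
qed

end

subsection \<open>Initial forms\<close>

lemma keys_hom_component:
  "Poly_Mapping.keys (hom_component d m f) = {a \<in> Poly_Mapping.keys f. total_deg d a = m}"
  "Poly_Mapping.lookup (hom_component d m f) a = (if total_deg d a = m then Poly_Mapping.lookup f a else 0)"
proof -
  have "Poly_Mapping.lookup (hom_component d m f) a = (if total_deg d a = m then Poly_Mapping.lookup f a else 0)" for a
  proof -
    have "Poly_Mapping.lookup (hom_component d m f) a =
        (\<Sum>b\<in>{b \<in> Poly_Mapping.keys f. total_deg d b = m}. if a = b then Poly_Mapping.lookup f b else 0)"
      unfolding hom_component_def lookup_sum by (intro sum.cong) (auto simp: lookup_single when_def)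
    also have "\<dots> = (if total_deg d a = m then Poly_Mapping.lookup f a else 0)"
      by (auto simp: in_keys_iff)
    finally show ?thesis .
  qed
  then show "Poly_Mapping.lookup (hom_component d m f) a = (if total_deg d a = m then Poly_Mapping.lookup f a else 0)"
    "Poly_Mapping.keys (hom_component d m f) = {a \<in> Poly_Mapping.keys f. total_deg d a = m}"
    by (auto simp: in_keys_iff split: if_splits)
qed

lemma keys_initial_form_subset: "Poly_Mapping.keys (initial_form d f) \<subseteq> Poly_Mapping.keys f"
  by (auto simp: initial_form_def keys_hom_component)

lemma initial_form_homogeneous_binomial:
  assumes "total_deg d a = total_deg d b"
  shows "initial_form d (xpow a - xpow b) = (xpow a - xpow b :: ('k::field) mpol)"
proof (cases "a = b")
  case True
  then show ?thesis by (simp add: initial_form_def hom_component_def)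
next
  case False
  then have keys: "Poly_Mapping.keys (xpow a - xpow b :: 'k mpol) = {a, b}" by (rule keys_binomial)
  show ?thesis
  proof (rule poly_mapping_eqI)
    fix k
    show "Poly_Mapping.lookup (initial_form d (xpow a - xpow b)) k =
        Poly_Mapping.lookup (xpow a - xpow b :: 'k mpol) k"
      unfolding initial_form_def keys using assms
      by (auto simp: keys_hom_component lookup_minus lookup_xpow)
  qed
qed

lemma initial_form_inhomogeneous_binomial:
  assumes "total_deg d b < total_deg d a" "f = xpow a - xpow b \<or> f = (xpow b - xpow a :: ('k::field) mpol)"
  shows "\<exists>c. xpow b = Poly_Mapping.single 0 c * initial_form d f"
proof -
  have "a \<noteq> b" using assms(1) by auto
  then have keys: "Poly_Mapping.keys f = {a, b}"
    using assms(2) keys_binomial[of a b, where 'k='k] keys_binomial[of b a, where 'k='k] by auto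
  have min: "Min (total_deg d ` {a, b}) = total_deg d b" using assms(1) by simp
  define c where "c = Poly_Mapping.lookup f b"
  \<comment> \<open>The coefficient is 1 or -1 according to the orientation of the binomial, hence
    its own inverse.\<close>
  have c: "c * c = 1"
    using assms(2) \<open>a \<noteq> b\<close> by (auto simp: c_def lookup_minus lookup_xpow)
  have "initial_form d f = Poly_Mapping.single b c"
  proof (rule poly_mapping_eqI)
    fix k
    show "Poly_Mapping.lookup (initial_form d f) k = Poly_Mapping.lookup (Poly_Mapping.single b c) k"
    proof (cases "k \<in> {a, b}")
      case True
      then show ?thesis unfolding initial_form_def keys min
        using assms(1) by (auto simp: keys_hom_component lookup_single when_def c_def)
    next
      case False
      then have "Poly_Mapping.lookup f k = 0" using keys not_in_keys_iff_lookup_eq_zero[of k f] by blast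
      then show ?thesis unfolding initial_form_def
        using False by (auto simp: keys_hom_component lookup_single when_def)
    qed
  qed
  then have "xpow b = Poly_Mapping.single 0 c * initial_form d f" by (simp add: mult_single c xpow_def)
  then show ?thesis ..
qed

context semigroup_generators
begin

section \<open>From generators to the combinatorial condition\<close>

lemma moves_weight:
  assumes "E \<subseteq> (semigroup_ideal d n :: ('k::field) mpol set)" "(move d E)\<^sup>*\<^sup>* a b" "a \<in> exps d"
  shows "weight d n b = weight d n a \<and> b \<in> exps d"
  using assms(2)
proof (induction rule: rtranclp_induct)
  case (step y z)
  then show ?case using move_weight[OF assms(1) step.hyps(2)] by simp
qed (simp add: assms(3))

lemma good_generators_subset:
  assumes "good_generators (E :: ('k::field) mpol set)"
  shows "E \<subseteq> carrier (mpol_ring d)" "Idl\<^bsub>mpol_ring d\<^esub> E = semigroup_ideal d n" "E \<subseteq> semigroup_ideal d n"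
proof -
  show E: "E \<subseteq> carrier (mpol_ring d)" "Idl\<^bsub>mpol_ring d\<^esub> E = semigroup_ideal d n"
    using assms by (simp_all add: good_generators_def minimal_generating_set_def)
  then show "E \<subseteq> semigroup_ideal d n" using mpol_Idl_self[OF E(1)] by blast
qed

lemma good_generators_move:
  fixes E :: "('k::field) mpol set"
  assumes E: "good_generators E" and mv: "move d E p q" and len: "total_deg d p < total_deg d q"
  shows "Poly_Mapping.lookup q 1 \<noteq> 0"
  using mv
proof (rule moveE)
  fix m u v
  assume uv: "u \<in> exps d" "v \<in> exps d" "xpow u - xpow v \<in> E \<or> xpow v - xpow u \<in> E" "p = m + u" "q = m + v"
  then have "total_deg d u < total_deg d v" using len by simp
  then have "Poly_Mapping.lookup v 1 \<noteq> 0" using E uv unfolding good_generators_def by blast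
  then show ?thesis using uv(5) by (simp add: lookup_add)
qed

lemma good_generators_connect:
  assumes "good_generators (E :: ('k::field) mpol set)" "a \<in> exps d" "b \<in> exps d" "weight d n a = weight d n b"
  shows "(move d E)\<^sup>*\<^sup>* a b"
  using moves_connect_fibres[OF _ good_generators_subset(2)[OF assms(1)] assms(2-4)] assms(1)
  by (simp add: good_generators_def)

lemma restricted_moves:
  "(\<lambda>x y. r x y \<and> Q x \<and> Q y)\<^sup>*\<^sup>* a p \<Longrightarrow> r\<^sup>*\<^sup>* a p"
  by (rule rtranclp_mono[THEN predicate2D, rotated]) auto

text \<open>Every move that changes the length has \<open>x_1\<close> on its longer side, but no
  factorization of an Apery element involves \<open>x_1\<close>.\<close>

lemma good_generators_imp_apery_homogeneous:
  assumes E: "good_generators (E :: ('k::field) mpol set)"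
  shows apery_homogeneous
  unfolding apery_homogeneous_def maxfac_def
proof (intro ballI impI conjI)
  fix a b
  assume a: "a \<in> exps d" "weight d n a \<in> apery S (n 1)" and b: "b \<in> exps d" "weight d n b = weight d n a"
  have E_sub: "E \<subseteq> semigroup_ideal d n" by (rule good_generators_subset(3)[OF E])
  show "total_deg d b \<le> total_deg d a"
  proof (rule ccontr)
    assume "\<not> ?thesis"
    then have nb: "\<not> total_deg d b = total_deg d a" by simp
    obtain p q where pq: "(\<lambda>x y. move d E x y \<and> total_deg d x = total_deg d a \<and> total_deg d y = total_deg d a)\<^sup>*\<^sup>* a p"
      "total_deg d p = total_deg d a" "move d E p q" "\<not> total_deg d q = total_deg d a"
      using rtranclp_first_exit[OF good_generators_connect[OF E a(1) b(1) b(2)[symmetric]],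
          of "\<lambda>x. total_deg d x = total_deg d a", OF refl nb] by (elim exE conjE)
    have "(move d E)\<^sup>*\<^sup>* a p" by (rule restricted_moves[OF pq(1)])
    then have p: "weight d n p = weight d n a" "p \<in> exps d" using moves_weight[OF E_sub _ a(1), of p] by simp_all
    have q: "weight d n q = weight d n a" "q \<in> exps d" using move_weight[OF E_sub pq(3)] p by simp_all
    have "Poly_Mapping.lookup p 1 = 0" "Poly_Mapping.lookup q 1 = 0"
      using a(2) p q unfolding apery_iff by blast+
    moreover have "total_deg d p < total_deg d q \<or> total_deg d q < total_deg d p" using pq by linarith
    ultimately show False using good_generators_move[OF E pq(3)] good_generators_move[OF E move_sym[OF pq(3)]] by blast
  qed
qed auto

text \<open>On a walk from \<open>c + e1\<close> to a longer factorization, the first element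
  \<open>q\<close> exceeding the length of \<open>c + e1\<close> involves \<open>x_1\<close>.
  Removing that \<open>x_1\<close> gives a factorization of the weight of \<open>c\<close> longer
  than \<open>c\<close>.\<close>

lemma good_generators_imp_ord_regular:
  assumes E: "good_generators (E :: ('k::field) mpol set)"
  shows ord_regular
  unfolding ord_regular_def
proof (intro allI impI)
  fix c assume c: "maxfac c"
  then have cx: "c + e1 \<in> exps d" by (simp add: maxfac_def)
  have E_sub: "E \<subseteq> semigroup_ideal d n" by (rule good_generators_subset(3)[OF E])
  show "maxfac (c + e1)" unfolding maxfac_def
  proof (intro conjI ballI impI cx)
    fix a assume a: "a \<in> exps d" "weight d n a = weight d n (c + e1)"
    let ?Q = "\<lambda>x. total_deg d x \<le> total_deg d (c + e1)"
    show "?Q a"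
    proof (rule ccontr)
      assume na: "\<not> ?Q a"
      obtain p q where pq: "(\<lambda>x y. move d E x y \<and> ?Q x \<and> ?Q y)\<^sup>*\<^sup>* (c + e1) p" "?Q p" "move d E p q" "\<not> ?Q q"
        using rtranclp_first_exit[OF good_generators_connect[OF E cx a(1) a(2)[symmetric]], of ?Q, OF order_refl na]
        by (elim exE conjE)
      have "(move d E)\<^sup>*\<^sup>* (c + e1) p" by (rule restricted_moves[OF pq(1)])
      then have p: "weight d n p = weight d n (c + e1)" using moves_weight[OF E_sub _ cx, of p] by simp
      have q: "weight d n q = weight d n (c + e1)" "q \<in> exps d" using move_weight[OF E_sub pq(3)] p by simp_all
      have "total_deg d p < total_deg d q" using pq(2,4) by linarith
      then have "Poly_Mapping.lookup q 1 \<noteq> 0" by (rule good_generators_move[OF E pq(3)])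
      then obtain b where b: "b \<in> exps d" "q = b + e1" using remove_e1[OF q(2)] by auto
      then have "total_deg d b \<le> total_deg d c" using c q(1) by (simp add: maxfac_def)
      then show False using pq(4) b(2) by simp
    qed
  qed
qed

text \<open>The finite \<open>nf_basis\<close> stands in for Hilbert's basis theorem: each of its
  elements needs finitely many members of \<open>E\<close>, and by minimality the union of these
  cannot be a proper subset of \<open>E\<close>.\<close>

lemma good_generators_finite:
  fixes E :: "('k::field) mpol set"
  assumes E: "good_generators E"
  shows "finite E"
proof -
  let ?P = "mpol_ring d :: 'k mpol ring"
  have c5: "good_groebner_basis (nf_basis :: 'k mpol set)"
    by (rule good_groebner_basis_nf_basis[OF good_generators_imp_apery_homogeneous[OF E] good_generators_imp_ord_regular[OF E]])
  then have fin: "finite (nf_basis :: 'k mpol set)"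
    by (simp add: good_groebner_basis_def minimal_groebner_basis_def)
  have gen: "Idl\<^bsub>?P\<^esub> (nf_basis :: 'k mpol set) = semigroup_ideal d n"
    using c5 by (intro groebner_basis_generates) (simp_all add: good_groebner_basis_def)
  have sub: "(nf_basis :: 'k mpol set) \<subseteq> semigroup_ideal d n"
    using c5 by (auto simp: good_groebner_basis_def minimal_groebner_basis_def)
  note E' = good_generators_subset[OF E]
  have "\<exists>F. finite F \<and> F \<subseteq> E \<and> g \<in> Idl\<^bsub>?P\<^esub> F" if "g \<in> nf_basis" for g
  proof (rule mpol_Idl_finite_subset[OF E'(1)])
    show "g \<in> Idl\<^bsub>?P\<^esub> E" using subsetD[OF sub that] E'(2) by simp
  qed
  then obtain F where F: "\<And>g. g \<in> nf_basis \<Longrightarrow> finite (F g) \<and> F g \<subseteq> E \<and> g \<in> Idl\<^bsub>?P\<^esub> (F g)"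
    by metis
  let ?U = "\<Union>g\<in>nf_basis. F g"
  have U: "finite ?U" "?U \<subseteq> E" using F fin by auto
  have Uc: "?U \<subseteq> carrier ?P" by (rule subset_trans[OF U(2) E'(1)])
  have UJ: "ideal (Idl\<^bsub>?P\<^esub> ?U) ?P" by (rule mpol_Idl_ideal[OF Uc])
  have "nf_basis \<subseteq> Idl\<^bsub>?P\<^esub> ?U"
  proof
    fix g :: "'k mpol" assume g: "g \<in> nf_basis"
    then have "F g \<subseteq> ?U" by blast
    then show "g \<in> Idl\<^bsub>?P\<^esub> ?U" using mpol_Idl_mono[OF Uc, of "F g"] F[OF g] by blast
  qed
  then have "semigroup_ideal d n \<subseteq> Idl\<^bsub>?P\<^esub> ?U"
    unfolding gen[symmetric] by (rule mpol_Idl_minimal[OF UJ])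
  moreover have "Idl\<^bsub>?P\<^esub> ?U \<subseteq> semigroup_ideal d n"
    using mpol_Idl_mono[OF E'(1) U(2)] E'(2) by simp
  ultimately have "Idl\<^bsub>?P\<^esub> ?U = semigroup_ideal d n" by (rule subset_antisym[rotated])
  then have "\<not> ?U \<subset> E" using E unfolding good_generators_def minimal_generating_set_def by metis
  then have "?U = E" using U(2) by blast
  then show ?thesis using U(1) by simp
qed

section \<open>The ideal generated by the initial forms of the generators\<close>

context
  fixes E :: "('k::field) mpol set" and J :: "'k mpol set"
  assumes E: "good_generators E" and J_def: "J = Idl\<^bsub>mpol_ring d\<^esub> (initial_form d ` E)"
begin

lemma initial_forms_carrier: "initial_form d ` E \<subseteq> carrier (mpol_ring d)"
proof (rule image_subsetI)
  fix f assume "f \<in> E"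
  then have "Poly_Mapping.keys f \<subseteq> exps d" using good_generators_subset(1)[OF E] by auto
  then show "initial_form d f \<in> carrier (mpol_ring d)" using keys_initial_form_subset[of d f] by simp
qed

lemma J_ideal: "ideal J (mpol_ring d)"
  unfolding J_def by (rule mpol_Idl_ideal[OF initial_forms_carrier])

lemma initial_form_in_J: "f \<in> E \<Longrightarrow> initial_form d f \<in> J"
  unfolding J_def by (intro mpol_Idl_self[OF initial_forms_carrier] imageI)

lemma homogeneous_move_in_J:
  assumes "move d E p q" "total_deg d p = total_deg d q"
  shows "xpow p - xpow q \<in> J"
  using assms(1)
proof (rule moveE)
  fix m u v
  assume uv: "m \<in> exps d" "u \<in> exps d" "v \<in> exps d"
    "xpow u - xpow v \<in> E \<or> xpow v - xpow u \<in> E" "p = m + u" "q = m + v"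
  have len: "total_deg d u = total_deg d v" using assms(2) uv by simp
  from uv(4) have "xpow u - xpow v \<in> J"
  proof
    assume "xpow u - xpow v \<in> E"
    then show ?thesis using initial_form_in_J initial_form_homogeneous_binomial[OF len, where 'k='k] by metis
  next
    assume "xpow v - xpow u \<in> E"
    then have "xpow v - xpow u \<in> J"
      using initial_form_in_J initial_form_homogeneous_binomial[OF len[symmetric], where 'k='k] by metis
    then show ?thesis using mpol_ideal_uminus[OF J_ideal, of "xpow v - xpow u"] by simp
  qed
  then show ?thesis unfolding uv(5,6) xpow_shift_binomial by (rule mpol_ideal_single[OF J_ideal _ uv(1)])
qed

text \<open>The initial form of a non-homogeneous binomial is, up to sign, its shorter term.\<close>

lemma increasing_move_in_J:
  assumes "move d E p q" "total_deg d p < total_deg d q"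
  shows "xpow p \<in> J"
  using assms(1)
proof (rule moveE)
  fix m u v
  assume uv: "m \<in> exps d" "u \<in> exps d" "v \<in> exps d"
    "xpow u - xpow v \<in> E \<or> xpow v - xpow u \<in> E" "p = m + u" "q = m + v"
  have len: "total_deg d u < total_deg d v" using assms(2) uv by simp
  obtain f where f: "f \<in> E" "f = xpow v - xpow u \<or> f = xpow u - xpow v" using uv(4) by blast
  obtain c where "xpow u = Poly_Mapping.single 0 c * initial_form d f"
    using initial_form_inhomogeneous_binomial[OF len f(2)] by blast
  then have "xpow u \<in> J" using mpol_ideal_scale[OF J_ideal initial_form_in_J[OF f(1)], of c] by simp
  then have "xpow (u + m) \<in> J" by (rule xpow_mult_in_ideal[OF J_ideal _ uv(1)])
  then show ?thesis by (simp add: uv(5) add.commute)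
qed

lemma homogeneous_moves_in_J:
  "(\<lambda>x y. move d E x y \<and> Q x \<and> Q y)\<^sup>*\<^sup>* a p \<Longrightarrow> (\<And>x. Q x \<Longrightarrow> total_deg d x = m) \<Longrightarrow> xpow a - xpow p \<in> J"
proof (induction rule: rtranclp_induct)
  case base
  then show ?case using mpol_ideal_zero[OF J_ideal] by simp
next
  case (step y z)
  then have "xpow y - xpow z \<in> J" by (intro homogeneous_move_in_J) auto
  then have "(xpow a - xpow y) + (xpow y - xpow z) \<in> J"
    using step.IH step.prems by (intro mpol_ideal_add[OF J_ideal]) auto
  then show ?case by simp
qed

lemma xpow_in_J_transfer: "xpow a - xpow b \<in> J \<Longrightarrow> xpow b \<in> J \<Longrightarrow> xpow a \<in> J"
  using mpol_ideal_add[OF J_ideal, of "xpow a - xpow b" "xpow b"] by simp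

lemma diff_in_J_trans: "xpow a - xpow b \<in> J \<Longrightarrow> xpow b - xpow c \<in> J \<Longrightarrow> xpow a - xpow c \<in> J"
  using mpol_ideal_add[OF J_ideal, of "xpow a - xpow b" "xpow b - xpow c"] by simp

lemma diff_in_J_sym: "xpow a - xpow b \<in> J \<Longrightarrow> xpow b - xpow a \<in> J"
  using mpol_ideal_uminus[OF J_ideal, of "xpow a - xpow b"] by simp

text \<open>Walk from \<open>b\<close> to a maximal factorization involving \<open>x\<^sub>1\<close>, and stop where the length changes
  or \<open>x\<^sub>1\<close> appears: a length change without \<open>x\<^sub>1\<close> can only be an increase.\<close>

lemma introduce_first:
  assumes b: "b \<in> exps d" "weight d n b \<notin> apery S (n 1)"
  shows "(xpow b \<in> J \<and> \<not> maxfac b) \<or>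
    (\<exists>c\<in>exps d. weight d n c = weight d n b \<and> Poly_Mapping.lookup c 1 \<noteq> 0 \<and>
       total_deg d c = total_deg d b \<and> xpow b - xpow c \<in> J)"
proof (cases "Poly_Mapping.lookup b 1 = 0")
  case False
  then show ?thesis using b mpol_ideal_zero[OF J_ideal] by (intro disjI2 bexI[of _ b]) auto
next
  case True
  define Q where "Q = (\<lambda>x. Poly_Mapping.lookup x 1 = 0 \<and> total_deg d x = total_deg d b)"
  have E_sub: "E \<subseteq> semigroup_ideal d n" by (rule good_generators_subset(3)[OF E])
  obtain c where c: "c \<in> exps d" "weight d n c = weight d n b" "Poly_Mapping.lookup c 1 \<noteq> 0"
    using b weight_in_S[OF b(1)] unfolding apery_iff by blast
  have Qbc: "Q b" "\<not> Q c" using True c(3) by (auto simp: Q_def)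
  obtain p q where pq: "(\<lambda>x y. move d E x y \<and> Q x \<and> Q y)\<^sup>*\<^sup>* b p" "Q p" "move d E p q" "\<not> Q q"
    using rtranclp_first_exit[OF good_generators_connect[OF E b(1) c(1) c(2)[symmetric]], of Q, OF Qbc]
    by (elim exE conjE)
  have bp: "xpow b - xpow p \<in> J" by (rule homogeneous_moves_in_J[OF pq(1)]) (simp add: Q_def)
  have p': "Poly_Mapping.lookup p 1 = 0" "total_deg d p = total_deg d b" using pq(2) by (simp_all add: Q_def)
  have q': "Poly_Mapping.lookup q 1 \<noteq> 0 \<or> total_deg d q \<noteq> total_deg d b" using pq(4) by (simp add: Q_def)
  have "(move d E)\<^sup>*\<^sup>* b p" by (rule restricted_moves[OF pq(1)])
  then have p: "weight d n p = weight d n b" using moves_weight[OF E_sub _ b(1), of p] by simp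
  have q: "weight d n q = weight d n b" "q \<in> exps d" using move_weight[OF E_sub pq(3)] p by simp_all
  consider "total_deg d q = total_deg d p" | "total_deg d q < total_deg d p" | "total_deg d p < total_deg d q"
    by linarith
  then show ?thesis
  proof cases
    case 1
    then have "xpow p - xpow q \<in> J" by (intro homogeneous_move_in_J[OF pq(3)]) simp
    then have "xpow b - xpow q \<in> J" by (rule diff_in_J_trans[OF bp])
    then show ?thesis using 1 q p' q' by (intro disjI2 bexI[of _ q]) auto
  next
    case 2
    then show ?thesis using good_generators_move[OF E move_sym[OF pq(3)]] p'(1) by blast
  next
    case 3
    then have "xpow b \<in> J" by (intro xpow_in_J_transfer[OF bp] increasing_move_in_J[OF pq(3)])
    moreover have "\<not> maxfac b" using 3 p'(2) q by (auto simp: maxfac_def)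
    ultimately show ?thesis by blast
  qed
qed

text \<open>These are the relations of the associated graded ring on monomials. Over an Apery
  element all lengths agree, so all moves are homogeneous. Over other elements
  \<open>introduce_first\<close> passes, modulo \<open>J\<close> and without changing the length, to
  a factorization involving \<open>x_1\<close>; cancelling \<open>x_1\<close> lowers the weight,
  with maximality inherited by \<open>maxfac_remove\<close> and its failure by regularity.\<close>

lemma fibre_in_J:
  assumes "a \<in> exps d" "b \<in> exps d" "weight d n a = s" "weight d n b = s"
  shows "(\<not> maxfac a \<longrightarrow> xpow a \<in> J) \<and> (maxfac a \<longrightarrow> maxfac b \<longrightarrow> xpow a - xpow b \<in> J)"
  using assms
proof (induction s arbitrary: a b rule: less_induct)
  case (less s)
  have hom: apery_homogeneous and reg: ord_regular
    by (rule good_generators_imp_apery_homogeneous[OF E], rule good_generators_imp_ord_regular[OF E])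
  have E_sub: "E \<subseteq> semigroup_ideal d n" by (rule good_generators_subset(3)[OF E])
  show ?case
  proof (cases "s \<in> apery S (n 1)")
    case True
    then have len: "total_deg d c = ord s" if "c \<in> exps d" "weight d n c = s" for c
      using hom that maxfac_iff_ord unfolding apery_homogeneous_def by blast
    have "maxfac a" using hom less.prems(1,3) True unfolding apery_homogeneous_def by simp
    moreover have "xpow a - xpow b \<in> J"
    proof -
      have "(move d E)\<^sup>*\<^sup>* a b" using less.prems by (intro good_generators_connect[OF E]) auto
      then have "xpow a - xpow b \<in> J \<and> weight d n b = s \<and> b \<in> exps d"
      proof (induction rule: rtranclp_induct)
        case base
        then show ?case using less.prems mpol_ideal_zero[OF J_ideal] by simp
      next
        case (step y z)
        have z: "weight d n z = s" "z \<in> exps d" using move_weight[OF E_sub step.hyps(2)] step.IH by auto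
        then have "total_deg d y = total_deg d z" using len[of y] len[of z] step.IH by simp
        then have "xpow y - xpow z \<in> J" by (rule homogeneous_move_in_J[OF step.hyps(2)])
        then show ?case using diff_in_J_trans[of a y z] step.IH z by blast
      qed
      then show ?thesis ..
    qed
    ultimately show ?thesis by blast
  next
    case False
    have nonmax: "xpow c \<in> J" if c: "c \<in> exps d" "weight d n c = s" "Poly_Mapping.lookup c 1 \<noteq> 0" "\<not> maxfac c" for c
    proof -
      obtain c' where c': "c' \<in> exps d" "c = c' + e1" using remove_e1[OF c(1,3)] by auto
      have "\<not> maxfac c'" using c(4) reg c'(2) unfolding ord_regular_def by blast
      moreover have "weight d n c' < s" using c(2) c'(2) n1_pos by auto
      ultimately have "xpow c' \<in> J" using less.IH[of "weight d n c'" c' c'] c'(1) by blast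
      then show ?thesis unfolding c'(2) by (rule xpow_mult_in_ideal[OF J_ideal _ e1_exps])
    qed
    have "xpow c \<in> J" if c: "c \<in> exps d" "weight d n c = s" "\<not> maxfac c" for c
    proof -
      have "weight d n c \<notin> apery S (n 1)" using c(2) False by simp
      from introduce_first[OF c(1) this] show ?thesis
      proof (elim disjE bexE conjE)
        fix c' assume c': "c' \<in> exps d" "weight d n c' = weight d n c" "Poly_Mapping.lookup c' 1 \<noteq> 0"
          "total_deg d c' = total_deg d c" "xpow c - xpow c' \<in> J"
        then have "\<not> maxfac c'" using c by (simp add: maxfac_iff_ord)
        then have "xpow c' \<in> J" using c' c by (intro nonmax) auto
        then show ?thesis by (rule xpow_in_J_transfer[OF c'(5)])
      qed
    qed
    moreover have "xpow a - xpow b \<in> J" if "maxfac a" "maxfac b"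
    proof -
      have red: "\<exists>c'\<in>exps d. maxfac (c' + e1) \<and> weight d n (c' + e1) = s \<and> xpow c - xpow (c' + e1) \<in> J"
        if c: "maxfac c" "weight d n c = s" for c
      proof -
        have cx: "c \<in> exps d" using c by (simp add: maxfac_def)
        have "weight d n c \<notin> apery S (n 1)" using c(2) False by simp
        \<comment> \<open>Maximality of \<open>c\<close> rules out the first alternative.\<close>
        from introduce_first[OF cx this] obtain c' where c': "c' \<in> exps d" "weight d n c' = weight d n c"
          "Poly_Mapping.lookup c' 1 \<noteq> 0" "total_deg d c' = total_deg d c" "xpow c - xpow c' \<in> J"
          using c(1) by blast
        obtain e where e: "e \<in> exps d" "c' = e + e1" using remove_e1[OF c'(1,3)] by auto
        have "maxfac c'" using c c' by (simp add: maxfac_iff_ord)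
        then show ?thesis using e c' c(2) by (intro bexI[of _ e]) auto
      qed
      obtain a' where a': "a' \<in> exps d" "maxfac (a' + e1)" "weight d n (a' + e1) = s" "xpow a - xpow (a' + e1) \<in> J"
        using red[OF \<open>maxfac a\<close> less.prems(3)] by blast
      obtain b' where b': "b' \<in> exps d" "maxfac (b' + e1)" "weight d n (b' + e1) = s" "xpow b - xpow (b' + e1) \<in> J"
        using red[OF \<open>maxfac b\<close> less.prems(4)] by blast
      have w: "weight d n a' = weight d n b'" using a'(3) b'(3) by simp
      have "weight d n a' < s" using a'(3) n1_pos by auto
      then have "xpow a' - xpow b' \<in> J"
        using less.IH[OF _ a'(1) b'(1) refl w[symmetric]] maxfac_remove[OF a'(2)] maxfac_remove[OF b'(2)]
        by blast
      then have "Poly_Mapping.single e1 1 * (xpow a' - xpow b') \<in> J"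
        by (rule mpol_ideal_single[OF J_ideal _ e1_exps])
      then have "xpow (a' + e1) - xpow (b' + e1) \<in> J"
        unfolding xpow_shift_binomial[symmetric] by (simp add: add.commute)
      then have "xpow a - xpow (b' + e1) \<in> J" by (rule diff_in_J_trans[OF a'(4)])
      then show ?thesis by (rule diff_in_J_trans[OF _ diff_in_J_sym[OF b'(4)]])
    qed
    ultimately show ?thesis using less.prems by blast
  qed
qed

text \<open>Let \<open>m\<close> be the least degree in \<open>f\<close>. Modulo \<open>J\<close>
  only maximal exponents of degree \<open>m\<close> matter, and their weights have order
  \<open>m\<close>. All terms of \<open>f\<close> over such a weight have degree at least
  \<open>m\<close> and at most the order, so none is lost in the initial form, and their
  coefficients sum to zero because \<open>f\<close> is in the semigroup ideal.\<close>

lemma initial_form_ideal_subset: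
  assumes f: "f \<in> semigroup_ideal d n" "f \<noteq> 0"
  shows "initial_form d f \<in> J"
proof -
  define m where "m = Min (total_deg d ` Poly_Mapping.keys f)"
  define g where "g = initial_form d f"
  have keys_f: "Poly_Mapping.keys f \<subseteq> exps d" by (rule keys_semigroup_ideal[OF f(1)])
  have keys_g: "Poly_Mapping.keys g = {a \<in> Poly_Mapping.keys f. total_deg d a = m}"
    unfolding g_def initial_form_def m_def by (rule keys_hom_component)
  have m_le: "m \<le> total_deg d a" if "a \<in> Poly_Mapping.keys f" for a
    unfolding m_def using that by (intro Min_le) auto
  have keys_g': "Poly_Mapping.keys g \<subseteq> exps d" using keys_g keys_f by auto
  have "g \<in> J"
  proof (rule mem_ideal_by_fibres[OF J_ideal keys_g', where Q = maxfac])
    fix a assume "a \<in> Poly_Mapping.keys g"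
    then have a: "a \<in> exps d" using keys_g' by blast
    {
      assume "maxfac a"
      then show "xpow a - xpow (nf (weight d n a)) \<in> J"
        using fibre_in_J[OF a nf_weight(3)[OF a] refl nf_weight(2)[OF a]] is_nf_maxfac[OF nf_weight(1)[OF a]] by blast
    }
    assume "\<not> maxfac a"
    then show "xpow a \<in> J" using fibre_in_J[OF a a refl refl] by blast
  next
    fix h :: "nat \<Rightarrow> 'k"
    have "pm_eval (\<lambda>x. x) (\<lambda>a. if maxfac a then h (weight d n a) else 0) g =
        (\<Sum>a\<in>Poly_Mapping.keys f. Poly_Mapping.lookup g a * (if maxfac a then h (weight d n a) else 0))"
      using keys_g by (intro pm_eval_superset) auto
    \<comment> \<open>The functional on the initial form becomes a functional on \<open>f\<close>
      whose weight function is cut off to weights of order \<open>m\<close>; such functionals vanish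
      on the semigroup ideal.\<close>
    also have "\<dots> = pm_eval (\<lambda>x. x) (\<lambda>a. if ord (weight d n a) = m then h (weight d n a) else 0) f"
      unfolding pm_eval_def
    proof (intro sum.cong refl)
      fix a assume a: "a \<in> Poly_Mapping.keys f"
      then have ax: "a \<in> exps d" using keys_f by blast
      have "maxfac a \<and> total_deg d a = m \<longleftrightarrow> ord (weight d n a) = m"
        using m_le[OF a] total_deg_le_ord[OF ax] maxfac_iff_ord[of a] ax by auto
      moreover have "Poly_Mapping.lookup g a = (if total_deg d a = m then Poly_Mapping.lookup f a else 0)"
        unfolding g_def initial_form_def m_def by (rule keys_hom_component)
      ultimately show "Poly_Mapping.lookup g a * (if maxfac a then h (weight d n a) else 0) =
          Poly_Mapping.lookup f a * (if ord (weight d n a) = m then h (weight d n a) else 0)" by auto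
    qed
    also have "\<dots> = 0"
      using f(1) unfolding semigroup_ideal_iff
      by (auto dest!: spec[of _ "\<lambda>s. if ord s = m then h s else 0"])
    finally show "pm_eval (\<lambda>x. x) (\<lambda>a. if maxfac a then h (weight d n a) else 0) g = 0" .
  qed
  then show ?thesis by (simp add: g_def)
qed

end

lemma good_generators_standard_basis:
  fixes E :: "('k::field) mpol set"
  assumes E: "good_generators E"
  shows "standard_basis d (semigroup_ideal d n) E"
proof -
  let ?P = "mpol_ring d :: 'k mpol ring" and ?I = "semigroup_ideal d n :: 'k mpol set"
  \<comment> \<open>Zero counts as a binomial (take \<open>a = b\<close>) but is not allowed in a
    standard basis; minimality of \<open>E\<close> excludes it.\<close>
  have "0 \<notin> E"
  proof
    assume 0: "0 \<in> E"
    have sub: "E - {0} \<subseteq> carrier ?P" using good_generators_subset(1)[OF E] by blast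
    have J: "ideal (Idl\<^bsub>?P\<^esub> (E - {0})) ?P" by (rule mpol_Idl_ideal[OF sub])
    have "E \<subseteq> Idl\<^bsub>?P\<^esub> (E - {0})"
      using mpol_Idl_self[OF sub] mpol_ideal_zero[OF J] by blast
    then have "Idl\<^bsub>?P\<^esub> E \<subseteq> Idl\<^bsub>?P\<^esub> (E - {0})" by (rule mpol_Idl_minimal[OF J])
    moreover have "Idl\<^bsub>?P\<^esub> (E - {0}) \<subseteq> Idl\<^bsub>?P\<^esub> E"
      by (rule mpol_Idl_mono[OF good_generators_subset(1)[OF E]]) blast
    ultimately have "Idl\<^bsub>?P\<^esub> (E - {0}) = ?I" using good_generators_subset(2)[OF E] by simp
    moreover have "E - {0} \<subset> E" using 0 by blast
    ultimately show False using E unfolding good_generators_def minimal_generating_set_def by blast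
  qed
  then have E_sub: "E \<subseteq> ?I - {0}" using good_generators_subset(3)[OF E] by blast
  have carr: "initial_form d ` (?I - {0}) \<subseteq> carrier ?P"
  proof (rule image_subsetI)
    fix f assume "f \<in> ?I - {0}"
    then have "Poly_Mapping.keys f \<subseteq> exps d" using keys_semigroup_ideal[of f d n] by blast
    then show "initial_form d f \<in> carrier ?P" using keys_initial_form_subset[of d f] by simp
  qed
  have "Idl\<^bsub>?P\<^esub> (initial_form d ` E) = Idl\<^bsub>?P\<^esub> (initial_form d ` (?I - {0}))"
  proof
    show "Idl\<^bsub>?P\<^esub> (initial_form d ` E) \<subseteq> Idl\<^bsub>?P\<^esub> (initial_form d ` (?I - {0}))"
      by (rule mpol_Idl_mono[OF carr image_mono[OF E_sub]])
    show "Idl\<^bsub>?P\<^esub> (initial_form d ` (?I - {0})) \<subseteq> Idl\<^bsub>?P\<^esub> (initial_form d ` E)"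
      using initial_form_ideal_subset[OF E refl] by (intro mpol_Idl_minimal[OF J_ideal[OF E refl]]) auto
  qed
  then show ?thesis
    using good_generators_finite[OF E] E_sub by (simp add: standard_basis_def initial_ideal_def)
qed

end

subsection \<open>One-dimensional rings that are nilpotent extensions of a polynomial ring\<close>

text \<open>The remainder stays in \<open>D\<close> and has smaller degree. Closure is required only
  under subtracting multiples of \<open>g\<close>, so that \<open>D\<close> may be a prime, a sum of
  two ideals, or a set of coordinates of a submodule.\<close>

lemma poly_mod_degree_minimal:
  fixes g :: "('k::field) poly"
  assumes "g \<in> D" "g \<noteq> 0"
    and min: "\<And>x. x \<in> D \<Longrightarrow> x \<noteq> 0 \<Longrightarrow> Polynomial.degree g \<le> Polynomial.degree x"
    and closed: "\<And>x y. x \<in> D \<Longrightarrow> x - y * g \<in> D"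
    and x: "x \<in> D"
  shows "g dvd x"
proof (rule ccontr)
  assume "\<not> g dvd x"
  then have "x mod g \<noteq> 0" by (simp add: dvd_eq_mod_eq_0)
  moreover have "x mod g \<in> D" using closed[OF x, of "x div g"] by (simp add: minus_div_mult_eq_mod)
  ultimately have "Polynomial.degree g \<le> Polynomial.degree (x mod g)" by (intro min)
  then show False using degree_mod_less'[OF assms(2) \<open>x mod g \<noteq> 0\<close>] by simp
qed

lemma degree_minimal_exists:
  fixes D :: "('k::field) poly set"
  assumes "x \<in> D" "x \<noteq> 0"
  obtains g where "g \<in> D" "g \<noteq> 0" "\<And>x. x \<in> D \<Longrightarrow> x \<noteq> 0 \<Longrightarrow> Polynomial.degree g \<le> Polynomial.degree x"
  using ex_has_least_nat[of "\<lambda>x. x \<in> D \<and> x \<noteq> 0" x Polynomial.degree] assms by blast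

text \<open>Nonzero primes of \<open>k[t]\<close> are maximal. Let \<open>f\<close> have least
  degree in \<open>q\<close> and \<open>g\<close> least degree in the ideal generated by
  \<open>q\<close> and \<open>r\<close>. Then \<open>g\<close> divides \<open>r\<close> and
  \<open>f = g * h\<close>; since \<open>r\<close> is not in \<open>q\<close>, neither is
  \<open>g\<close>, so \<open>h\<close> is in \<open>q\<close>. Minimality of \<open>f\<close>
  forces \<open>g\<close> to be constant.\<close>

lemma poly_prime_ideal_maximal:
  fixes q :: "('k::field) poly set"
  assumes diff: "\<And>x y. x \<in> q \<Longrightarrow> y \<in> q \<Longrightarrow> x - y \<in> q"
    and mult: "\<And>x y. x \<in> q \<Longrightarrow> y * x \<in> q"
    and prime: "\<And>x y. x * y \<in> q \<Longrightarrow> x \<in> q \<or> y \<in> q"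
    and f0: "f0 \<in> q" "f0 \<noteq> 0" and r: "r \<notin> q"
  obtains u v where "u \<in> q" "1 = u + v * r"
proof -
  obtain f where f: "f \<in> q" "f \<noteq> 0" "\<And>x. x \<in> q \<Longrightarrow> x \<noteq> 0 \<Longrightarrow> Polynomial.degree f \<le> Polynomial.degree x"
    using degree_minimal_exists[OF f0] by blast
  define D where "D = {u + v * r |u v. u \<in> q}"
  have DI: "u + v * r \<in> D" if "u \<in> q" for u v using that unfolding D_def by blast
  have q_add: "x + y \<in> q" if "x \<in> q" "y \<in> q" for x y
    using diff[OF that(1) mult[OF that(2), of "-1"]] by simp
  have fD: "f \<in> D" using DI[OF f(1), of 0] by simp
  obtain g where g: "g \<in> D" "g \<noteq> 0" "\<And>x. x \<in> D \<Longrightarrow> x \<noteq> 0 \<Longrightarrow> Polynomial.degree g \<le> Polynomial.degree x"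
    using degree_minimal_exists[OF fD f(2)] by blast
  obtain u0 v0 where g_eq: "g = u0 + v0 * r" "u0 \<in> q" using g(1) unfolding D_def by blast
  have closed: "x - y * g \<in> D" if xD: "x \<in> D" for x y
  proof -
    obtain u v where uv: "x = u + v * r" "u \<in> q" using xD unfolding D_def by blast
    have "x - y * g = (u - y * u0) + (v - y * v0) * r" by (simp add: uv g_eq algebra_simps)
    then show ?thesis using DI[OF diff[OF uv(2) mult[OF g_eq(2), of y]]] by simp
  qed
  have rD: "r \<in> D" using DI[OF diff[OF f(1) f(1)], of 1] by simp
  have "g dvd f" "g dvd r"
    by (rule poly_mod_degree_minimal[OF g(1,2) g(3) closed fD], assumption+)
      (rule poly_mod_degree_minimal[OF g(1,2) g(3) closed rD], assumption+)
  then obtain h k where h: "f = g * h" and k: "r = g * k" by (elim dvdE)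
  have "g \<notin> q" using r mult[of g k] k by (auto simp: mult.commute)
  then have "h \<in> q" using prime[of g h] f(1) h by simp
  moreover have "h \<noteq> 0" using f(2) h by auto
  ultimately have "Polynomial.degree f \<le> Polynomial.degree h" by (rule f(3))
  then have "Polynomial.degree g = 0" using h g(2) \<open>h \<noteq> 0\<close> by (simp add: degree_mult_eq)
  then obtain c where c: "g = [:c:]" by (rule degree_eq_zeroE)
  then have "c \<noteq> 0" using g(2) by auto
  then have "1 = [:inverse c:] * g" using c by (simp add: one_pCons)
  also have "\<dots> = [:inverse c:] * u0 + ([:inverse c:] * v0) * r" by (simp only: g_eq distrib_left mult.assoc)
  finally show ?thesis using mult[OF g_eq(2)] by (intro that)
qed

lemma poly_power_decomposition:
  fixes f p :: "('k::field) poly"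
  assumes "Polynomial.degree f > 0" "p \<noteq> 0"
  shows "\<exists>j g. p = f ^ j * g \<and> \<not> f dvd g"
  using assms(2)
proof (induction "Polynomial.degree p" arbitrary: p rule: less_induct)
  case less
  show ?case
  proof (cases "f dvd p")
    case False
    then show ?thesis by (intro exI[of _ 0] exI[of _ p]) simp
  next
    case True
    then obtain h where h: "p = f * h" ..
    then have "f \<noteq> 0" "h \<noteq> 0" using less.prems by auto
    then have "Polynomial.degree h < Polynomial.degree p" using h assms(1) by (simp add: degree_mult_eq)
    then obtain j g where "h = f ^ j * g" "\<not> f dvd g" using less.hyps \<open>h \<noteq> 0\<close> by blast
    then show ?thesis using h by (intro exI[of _ "Suc j"] exI[of _ g]) (simp add: mult.assoc)
  qed
qed

lemma (in monoid) pow_Suc_mult: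
  "x \<in> carrier G \<Longrightarrow> u \<in> carrier G \<Longrightarrow> x [^] Suc k \<otimes> u = x \<otimes> (x [^] k \<otimes> u)"
  by (metis m_assoc nat_pow_Suc2 nat_pow_closed)

lemma (in ring) regular_pow:
  assumes reg: "\<And>y. y \<in> carrier R \<Longrightarrow> x \<otimes> y \<in> A \<Longrightarrow> y \<in> A"
    and "x \<in> carrier R" "u \<in> carrier R" "x [^] (k::nat) \<otimes> u \<in> A"
  shows "u \<in> A"
  using assms(4)
proof (induction k)
  case 0
  then show ?case using assms(3) by simp
next
  case (Suc k)
  moreover have "x [^] Suc k \<otimes> u = x \<otimes> (x [^] k \<otimes> u)"
    by (rule pow_Suc_mult[OF assms(2,3)])
  ultimately have *: "x \<otimes> (x [^] k \<otimes> u) \<in> A" by simp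
  have "x [^] k \<otimes> u \<in> carrier R" using assms(2,3) by simp
  then have "x [^] k \<otimes> u \<in> A" using * by (rule reg)
  then show ?case by (rule Suc.IH)
qed

lemma (in cring) pow_add_ideal:
  assumes A: "ideal A R" and v: "v \<in> carrier R" and a: "a \<in> A"
  shows "\<exists>b\<in>A. (v \<oplus> a) [^] (k::nat) = v [^] k \<oplus> b"
proof (induction k)
  case 0
  show ?case using additive_subgroup.zero_closed[OF ideal.axioms(1)[OF A]] by (intro bexI[of _ \<zero>]) auto
next
  case (Suc k)
  then obtain b where b: "b \<in> A" "(v \<oplus> a) [^] k = v [^] k \<oplus> b" by blast
  have car: "a \<in> carrier R" "b \<in> carrier R" using a b ideal.Icarr[OF A] by auto
  have "(v \<oplus> a) [^] Suc k = (v [^] k \<oplus> b) \<otimes> (v \<oplus> a)" by (simp add: b(2))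
  also have "\<dots> = v [^] Suc k \<oplus> (v [^] k \<otimes> a \<oplus> (v \<oplus> a) \<otimes> b)"
    using car v nat_pow_closed[OF v, of k] by (simp, algebra)
  finally show ?case using a b v car
    by (intro bexI[of _ "v [^] k \<otimes> a \<oplus> (v \<oplus> a) \<otimes> b"]) (auto intro!: additive_subgroup.a_closed[OF ideal.axioms(1)[OF A]] ideal.I_l_closed[OF A])
qed

lemma (in primeideal) pow_in_prime:
  assumes "x \<in> carrier R" "x [^] (k::nat) \<in> I"
  shows "x \<in> I"
  using assms(2)
proof (induction k)
  case 0
  then show ?case using one_imp_carrier I_notcarr by auto
next
  case (Suc k)
  then show ?case using assms(1) I_prime[of "x [^] k" x] by auto
qed

lemma (in ring) genideal_empty: "Idl {} = {\<zero>}"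
proof
  show "Idl {} \<subseteq> {\<zero>}" by (rule genideal_minimal[OF zeroideal]) simp
  show "{\<zero>} \<subseteq> Idl {}"
    using additive_subgroup.zero_closed[OF ideal.axioms(1)[OF genideal_ideal[of "{}"]]] by simp
qed

text \<open>A copy of \<open>k[t]\<close> that is a retract of \<open>R\<close> with nil kernel. In
  the application \<open>\<iota> [:0, 1:]\<close> is the class of \<open>t^(n 1)\<close> in the
  associated graded ring.\<close>

locale nil_extension = cring R for R (structure) +
  fixes \<iota> :: "('k::field) poly \<Rightarrow> 'a" and \<pi> :: "'a \<Rightarrow> 'k poly"
  assumes \<iota>_hom: "\<iota> \<in> ring_hom (ring_of_type_algebra :: 'k poly ring) R"
    and \<pi>_hom: "\<pi> \<in> ring_hom R (ring_of_type_algebra :: 'k poly ring)"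
    and \<pi>_\<iota> [simp]: "\<pi> (\<iota> p) = p"
    and nil: "u \<in> carrier R \<Longrightarrow> \<pi> u = 0 \<Longrightarrow> \<exists>k::nat. u [^] k = \<zero>"
begin

lemma \<iota>_closed [simp, intro]: "\<iota> p \<in> carrier R"
  using ring_hom_closed[OF \<iota>_hom] by simp

lemma \<iota>_mult: "\<iota> (p * q) = \<iota> p \<otimes> \<iota> q"
  using ring_hom_mult[OF \<iota>_hom] by simp

lemma \<iota>_add: "\<iota> (p + q) = \<iota> p \<oplus> \<iota> q"
  using ring_hom_add[OF \<iota>_hom] by simp

lemma \<iota>_one [simp]: "\<iota> 1 = \<one>"
  using ring_hom_one[OF \<iota>_hom] by simp

lemma \<iota>_zero [simp]: "\<iota> 0 = \<zero>"
  using ring_hom_zero[OF \<iota>_hom ring_from_type_algebra ring_axioms] by simp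

lemma \<iota>_minus: "\<iota> (p - q) = \<iota> p \<ominus> \<iota> q"
proof -
  have "\<iota> (p - q) \<oplus> \<iota> q = \<iota> p" by (simp flip: \<iota>_add)
  then have "\<iota> p \<ominus> \<iota> q = (\<iota> (p - q) \<oplus> \<iota> q) \<ominus> \<iota> q" by simp
  also have "\<dots> = \<iota> (p - q)" using \<iota>_closed[of "p - q"] \<iota>_closed[of q] by algebra
  finally show ?thesis ..
qed

lemma \<pi>_mult [simp]: "u \<in> carrier R \<Longrightarrow> v \<in> carrier R \<Longrightarrow> \<pi> (u \<otimes> v) = \<pi> u * \<pi> v"
  using ring_hom_mult[OF \<pi>_hom] by simp

lemma \<pi>_add [simp]: "u \<in> carrier R \<Longrightarrow> v \<in> carrier R \<Longrightarrow> \<pi> (u \<oplus> v) = \<pi> u + \<pi> v"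
  using ring_hom_add[OF \<pi>_hom] by simp

lemma \<pi>_one [simp]: "\<pi> \<one> = 1"
  using ring_hom_one[OF \<pi>_hom] by simp

lemma \<pi>_zero [simp]: "\<pi> \<zero> = 0"
  using ring_hom_zero[OF \<pi>_hom ring_axioms ring_from_type_algebra] by simp

lemma \<pi>_minus [simp]:
  assumes "u \<in> carrier R" "v \<in> carrier R"
  shows "\<pi> (u \<ominus> v) = \<pi> u - \<pi> v"
proof -
  have "(u \<ominus> v) \<oplus> v = u" using assms by algebra
  then have "\<pi> (u \<ominus> v) + \<pi> v = \<pi> u" using assms by (metis \<pi>_add minus_closed)
  then show ?thesis by (simp add: eq_diff_eq)
qed

lemma \<pi>_pow [simp]: "u \<in> carrier R \<Longrightarrow> \<pi> (u [^] (k::nat)) = \<pi> u ^ k"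
  by (induction k) (simp_all add: mult.commute)

lemma one_not_zero: "\<one> \<noteq> \<zero>"
  using \<pi>_one \<pi>_zero zero_neq_one by metis

text \<open>The difference of \<open>u\<close> and \<open>\<iota> (\<pi> u)\<close> is nilpotent,
  hence in every prime. So primes are determined by their contraction to
  \<open>k[t]\<close>.\<close>

lemma prime_mem_iff:
  assumes Q: "primeideal Q R" and u: "u \<in> carrier R"
  shows "u \<in> Q \<longleftrightarrow> \<iota> (\<pi> u) \<in> Q"
proof -
  interpret Q: primeideal Q R by (rule Q)
  let ?v = "u \<ominus> \<iota> (\<pi> u)"
  have v: "?v \<in> carrier R" "\<pi> ?v = 0" using u by simp_all
  then obtain k :: nat where "?v [^] k = \<zero>" using nil by blast
  then have vQ: "?v \<in> Q" using Q.pow_in_prime[OF v(1)] Q.zero_closed by metis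
  have eq: "u = ?v \<oplus> \<iota> (\<pi> u)" "\<iota> (\<pi> u) = u \<ominus> ?v"
    using u \<iota>_closed[of "\<pi> u"] by algebra+
  show ?thesis
  proof
    assume "u \<in> Q"
    then have "u \<ominus> ?v \<in> Q" using vQ by (simp add: a_minus_def Q.a_inv_closed)
    then show "\<iota> (\<pi> u) \<in> Q" using eq(2) by simp
  next
    assume "\<iota> (\<pi> u) \<in> Q"
    then have "?v \<oplus> \<iota> (\<pi> u) \<in> Q" using vQ by simp
    then show "u \<in> Q" using eq(1) by simp
  qed
qed

lemma contraction:
  assumes Q: "primeideal Q R"
  defines "q \<equiv> {p. \<iota> p \<in> Q}"
  shows "\<And>x y. x \<in> q \<Longrightarrow> y \<in> q \<Longrightarrow> x - y \<in> q" "\<And>x y. x \<in> q \<Longrightarrow> y * x \<in> q"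
    "\<And>x y. x * y \<in> q \<Longrightarrow> x \<in> q \<or> y \<in> q" "1 \<notin> q" "0 \<in> q"
proof -
  interpret Q: primeideal Q R by (rule Q)
  show "x - y \<in> q" if "x \<in> q" "y \<in> q" for x y
    using that by (simp add: q_def \<iota>_minus a_minus_def Q.a_inv_closed)
  show "y * x \<in> q" if "x \<in> q" for x y
    using that by (simp add: q_def \<iota>_mult Q.I_l_closed)
  show "x \<in> q \<or> y \<in> q" if "x * y \<in> q" for x y
    using that Q.I_prime by (simp add: q_def \<iota>_mult)
  show "1 \<notin> q" using Q.I_notcarr Q.one_imp_carrier by (auto simp: q_def)
  show "0 \<in> q" using Q.zero_closed by (simp add: q_def)
qed

text \<open>Strict inclusions stay strict after contraction. The middle prime then contracts to a
  nonzero, hence maximal, prime of \<open>k[t]\<close>, and a strictly larger one would contain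
  1.\<close>

lemma no_prime_chain:
  assumes Q: "primeideal Q0 R" "primeideal Q1 R" "primeideal Q2 R" and sub: "Q0 \<subset> Q1" "Q1 \<subset> Q2"
  shows False
proof -
  obtain u where u: "u \<in> Q1" "u \<notin> Q0" using sub(1) by blast
  obtain v where v: "v \<in> Q2" "v \<notin> Q1" using sub(2) by blast
  interpret Q2: primeideal Q2 R by (rule Q(3))
  have car: "u \<in> carrier R" "v \<in> carrier R" using u(1) v(1) sub(2) Q2.Icarr by auto
  have u': "\<iota> (\<pi> u) \<in> Q1" "\<iota> (\<pi> u) \<notin> Q0" and v': "\<iota> (\<pi> v) \<in> Q2" "\<iota> (\<pi> v) \<notin> Q1"
    using prime_mem_iff[OF Q(1) car(1)] prime_mem_iff[OF Q(2) car(1)]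
      prime_mem_iff[OF Q(2) car(2)] prime_mem_iff[OF Q(3) car(2)] u v by simp_all
  have "\<pi> u \<noteq> 0" using u'(2) contraction(5)[OF Q(1)] by auto
  then obtain a b where ab: "\<iota> a \<in> Q1" "1 = a + b * \<pi> v"
    using poly_prime_ideal_maximal[OF contraction(1,2,3)[OF Q(2)], of "\<pi> u" "\<pi> v"] u'(1) v'(2) by auto
  have "\<iota> (a + b * \<pi> v) \<in> Q2"
    using ab(1) sub(2) v'(1) by (auto simp: \<iota>_add \<iota>_mult Q2.I_l_closed)
  then show False using ab(2) contraction(4)[OF Q(3)] by simp
qed

abbreviation (input) nil_ideal :: "'a set" where
  "nil_ideal \<equiv> {u \<in> carrier R. \<pi> u = 0}"

abbreviation (input) origin_ideal :: "'a set" where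
  "origin_ideal \<equiv> {u \<in> carrier R. poly (\<pi> u) 0 = 0}"

lemma ideal_preimage:
  assumes "\<And>p q. P p \<Longrightarrow> P q \<Longrightarrow> P (p + q)" "\<And>p q. P p \<Longrightarrow> P (p * q)" "P 0"
  shows "ideal {u \<in> carrier R. P (\<pi> u)} R"
proof (rule idealI[OF ring_axioms])
  have "P (- p)" if "P p" for p using assms(2)[OF that, of "-1"] by simp
  moreover have "\<pi> (\<ominus> u) = - \<pi> u" if "u \<in> carrier R" for u
    using \<pi>_minus[OF zero_closed that] that by (simp add: a_minus_def)
  moreover have "inv\<^bsub>add_monoid R\<^esub> u = \<ominus> u" for u by (simp add: a_inv_def)
  ultimately show "subgroup {u \<in> carrier R. P (\<pi> u)} (add_monoid R)"
    using assms by (intro subgroup.intro) auto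
next
  fix u v assume "u \<in> {u \<in> carrier R. P (\<pi> u)}" "v \<in> carrier R"
  then show "v \<otimes> u \<in> {u \<in> carrier R. P (\<pi> u)}" "u \<otimes> v \<in> {u \<in> carrier R. P (\<pi> u)}"
    using assms(2)[of "\<pi> u" "\<pi> v"] by (auto simp: mult.commute)
qed

lemma prime_nil_ideal: "primeideal nil_ideal R"
proof (rule primeidealI)
  show "ideal nil_ideal R" by (rule ideal_preimage) auto
  show "carrier R \<noteq> nil_ideal" using one_closed \<pi>_one by force
qed (auto intro: is_cring)

lemma maximal_origin_ideal: "maximalideal origin_ideal R"
proof (rule maximalidealI)
  show "ideal origin_ideal R" by (rule ideal_preimage) auto
  show "carrier R \<noteq> origin_ideal" using one_closed \<pi>_one by force
  fix J assume J: "ideal J R" "origin_ideal \<subseteq> J" "J \<subseteq> carrier R"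
  interpret J: ideal J R by (rule J(1))
  show "J = origin_ideal \<or> J = carrier R"
  proof (rule disjCI)
    assume "J \<noteq> carrier R"
    show "J = origin_ideal"
    proof (rule ccontr)
      assume "J \<noteq> origin_ideal"
      then obtain u where u: "u \<in> J" "poly (\<pi> u) 0 \<noteq> 0" "u \<in> carrier R" using J(2,3) by blast
      \<comment> \<open>Scaled so that \<open>\<pi> ?w\<close> takes the value 1 at 0, which puts
        \<open>\<one> \<ominus> ?w\<close> into \<open>origin_ideal\<close>.\<close>
      let ?w = "\<iota> [:inverse (poly (\<pi> u) 0):] \<otimes> u"
      have w: "?w \<in> J" using u by (simp add: J.I_l_closed)
      have "\<one> \<ominus> ?w \<in> origin_ideal" using u by simp
      then have "\<one> \<ominus> ?w \<in> J" using J(2) by blast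
      then have "(\<one> \<ominus> ?w) \<oplus> ?w \<in> J" using w by simp
      moreover have "(\<one> \<ominus> ?w) \<oplus> ?w = \<one>" using u(3) \<iota>_closed[of "[:inverse (poly (\<pi> u) 0):]"] by algebra
      ultimately show False using J.one_imp_carrier \<open>J \<noteq> carrier R\<close> by simp
    qed
  qed
qed

lemma nil_subset_prime:
  assumes "primeideal Q R"
  shows "nil_ideal \<subseteq> Q"
proof
  interpret Q: primeideal Q R by (rule assms)
  fix u assume "u \<in> nil_ideal"
  then show "u \<in> Q" using prime_mem_iff[OF assms, of u] Q.zero_closed by simp
qed

text \<open>The kernel is not maximal itself: \<open>origin_ideal\<close> is a proper ideal
  containing it and also \<open>\<iota> [:0, 1:]\<close>.\<close>

lemma maximal_neq_nil:
  assumes "maximalideal M R"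
  shows "nil_ideal \<subset> M"
proof
  interpret M: maximalideal M R by (rule assms)
  show "nil_ideal \<subseteq> M" by (rule nil_subset_prime[OF maximalideal_prime[OF assms]])
  show "nil_ideal \<noteq> M"
  proof
    assume eq: "nil_ideal = M"
    have O: "ideal origin_ideal R" "carrier R \<noteq> origin_ideal"
      using maximal_origin_ideal by (rule maximalideal.axioms, rule maximalideal.I_notcarr)
    have "M \<subseteq> origin_ideal" unfolding eq[symmetric] by (intro Collect_mono) simp
    then have "origin_ideal = M"
      using M.I_maximal[OF O(1)] O(2) by blast
    moreover have "\<iota> [:0, 1:] \<in> origin_ideal" by simp
    ultimately have "\<iota> [:0, 1:] \<in> M" by (simp only:)
    then show False unfolding eq[symmetric] by simp
  qed
qed

lemma prime_height_maximal:
  assumes M: "maximalideal M R"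
  shows "prime_height R M = 1"
  unfolding prime_height_def
proof (rule antisym)
  let ?P = "\<lambda>l Q. (\<forall>i\<le>l. primeideal (Q i) R) \<and> (\<forall>i<l. Q i \<subset> Q (Suc i)) \<and> Q l = M"
  show "Sup {enat l |l. \<exists>Q :: nat \<Rightarrow> 'a set. ?P l Q} \<le> 1"
  proof (rule Sup_least)
    fix e assume "e \<in> {enat l |l. \<exists>Q :: nat \<Rightarrow> 'a set. ?P l Q}"
    then obtain l and Q :: "nat \<Rightarrow> 'a set" where e: "e = enat l"
      and Q: "\<forall>i\<le>l. primeideal (Q i) R" "\<forall>i<l. Q i \<subset> Q (Suc i)"
      by (elim CollectE exE conjE)
    have "l \<le> 1"
    proof (rule ccontr)
      assume "\<not> l \<le> 1"
      then have l: "0 \<le> l" "1 \<le> l" "2 \<le> l" "0 < l" "1 < l" by simp_all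
      have "Q 0 \<subset> Q 1" "Q 1 \<subset> Q 2"
        using Q(2)[rule_format, OF l(4)] Q(2)[rule_format, OF l(5)] by (simp_all only: One_nat_def numeral_2_eq_2)
      with Q(1)[rule_format, OF l(1)] Q(1)[rule_format, OF l(2)] Q(1)[rule_format, OF l(3)]
      show False by (rule no_prime_chain)
    qed
    then show "e \<le> 1" by (simp add: e one_enat_def)
  qed
  let ?Q = "\<lambda>i::nat. if i = 0 then nil_ideal else M"
  have "?P 1 ?Q"
    using prime_nil_ideal maximalideal_prime[OF M] maximal_neq_nil[OF M] by simp
  then have "\<exists>Q :: nat \<Rightarrow> 'a set. ?P 1 Q" by (rule exI[of _ ?Q])
  then have "enat 1 \<in> {enat l |l. \<exists>Q :: nat \<Rightarrow> 'a set. ?P l Q}"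
    by (rule_tac CollectI, rule_tac x = 1 in exI, rule_tac conjI[OF refl])
  then show "1 \<le> Sup {enat l |l. \<exists>Q :: nat \<Rightarrow> 'a set. ?P l Q}"
    unfolding one_enat_def by (rule Sup_upper)
qed

lemma regular_sequenceD:
  assumes "regular_sequence R xs" "i < length xs" "y \<in> carrier R" "xs ! i \<otimes> y \<in> Idl (set (take i xs))"
  shows "y \<in> Idl (set (take i xs))"
  using assms unfolding regular_sequence_def by blast

lemma regular_first:
  assumes "regular_sequence R xs" "xs \<noteq> []"
  shows "xs ! 0 \<in> carrier R" "\<And>y. y \<in> carrier R \<Longrightarrow> xs ! 0 \<otimes> y \<in> {\<zero>} \<Longrightarrow> y \<in> {\<zero>}"
proof -
  have len: "0 < length xs" using assms(2) by simp
  have R: "set xs \<subseteq> carrier R" using assms(1) by (simp add: regular_sequence_def)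
  show "xs ! 0 \<in> carrier R" using nth_mem[OF len] R by blast
  show "y \<in> {\<zero>}" if "y \<in> carrier R" "xs ! 0 \<otimes> y \<in> {\<zero>}" for y
    using regular_sequenceD[OF assms(1) len that(1)] that(2) by (simp only: take_0 list.set genideal_empty)
qed

text \<open>Modulo a nonzerodivisor \<open>x \<in> M\<close> every element of \<open>M\<close> is a zero divisor: write
  \<open>\<pi> x = f\<^sup>j g\<close> for a generator \<open>f\<close> of the contraction of \<open>M\<close>.\<close>

lemma regular_sequence_length_le_1:
  assumes xs: "regular_sequence R xs" and M: "maximalideal M R" and sub: "set xs \<subseteq> M"
  shows "length xs \<le> 1"
proof (rule ccontr)
  assume "\<not> length xs \<le> 1"
  then have len: "1 < length xs" by simp
  define x z where "x = xs ! 0" and "z = xs ! 1"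
  have prime: "primeideal M R" by (rule maximalideal_prime[OF M])
  interpret M: primeideal M R by (rule prime)
  have xz_set: "x \<in> set xs" "z \<in> set xs" unfolding x_def z_def using len by (auto intro: nth_mem)
  then have xzM: "x \<in> M" "z \<in> M" using sub by auto
  then have xz: "x \<in> carrier R" "z \<in> carrier R" using M.Icarr by auto
  have "xs \<noteq> []" using len by auto
  note regx = regular_first(2)[OF xs this, folded x_def]
  define A where "A = Idl {x}"
  have A: "ideal A R" unfolding A_def using xz by (intro genideal_ideal) auto
  interpret A: ideal A R by (rule A)
  have xA: "x \<in> A" unfolding A_def using xz by (intro genideal_self') auto
  have AM: "A \<subseteq> M" unfolding A_def using xzM by (intro genideal_minimal[OF M.is_ideal]) auto
  have "take 1 xs = [x]" using len by (cases xs) (auto simp: x_def)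
  then have "set (take 1 xs) = {x}" by simp
  then have regz: "y \<in> A" if "y \<in> carrier R" "z \<otimes> y \<in> A" for y
    using regular_sequenceD[OF xs len that(1)] that(2) by (simp only: A_def z_def)
  define q where "q = {p. \<iota> p \<in> M}"
  have q: "\<pi> x \<in> q" "\<pi> z \<in> q"
    unfolding q_def mem_Collect_eq
    using prime_mem_iff[OF prime xz(1)] prime_mem_iff[OF prime xz(2)] xzM by blast+
  \<comment> \<open>Otherwise \<open>x\<close> is nilpotent, which a nonzerodivisor of a nonzero
    ring cannot be.\<close>
  have "\<pi> x \<noteq> 0"
  proof
    assume "\<pi> x = 0"
    then obtain k :: nat where "x [^] k = \<zero>" using nil xz(1) by blast
    then have "x [^] k \<otimes> \<one> \<in> {\<zero>}" by simp
    then have "\<one> \<in> {\<zero>}" by (rule regular_pow[of x "{\<zero>}" \<one> k, OF _ xz(1) one_closed, rotated]) (rule regx)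
    then show False using one_not_zero by simp
  qed
  then obtain f where f: "f \<in> q" "f \<noteq> 0" "\<And>x. x \<in> q \<Longrightarrow> x \<noteq> 0 \<Longrightarrow> Polynomial.degree f \<le> Polynomial.degree x"
    using degree_minimal_exists[OF q(1)] by blast
  note c = contraction[OF prime, folded q_def]
  have f_dvd: "f dvd p" if "p \<in> q" for p
    by (rule poly_mod_degree_minimal[OF f _ that]) (use c(1) c(2)[OF f(1)] in auto)
  have "Polynomial.degree f > 0"
  proof (rule ccontr)
    assume "\<not> Polynomial.degree f > 0"
    then have "f dvd 1" using f(2) by (simp add: is_unit_iff_degree)
    then obtain h where "1 = f * h" by (rule dvdE)
    then show False using c(2)[OF f(1), of h] c(4) by (simp add: mult.commute)
  qed
  then obtain j g where jg: "\<pi> x = f ^ j * g" "\<not> f dvd g"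
    using poly_power_decomposition \<open>\<pi> x \<noteq> 0\<close> by blast
  obtain w where w: "\<pi> z = f * w" using f_dvd[OF q(2)] by (rule dvdE)
  \<comment> \<open>With \<open>\<pi> z = f * w\<close> the images of \<open>t\<close> and
    \<open>a\<close> agree: both equal \<open>w^j * f^j * g\<close>. So \<open>t\<close> is a
    multiple of \<open>x\<close> up to a nilpotent, and a power of \<open>t\<close> lies in
    \<open>A\<close>. Cancelling \<open>z\<close> modulo \<open>A\<close> leaves a power of
    \<open>\<iota> g\<close> in \<open>A\<close>, hence \<open>\<iota> g\<close> in
    \<open>M\<close>, although \<open>f\<close> does not divide \<open>g\<close>.\<close>
  define t where "t = z [^] j \<otimes> \<iota> g"
  define a where "a = \<iota> (w ^ j) \<otimes> x"
  have t: "t \<in> carrier R" and aA: "a \<in> A" unfolding t_def a_def using xz xA by (auto intro: A.I_l_closed)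
  have a: "a \<in> carrier R" using aA A.Icarr by simp
  have "\<pi> (t \<ominus> a) = 0"
    using t a xz by (simp add: t_def a_def jg w power_mult_distrib algebra_simps)
  then obtain L :: nat where L: "(t \<ominus> a) [^] L = \<zero>" using nil[of "t \<ominus> a"] t a by auto
  have "t = (t \<ominus> a) \<oplus> a" using t a by algebra
  moreover obtain b where "b \<in> A" "((t \<ominus> a) \<oplus> a) [^] L = (t \<ominus> a) [^] L \<oplus> b"
    using pow_add_ideal[OF A _ aA, of "t \<ominus> a" L] t a by auto
  ultimately have "t [^] L \<in> A" using L A.Icarr by simp
  then have "z [^] (j * L) \<otimes> \<iota> g [^] L \<in> A"
    using xz by (simp add: t_def nat_pow_distrib nat_pow_pow)
  then have "\<iota> g [^] L \<in> A" by (rule regular_pow[of z A "\<iota> g [^] L" "j * L", OF _ xz(2) nat_pow_closed[OF \<iota>_closed], rotated]) (rule regz)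
  then have "\<iota> g [^] L \<in> M" using AM by blast
  then have "\<iota> g \<in> M" by (rule M.pow_in_prime[OF \<iota>_closed])
  then have "g \<in> q" by (simp add: q_def)
  then show False using f_dvd jg(2) by blast
qed

lemma ideal_depth_le_1:
  assumes "maximalideal M R"
  shows "ideal_depth R M \<le> 1"
  unfolding ideal_depth_def
proof (rule Sup_least)
  fix e assume "e \<in> {enat (length xs) |xs. regular_sequence R xs \<and> set xs \<subseteq> M}"
  then obtain xs where "e = enat (length xs)" "regular_sequence R xs" "set xs \<subseteq> M"
    by (elim CollectE exE conjE)
  then show "e \<le> 1" using regular_sequence_length_le_1[OF _ assms] by (simp add: one_enat_def)
qed

text \<open>Depth 1 at \<open>origin_ideal\<close> provides a nonzerodivisor \<open>x\<close> there,
  and \<open>\<pi> x\<close> is divisible by \<open>[:0, 1:]\<close>. If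
  \<open>\<iota> [:0, 1:]\<close> kills \<open>u\<close>, then so does
  \<open>\<iota> (\<pi> x)\<close>, and \<open>x\<close> acts on \<open>u\<close> like the nilpotent
  \<open>x \<ominus> \<iota> (\<pi> x)\<close>. So a power of \<open>x\<close> kills
  \<open>u\<close>.\<close>

lemma cohen_macaulay_imp_regular:
  assumes cm: "cohen_macaulay R" and u: "u \<in> carrier R" "\<iota> [:0, 1:] \<otimes> u = \<zero>"
  shows "u = \<zero>"
proof -
  have "ideal_depth R origin_ideal = 1"
    using cm maximal_origin_ideal prime_height_maximal[OF maximal_origin_ideal]
    by (simp add: cohen_macaulay_def)
  have "\<exists>xs. regular_sequence R xs \<and> set xs \<subseteq> origin_ideal \<and> xs \<noteq> []"
  proof (rule ccontr)
    assume nex: "\<not> ?thesis"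
    have none: "xs = []" if "regular_sequence R xs" "set xs \<subseteq> origin_ideal" for xs
      using nex that by blast
      have "ideal_depth R origin_ideal \<le> 0"
        unfolding ideal_depth_def
      proof (rule Sup_least)
        fix e assume "e \<in> {enat (length xs) |xs. regular_sequence R xs \<and> set xs \<subseteq> origin_ideal}"
        then obtain xs where "e = enat (length xs)" "regular_sequence R xs" "set xs \<subseteq> origin_ideal"
          by (elim CollectE exE conjE)
        then show "e \<le> 0" using none[of xs] by (simp add: zero_enat_def)
      qed
      then show False using \<open>ideal_depth R origin_ideal = 1\<close> by simp
  qed
  then obtain xs where xs: "regular_sequence R xs" "set xs \<subseteq> origin_ideal" "xs \<noteq> []" by blast
  define x where "x = xs ! 0"
  have "x \<in> set xs" using xs(3) by (simp add: x_def)
  then have x: "x \<in> carrier R" "poly (\<pi> x) 0 = 0" using xs(2) by auto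
  have reg: "y \<in> {\<zero>}" if "y \<in> carrier R" "x \<otimes> y \<in> {\<zero>}" for y
    using regular_first(2)[OF xs(1,3) that(1)] that(2) by (simp add: x_def)
  have "[:0, 1:] dvd \<pi> x" using x(2) poly_eq_0_iff_dvd[of "\<pi> x" 0] by simp
  then obtain p where "\<pi> x = [:0, 1:] * p" by (rule dvdE)
  then have "\<iota> (\<pi> x) = \<iota> p \<otimes> \<iota> [:0, 1:]" by (simp only: \<iota>_mult m_comm[OF \<iota>_closed \<iota>_closed])
  then have "\<iota> (\<pi> x) \<otimes> u = \<iota> p \<otimes> (\<iota> [:0, 1:] \<otimes> u)"
    by (simp only: m_assoc[OF \<iota>_closed \<iota>_closed u(1)])
  then have ku: "\<iota> (\<pi> x) \<otimes> u = \<zero>" by (simp only: u(2) r_null[OF \<iota>_closed])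
  define v where "v = x \<ominus> \<iota> (\<pi> x)"
  have v: "v \<in> carrier R" "\<pi> v = 0" using x by (simp_all add: v_def)
  then obtain k :: nat where k: "v [^] k = \<zero>" using nil by blast
  have vu: "v \<otimes> u = x \<otimes> u"
  proof -
    have "v \<otimes> u = x \<otimes> u \<ominus> \<iota> (\<pi> x) \<otimes> u" unfolding v_def using x(1) u(1) \<iota>_closed[of "\<pi> x"] by algebra
    then show ?thesis using ku x(1) u(1) by (simp add: a_minus_def)
  qed
  have "x [^] m \<otimes> u = v [^] m \<otimes> u" for m :: nat
  proof (induction m)
    case (Suc m)
    have "x [^] Suc m \<otimes> u = x \<otimes> (x [^] m \<otimes> u)"
      by (rule pow_Suc_mult[OF x(1) u(1)])
    also have "\<dots> = v [^] m \<otimes> (x \<otimes> u)" using Suc x(1) u(1) v(1) by (simp add: m_lcomm)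
    also have "\<dots> = v [^] Suc m \<otimes> u" using u(1) v(1) by (simp add: vu[symmetric] m_assoc)
    finally show ?case .
  qed (use u(1) in simp)
  then have "x [^] k \<otimes> u \<in> {\<zero>}" using k u(1) by simp
  then have "u \<in> {\<zero>}" by (rule regular_pow[of x "{\<zero>}" u k, OF _ x(1) u(1), rotated]) (rule reg)
  then show ?thesis by simp
qed

text \<open>A maximal ideal exceeds the kernel, so it contains \<open>\<iota> p\<close> for some
  \<open>p \<noteq> 0\<close>. That element alone is a regular sequence, which matches the upper
  bound on the depth and the height 1.\<close>

lemma cohen_macaulayI:
  assumes noeth: "noetherian_ring R"
    and reg: "\<And>p u. p \<noteq> 0 \<Longrightarrow> u \<in> carrier R \<Longrightarrow> \<iota> p \<otimes> u = \<zero> \<Longrightarrow> u = \<zero>"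
  shows "cohen_macaulay R"
proof -
  have "ideal_depth R M = prime_height R M" if M: "maximalideal M R" for M
  proof -
    interpret M: maximalideal M R by (rule M)
    obtain u where u: "u \<in> M" "u \<notin> nil_ideal" using maximal_neq_nil[OF M] by blast
    then have uc: "u \<in> carrier R" using M.Icarr by blast
    have p: "\<iota> (\<pi> u) \<in> M" using prime_mem_iff[OF maximalideal_prime[OF M] uc] u(1) by simp
    have "\<pi> u \<noteq> 0" using u(2) uc by simp
    have "Idl {\<iota> (\<pi> u)} \<subseteq> M" using p by (intro genideal_minimal[OF M.is_ideal]) auto
    then have "Idl {\<iota> (\<pi> u)} \<noteq> carrier R" using M.I_notcarr M.a_subset by blast
    then have "regular_sequence R [\<iota> (\<pi> u)]"
      using reg[OF \<open>\<pi> u \<noteq> 0\<close>] by (simp add: regular_sequence_def genideal_empty)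
    then have "enat 1 \<in> {enat (length xs) |xs. regular_sequence R xs \<and> set xs \<subseteq> M}"
      using p by (intro CollectI exI[of _ "[\<iota> (\<pi> u)]"]) simp
    then have "1 \<le> ideal_depth R M" unfolding ideal_depth_def one_enat_def by (rule Sup_upper)
    then show ?thesis using ideal_depth_le_1[OF M] prime_height_maximal[OF M] by simp
  qed
  then show ?thesis using noeth is_cring by (simp add: cohen_macaulay_def)
qed

end

text \<open>Submodules of a free \<open>k[t]\<close>-module of finite rank are finitely generated,
  by induction on the rank. The entries in coordinate \<open>m\<close> form an ideal generated by
  one of least degree; subtracting a multiple of the corresponding element leaves the submodule
  where coordinate \<open>m\<close> vanishes. Equality is claimed on \<open>A\<close> only, as the
  functions are arbitrary elsewhere.\<close>

lemma finite_generation_over_poly: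
  fixes K :: "('i \<Rightarrow> ('k::field) poly) set"
  assumes "finite A"
    and "\<And>p q. p \<in> K \<Longrightarrow> q \<in> K \<Longrightarrow> (\<lambda>j. p j + q j) \<in> K"
    and "\<And>p r. p \<in> K \<Longrightarrow> (\<lambda>j. r * p j) \<in> K"
  shows "\<exists>F. finite F \<and> F \<subseteq> K \<and> (\<forall>p\<in>K. \<exists>c. \<forall>j\<in>A. p j = (\<Sum>f\<in>F. c f * f j))"
  using assms
proof (induction A arbitrary: K rule: finite_induct)
  case empty
  then show ?case by (intro exI[of _ "{}"]) auto
next
  case (insert m A)
  define K' where "K' = {p \<in> K. p m = 0}"
  have "\<exists>F. finite F \<and> F \<subseteq> K' \<and> (\<forall>p\<in>K'. \<exists>c. \<forall>j\<in>A. p j = (\<Sum>f\<in>F. c f * f j))"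
    by (rule insert.IH) (use insert.prems in \<open>auto simp: K'_def\<close>)
  then obtain F where F: "finite F" "F \<subseteq> K'" "\<And>p. p \<in> K' \<Longrightarrow> \<exists>c. \<forall>j\<in>A. p j = (\<Sum>f\<in>F. c f * f j)"
    by blast
  have Fm: "f m = 0" if "f \<in> F" for f using F(2) that by (auto simp: K'_def)
  have FK: "F \<subseteq> K" using F(2) by (auto simp: K'_def)
  define D where "D = (\<lambda>p. p m) ` K"
  show ?case
  proof (cases "D \<subseteq> {0}")
    case True
    have "\<exists>c. \<forall>j\<in>insert m A. p j = (\<Sum>f\<in>F. c f * f j)" if p: "p \<in> K" for p
    proof -
      have pm: "p m = 0" using True p by (auto simp: D_def)
      then obtain c where "\<forall>j\<in>A. p j = (\<Sum>f\<in>F. c f * f j)" using F(3)[of p] p by (auto simp: K'_def)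
      moreover have "(\<Sum>f\<in>F. c f * f m) = 0" using Fm by (intro sum.neutral) simp
      ultimately show ?thesis using pm by (intro exI[of _ c]) auto
    qed
    then show ?thesis using F(1) FK by (intro exI[of _ F]) blast
  next
    case False
    then obtain x where x: "x \<in> D" "x \<noteq> 0" by blast
    obtain g where g: "g \<in> D" "g \<noteq> 0" "\<And>x. x \<in> D \<Longrightarrow> x \<noteq> 0 \<Longrightarrow> Polynomial.degree g \<le> Polynomial.degree x"
      using degree_minimal_exists[OF x] by blast
    obtain f0 where f0: "f0 \<in> K" "g = f0 m" using g(1) by (auto simp: D_def)
    have f0F: "f0 \<notin> F" using Fm[of f0] g(2) f0(2) by auto
    have comb: "(\<lambda>j. p j + (- r) * f0 j) \<in> K" if "p \<in> K" for p r
      by (rule insert.prems(1)[OF that insert.prems(2)[OF f0(1)]])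
    have closed: "x - y * g \<in> D" if xD: "x \<in> D" for x y
    proof -
      obtain p where p: "p \<in> K" "x = p m" using xD by (auto simp: D_def)
      show ?thesis unfolding D_def by (rule image_eqI[OF _ comb[OF p(1), of y]]) (simp add: p f0)
    qed
    have "\<exists>c. \<forall>j\<in>insert m A. p j = (\<Sum>f\<in>insert f0 F. c f * f j)" if p: "p \<in> K" for p
    proof -
      have pmD: "p m \<in> D" using p by (auto simp: D_def)
      have "g dvd p m" by (rule poly_mod_degree_minimal[OF g(1,2) g(3) closed pmD], assumption+)
      then obtain r where r: "p m = g * r" by (rule dvdE)
      let ?p = "\<lambda>j. p j + (- r) * f0 j"
      have "?p \<in> K'" using comb[OF p, of r] by (simp add: K'_def r f0(2))
      then obtain c where c: "\<forall>j\<in>A. ?p j = (\<Sum>f\<in>F. c f * f j)" using F(3) by blast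
      let ?c = "c(f0 := r)"
      have eq: "(\<Sum>f\<in>insert f0 F. ?c f * f j) = r * f0 j + (\<Sum>f\<in>F. c f * f j)" for j
      proof -
        have "(\<Sum>f\<in>F. ?c f * f j) = (\<Sum>f\<in>F. c f * f j)" using f0F by (intro sum.cong) auto
        then show ?thesis using F(1) f0F by simp
      qed
      have "p j = (\<Sum>f\<in>insert f0 F. ?c f * f j)" if "j \<in> A" for j
        unfolding eq using c[rule_format, OF that, symmetric] by simp
      moreover have "p m = (\<Sum>f\<in>insert f0 F. ?c f * f m)"
      proof -
        have "(\<Sum>f\<in>F. c f * f m) = 0" using Fm by (intro sum.neutral) simp
        then show ?thesis unfolding eq using r f0(2) by simp
      qed
      ultimately show ?thesis by (intro exI[of _ ?c]) blast
    qed
    then show ?thesis using F(1) FK f0(1) by (intro exI[of _ "insert f0 F"]) simp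
  qed
qed

context nil_extension
begin

text \<open>The \<open>k[t]\<close>-linear map from the free module on \<open>A\<close> to
  \<open>R\<close> that sends the basis vectors to the \<open>b j\<close>.\<close>

definition combination :: "'i set \<Rightarrow> ('i \<Rightarrow> 'a) \<Rightarrow> ('i \<Rightarrow> 'k poly) \<Rightarrow> 'a" where
  "combination A b p = (\<Oplus>j\<in>A. \<iota> (p j) \<otimes> b j)"

lemma combination_props:
  assumes b: "\<And>j. j \<in> A \<Longrightarrow> b j \<in> carrier R" and fin: "finite A"
  shows "combination A b p \<in> carrier R"
    and "combination A b (\<lambda>j. p j + q j) = combination A b p \<oplus> combination A b q"
    and "combination A b (\<lambda>j. r * p j) = \<iota> r \<otimes> combination A b p"
    and "combination A b (\<lambda>j. 0) = \<zero>"
    and "i \<in> A \<Longrightarrow> combination A b (\<lambda>j. if j = i then r else 0) = \<iota> r \<otimes> b i"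
proof -
  have closed: "(\<lambda>j. \<iota> (p j) \<otimes> b j) \<in> A \<rightarrow> carrier R" for p using b by auto
  show "combination A b p \<in> carrier R" unfolding combination_def by (rule finsum_closed[OF closed])
  show "combination A b (\<lambda>j. p j + q j) = combination A b p \<oplus> combination A b q"
    unfolding combination_def finsum_addf[OF closed closed, symmetric]
    by (intro finsum_cong') (use b in \<open>auto simp: \<iota>_add l_distr\<close>)
  show "combination A b (\<lambda>j. r * p j) = \<iota> r \<otimes> combination A b p"
    unfolding combination_def finsum_rdistr[OF fin \<iota>_closed closed]
    by (intro finsum_cong') (use b in \<open>auto simp: \<iota>_mult m_assoc\<close>)
  have 0: "combination A' b (\<lambda>j. 0) = \<zero>" if "A' \<subseteq> A" for A'
    unfolding combination_def using b that by (intro add.finprod_one_eqI) auto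
  then show "combination A b (\<lambda>j. 0) = \<zero>" by simp
  show "combination A b (\<lambda>j. if j = i then r else 0) = \<iota> r \<otimes> b i" if i: "i \<in> A"
  proof -
    have "combination (insert i (A - {i})) b (\<lambda>j. if j = i then r else 0) =
        \<iota> r \<otimes> b i \<oplus> combination (A - {i}) b (\<lambda>j. if j = i then r else 0)"
      unfolding combination_def using fin b i by (subst finsum_insert) auto
    also have "combination (A - {i}) b (\<lambda>j. if j = i then r else 0) = combination (A - {i}) b (\<lambda>j. 0)"
      unfolding combination_def using b by (intro finsum_cong') auto
    also have "\<dots> = \<zero>" by (rule 0) blast
    finally show ?thesis using i b[OF i] by (simp add: insert_absorb)
  qed
qed

text \<open>An ideal pulls back along \<open>combination\<close> to a submodule of a free module;
  finitely many generators of the pullback map to generators of the ideal, since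
  \<open>combination\<close> is onto.\<close>

lemma noetherianI:
  assumes fin: "finite A" and b: "\<And>j. j \<in> A \<Longrightarrow> b j \<in> carrier R"
    and span: "\<And>u. u \<in> carrier R \<Longrightarrow> \<exists>p. u = combination A b p"
  shows "noetherian_ring R"
proof (rule noetherian_ringI)
  fix I assume I: "ideal I R"
  interpret I: ideal I R by (rule I)
  note cp = combination_props[of A b, OF b fin]
  let ?K = "{p. combination A b p \<in> I}"
  have "\<exists>F. finite F \<and> F \<subseteq> ?K \<and> (\<forall>p\<in>?K. \<exists>c. \<forall>j\<in>A. p j = (\<Sum>f\<in>F. c f * f j))"
  proof (rule finite_generation_over_poly[OF fin])
    show "(\<lambda>j. p j + q j) \<in> ?K" if "p \<in> ?K" "q \<in> ?K" for p q using that by (simp add: cp(2))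
    show "(\<lambda>j. r * p j) \<in> ?K" if "p \<in> ?K" for p r using that by (simp add: cp(3) I.I_l_closed)
  qed
  then obtain F where F: "finite F" "F \<subseteq> ?K" "\<And>p. p \<in> ?K \<Longrightarrow> \<exists>c. \<forall>j\<in>A. p j = (\<Sum>f\<in>F. c f * f j)"
    by blast
  let ?B = "combination A b ` F"
  have BI: "?B \<subseteq> I" using F(2) by blast
  have B: "?B \<subseteq> carrier R" using cp(1) by blast
  interpret J: ideal "Idl ?B" R by (rule genideal_ideal[OF B])
  have sums: "combination A b (\<lambda>j. \<Sum>f\<in>F'. c f * f j) \<in> Idl ?B" if "F' \<subseteq> F" for F' c
    using finite_subset[OF that F(1)] that
  proof (induction F' rule: finite_induct)
    case empty
    then show ?case using J.zero_closed by (simp add: cp(4))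
  next
    case (insert f F')
    have "combination A b f \<in> Idl ?B" using genideal_self[OF B] insert.prems by blast
    then have "combination A b (\<lambda>j. c f * f j) \<in> Idl ?B" by (simp add: cp(3) J.I_l_closed)
    moreover have "combination A b (\<lambda>j. \<Sum>f\<in>F'. c f * f j) \<in> Idl ?B"
      using insert.IH insert.prems by blast
    ultimately show ?case using insert.hyps by (simp add: cp(2))
  qed
  have "I \<subseteq> Idl ?B"
  proof
    fix u assume u: "u \<in> I"
    then obtain p where p: "u = combination A b p" using span I.Icarr by blast
    then obtain c where c: "\<forall>j\<in>A. p j = (\<Sum>f\<in>F. c f * f j)" using F(3)[of p] u by blast
    have "combination A b p = combination A b (\<lambda>j. \<Sum>f\<in>F. c f * f j)"
      unfolding combination_def using c b by (intro finsum_cong') auto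
    then show "u \<in> Idl ?B" using p sums[of F c] by simp
  qed
  then have "I = Idl ?B" using genideal_minimal[OF I BI] by (rule subset_antisym)
  then show "\<exists>A\<subseteq>carrier R. finite A \<and> I = Idl A"
    using B F(1) by (intro exI[of _ ?B]) simp
qed

end

subsection \<open>The filtration of the semigroup ring\<close>

lemma semigroup_ring_simps [simp]:
  "carrier (semigroup_ring S :: ('k::field) poly ring) = {p. \<forall>s. Polynomial.coeff p s \<noteq> 0 \<longrightarrow> s \<in> S}"
  "monoid.mult (semigroup_ring S :: 'k poly ring) = (*)"
  "monoid.one (semigroup_ring S :: 'k poly ring) = 1"
  "ring.zero (semigroup_ring S :: 'k poly ring) = 0"
  "ring.add (semigroup_ring S :: 'k poly ring) = (+)"
  by (simp_all add: semigroup_ring_def)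

context semigroup_generators
begin

lemma ord_superadditive:
  assumes "s \<in> S" "t \<in> S"
  shows "ord s + ord t \<le> ord (s + t)"
proof -
  obtain a where a: "maxfac a" "weight d n a = s" "total_deg d a = ord s" "a \<in> exps d"
    using maxfac_exists[OF assms(1)] by blast
  obtain b where b: "maxfac b" "weight d n b = t" "total_deg d b = ord t" "b \<in> exps d"
    using maxfac_exists[OF assms(2)] by blast
  show ?thesis using total_deg_le_ord[of "a + b"] a b by simp
qed

text \<open>A description by monomials of the \<open>m\<close>-th power of the ideal generated by
  the \<open>t^(n i)\<close>, with \<open>filt 0\<close> the whole semigroup ring.\<close>

definition filt :: "nat \<Rightarrow> ('k::field) poly set" where
  "filt m = {p. \<forall>s. Polynomial.coeff p s \<noteq> 0 \<longrightarrow> s \<in> S \<and> m \<le> ord s}"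

lemma filtD: "p \<in> filt m \<Longrightarrow> Polynomial.coeff p s \<noteq> 0 \<Longrightarrow> s \<in> S \<and> m \<le> ord s"
  by (simp add: filt_def)

lemma filt_0: "filt 0 = carrier (semigroup_ring S :: ('k::field) poly ring)"
  by (simp add: filt_def)

lemma filt_subset_carrier: "filt m \<subseteq> carrier (semigroup_ring S :: ('k::field) poly ring)"
  by (auto simp: filt_def)

lemma zero_in_filt [simp]: "0 \<in> filt m"
  by (simp add: filt_def)

lemma filt_add: "p \<in> filt m \<Longrightarrow> q \<in> filt m \<Longrightarrow> p + q \<in> filt m"
  unfolding filt_def mem_Collect_eq by (metis add.right_neutral coeff_add)

lemma filt_uminus: "p \<in> filt m \<Longrightarrow> - p \<in> filt m"
  by (simp add: filt_def)

lemma filt_diff: "p \<in> filt m \<Longrightarrow> q \<in> filt m \<Longrightarrow> p - q \<in> filt m"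
  using filt_add[OF _ filt_uminus, of p m q] by simp

lemma filt_sum: "(\<And>x. x \<in> A \<Longrightarrow> F x \<in> filt m) \<Longrightarrow> sum F A \<in> filt m"
  by (induction A rule: infinite_finite_induct) (auto intro: filt_add)

lemma filt_mult:
  fixes p q :: "('k::field) poly"
  assumes "p \<in> filt i" "q \<in> filt j"
  shows "p * q \<in> filt (i + j)"
  unfolding filt_def mem_Collect_eq
proof (intro allI impI)
  fix s assume "Polynomial.coeff (p * q) s \<noteq> 0"
  then obtain k where k: "k \<le> s" "Polynomial.coeff p k * Polynomial.coeff q (s - k) \<noteq> 0"
    unfolding coeff_mult by (meson atMost_iff sum.not_neutral_contains_not_neutral)
  then have "k \<in> S \<and> i \<le> ord k" "s - k \<in> S \<and> j \<le> ord (s - k)"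
    using filtD[OF assms(1), of k] filtD[OF assms(2), of "s - k"] by auto
  then show "s \<in> S \<and> i + j \<le> ord s"
    using S_submonoid(2)[of k "s - k"] ord_superadditive[of k "s - k"] k(1) by simp
qed

lemma filt_Suc: "filt (Suc m) \<subseteq> filt m"
  by (auto simp: filt_def)

lemma monom_in_filt: "s \<in> S \<Longrightarrow> m \<le> ord s \<Longrightarrow> Polynomial.monom c s \<in> filt m"
  by (simp add: filt_def)

lemma cring_semigroup_ring: "cring (semigroup_ring S :: ('k::field) poly ring)"
proof (rule cringI)
  let ?R = "semigroup_ring S :: 'k poly ring"
  note c = filt_0[where 'k='k, symmetric]
  show "abelian_group ?R"
  proof (rule abelian_groupI)
    fix x assume "x \<in> carrier ?R"
    then show "\<exists>y\<in>carrier ?R. y \<oplus>\<^bsub>?R\<^esub> x = \<zero>\<^bsub>?R\<^esub>"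
      unfolding c by (intro bexI[of _ "- x"] filt_uminus) auto
  qed (unfold c, auto simp: add_ac intro: filt_add)
  have one: "1 \<in> (filt 0 :: 'k poly set)"
    using monom_in_filt[of 0 0 1] S_submonoid(1) by (simp add: monom_0 one_pCons)
  show "comm_monoid ?R"
  proof (rule comm_monoidI)
    fix x y assume "x \<in> carrier ?R" "y \<in> carrier ?R"
    then have "x * y \<in> filt (0 + 0)" unfolding c by (rule filt_mult)
    then show "x \<otimes>\<^bsub>?R\<^esub> y \<in> carrier ?R" unfolding c by simp
  next
    show "\<one>\<^bsub>?R\<^esub> \<in> carrier ?R" unfolding c using one by simp
  qed (simp_all add: mult_ac)
qed (auto simp: distrib_right)

lemma ideal_filt: "ideal (filt m) (semigroup_ring S :: ('k::field) poly ring)"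
proof -
  let ?R = "semigroup_ring S :: 'k poly ring"
  interpret R: cring ?R by (rule cring_semigroup_ring)
  show ?thesis
  proof (rule idealI[OF R.ring_axioms])
    have inv: "inv\<^bsub>add_monoid ?R\<^esub> f = - f" if "f \<in> filt m" for f
    proof -
      have "f \<in> carrier ?R" "- f \<in> carrier ?R"
        using subsetD[OF filt_subset_carrier that] subsetD[OF filt_subset_carrier filt_uminus[OF that]] .
      then show ?thesis using R.minus_equality[of "- f" f] by (simp add: a_inv_def)
    qed
    show "subgroup (filt m) (add_monoid ?R)"
    proof (rule subgroup.intro)
      show "filt m \<subseteq> carrier (add_monoid ?R)" using filt_subset_carrier by simp
      show "inv\<^bsub>add_monoid ?R\<^esub> x \<in> filt m" if "x \<in> filt m" for x
        unfolding inv[OF that] by (rule filt_uminus[OF that])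
    qed (simp_all add: filt_add)
    fix a x :: "'k poly" assume a: "a \<in> filt m" and x: "x \<in> carrier ?R"
    have "x * a \<in> filt m" using filt_mult[OF x[folded filt_0] a] by simp
    then show "x \<otimes>\<^bsub>?R\<^esub> a \<in> filt m" "a \<otimes>\<^bsub>?R\<^esub> x \<in> filt m" by (simp_all add: mult.commute)
  qed
qed

lemma filt_induct:
  assumes "p \<in> filt m" "P 0" "\<And>p q. P p \<Longrightarrow> P q \<Longrightarrow> P (p + q)"
    and mon: "\<And>c s. s \<in> S \<Longrightarrow> m \<le> ord s \<Longrightarrow> P (Polynomial.monom c s)"
  shows "P (p :: ('k::field) poly)"
proof -
  have "P (Polynomial.monom (Polynomial.coeff p s) s)" for s
    using mon[of s] filtD[OF assms(1), of s] assms(2) by (cases "Polynomial.coeff p s = 0") auto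
  then have "P (\<Sum>s\<in>A. Polynomial.monom (Polynomial.coeff p s) s)" for A
    using assms(2,3) by (induction A rule: infinite_finite_induct) auto
  from this[of "{..Polynomial.degree p}"] show ?thesis by (simp only: poly_as_sum_of_monoms)
qed

lemma generator_in_S: "i \<in> {1..d} \<Longrightarrow> n i \<in> S \<and> 1 \<le> ord (n i)"
  using weight_in_S[of "Poly_Mapping.single i 1"] total_deg_le_ord[of "Poly_Mapping.single i 1"]
    weight_single[of i d n 1] total_deg_single[of i d 1] single_in_exps[of i d 1] by (simp del: One_nat_def)

text \<open>Take one variable off a longest factorization; what remains still has length at least
  \<open>m\<close>.\<close>

lemma split_generator:
  assumes "s \<in> S" "Suc m \<le> ord s"
  obtains i t where "i \<in> {1..d}" "t \<in> S" "m \<le> ord t" "s = n i + t"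
proof -
  obtain a where a: "weight d n a = s" "total_deg d a = ord s" "a \<in> exps d"
    using maxfac_exists[OF assms(1)] by blast
  then have "a \<noteq> 0" using assms(2) by auto
  then obtain i where i: "Poly_Mapping.lookup a i \<noteq> 0" by (metis lookup_zero poly_mapping_eqI)
  have id: "i \<in> {1..d}" by (rule exps_lookup_index[OF a(3) i])
  define b where "b = a - Poly_Mapping.single i 1"
  have ab: "a = b + Poly_Mapping.single i 1" unfolding b_def by (rule minus_single_add[OF i])
  have bx: "b \<in> exps d" using a(3) ab by (metis add_in_exps_iff)
  have w: "weight d n a = weight d n b + n i" unfolding ab weight_add weight_single[OF id] by simp
  have "total_deg d a = total_deg d b + 1" unfolding ab total_deg_add total_deg_single[OF id] ..
  then have "m \<le> ord (weight d n b)" using assms(2) a(2) total_deg_le_ord[OF bx] by simp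
  then show ?thesis using that[OF id weight_in_S[OF bx]] w a(1) by simp
qed

lemma maximal_ideal_eq_filt:
  "Idl\<^bsub>semigroup_ring S\<^esub> ((\<lambda>i. Polynomial.monom 1 (n i)) ` {1..d}) = (filt 1 :: ('k::field) poly set)"
proof
  let ?R = "semigroup_ring S :: 'k poly ring"
  let ?B = "(\<lambda>i. Polynomial.monom 1 (n i)) ` {1..d} :: 'k poly set"
  interpret R: cring ?R by (rule cring_semigroup_ring)
  have BM: "?B \<subseteq> filt 1" by (intro image_subsetI monom_in_filt) (use generator_in_S in blast)+
  then show "Idl\<^bsub>?R\<^esub> ?B \<subseteq> filt 1" by (rule R.genideal_minimal[OF ideal_filt])
  have B: "?B \<subseteq> carrier ?R" using BM filt_subset_carrier by (rule subset_trans)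
  interpret J: ideal "Idl\<^bsub>?R\<^esub> ?B" ?R by (rule R.genideal_ideal[OF B])
  show "filt 1 \<subseteq> Idl\<^bsub>?R\<^esub> ?B"
  proof
    fix p :: "'k poly" assume "p \<in> filt 1"
    then show "p \<in> Idl\<^bsub>?R\<^esub> ?B"
    proof (rule filt_induct)
      fix c :: 'k and s assume "s \<in> S" "1 \<le> ord s"
      then have "s \<in> S" "Suc 0 \<le> ord s" by simp_all
      then obtain i t where it: "i \<in> {1..d}" "t \<in> S" "0 \<le> ord t" "s = n i + t" by (rule split_generator)
      have "Polynomial.monom 1 (n i) \<in> Idl\<^bsub>?R\<^esub> ?B" using R.genideal_self[OF B] it(1) by blast
      moreover have "Polynomial.monom c t \<in> carrier ?R" using it(2) by simp
      ultimately have "Polynomial.monom 1 (n i) \<otimes>\<^bsub>?R\<^esub> Polynomial.monom c t \<in> Idl\<^bsub>?R\<^esub> ?B"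
        by (rule J.I_r_closed)
      then show "Polynomial.monom c s \<in> Idl\<^bsub>?R\<^esub> ?B" by (simp add: it(4) mult_monom)
    qed (use J.zero_closed J.a_closed in simp_all)
  qed
qed

text \<open>Superadditivity of \<open>ord\<close> gives one inclusion, splitting a generator off a
  longest factorization the other.\<close>

lemma ideal_pow_eq_filt: "ideal_pow (semigroup_ring S) (filt 1) m = (filt m :: ('k::field) poly set)"
proof (induction m)
  case 0
  then show ?case by (simp add: filt_0)
next
  case (Suc m)
  let ?R = "semigroup_ring S :: 'k poly ring"
  have "ideal_prod ?R (filt 1) (filt m) = filt (Suc m)"
  proof (intro equalityI subsetI)
    fix p assume "p \<in> ideal_prod ?R (filt 1) (filt m)"
    then show "p \<in> filt (Suc m)"
    proof (induction rule: ideal_prod.induct)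
      case (prod i j)
      then show ?case using filt_mult[of i 1 j m] by simp
    next
      case (sum s t)
      then show ?case using filt_add[of s "Suc m" t] by simp
    qed
  next
    fix p :: "'k poly" assume "p \<in> filt (Suc m)"
    then show "p \<in> ideal_prod ?R (filt 1) (filt m)"
    proof (rule filt_induct)
      show "0 \<in> ideal_prod ?R (filt 1) (filt m)"
        using ideal_prod.prod[of 0 "filt 1" 0 "filt m" ?R] by simp
      show "p + q \<in> ideal_prod ?R (filt 1) (filt m)"
        if "p \<in> ideal_prod ?R (filt 1) (filt m)" "q \<in> ideal_prod ?R (filt 1) (filt m)"
        for p q :: "'k poly"
        using ideal_prod.sum[OF that] by simp
      fix c :: 'k and s assume "s \<in> S" "Suc m \<le> ord s"
      then obtain i t where it: "i \<in> {1..d}" "t \<in> S" "m \<le> ord t" "s = n i + t" by (rule split_generator)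
      have "Polynomial.monom 1 (n i) \<in> filt 1" "Polynomial.monom c t \<in> filt m"
        using generator_in_S[OF it(1)] it by (simp_all only: monom_in_filt)
      from ideal_prod.prod[OF this, of ?R]
      show "Polynomial.monom c s \<in> ideal_prod ?R (filt 1) (filt m)" by (simp add: it(4) mult_monom)
    qed
  qed
  then show ?case using Suc by simp
qed

end

subsection \<open>The associated graded ring as an image of the polynomial ring\<close>

context semigroup_generators
begin

text \<open>The outer variable records the total degree.\<close>

definition bigraded :: "('k::field) mpol \<Rightarrow> 'k poly poly" where
  "bigraded = pm_eval (\<lambda>c. [:[:c:]:])
     (\<lambda>a. Polynomial.monom (Polynomial.monom 1 (weight d n a)) (total_deg d a))"

text \<open>The image in \<open>k[t]\<close> of the degree \<open>m\<close> part of
  \<open>f\<close>. Only its class modulo \<open>filt (Suc m)\<close> enters the graded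
  ring.\<close>

definition piece :: "('k::field) mpol \<Rightarrow> nat \<Rightarrow> 'k poly" where
  "piece f m = Polynomial.coeff (bigraded f) m"

lemma piece_add: "piece (f + g) m = piece f m + piece g m"
  by (simp add: piece_def bigraded_def pm_eval_add)

lemma piece_zero [simp]: "piece 0 m = 0"
  by (simp add: piece_def bigraded_def)

lemma piece_sum: "piece (sum F A) m = (\<Sum>x\<in>A. piece (F x) m)"
  by (induction A rule: infinite_finite_induct) (simp_all add: piece_add)

lemma piece_mult: "piece (f * g) m = (\<Sum>i\<le>m. piece f i * piece g (m - i))"
proof -
  have "bigraded (f * g) = bigraded f * bigraded g"
    unfolding bigraded_def by (rule pm_eval_mult) (simp_all add: mult_monom)
  then show ?thesis by (simp add: piece_def coeff_mult)
qed

lemma piece_single: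
  "piece (Poly_Mapping.single a c) m = (if total_deg d a = m then Polynomial.monom c (weight d n a) else 0)"
  by (simp add: piece_def bigraded_def pm_eval_single smult_monom)

lemma piece_one: "piece 1 m = (if m = 0 then 1 else 0)"
  using piece_single[of 0 1 m] by (cases "m = 0") (simp_all add: monom_0 one_pCons)

lemma piece_in_filt:
  assumes "Poly_Mapping.keys f \<subseteq> exps d"
  shows "piece f m \<in> filt m"
proof -
  have "piece (\<Sum>a\<in>Poly_Mapping.keys f. Poly_Mapping.single a (Poly_Mapping.lookup f a)) m \<in> filt m"
    unfolding piece_sum
  proof (rule filt_sum)
    fix a assume "a \<in> Poly_Mapping.keys f"
    then have a: "a \<in> exps d" using assms by blast
    show "piece (Poly_Mapping.single a (Poly_Mapping.lookup f a)) m \<in> filt m"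
      using monom_in_filt[OF weight_in_S[OF a] total_deg_le_ord[OF a]] by (auto simp: piece_single)
  qed
  then show ?thesis by (simp only: pm_sum_monomials)
qed

lemma finite_pieces: "finite {m. piece f m \<noteq> 0}"
  unfolding piece_def using MOST_coeff_eq_0[of "bigraded f"] by (simp add: eventually_cofinite)

section \<open>Classes modulo the filtration and the graded ring\<close>

definition cls :: "nat \<Rightarrow> ('k::field) poly \<Rightarrow> 'k poly set" where
  "cls m x = (\<lambda>h. h + x) ` filt (Suc m)"

lemma cls_mem_iff: "y \<in> cls m x \<longleftrightarrow> y - x \<in> filt (Suc m)"
proof
  assume "y - x \<in> filt (Suc m)"
  then show "y \<in> cls m x" unfolding cls_def by (rule image_eqI[rotated]) simp
qed (auto simp: cls_def)

lemma cls_self: "x \<in> cls m x"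
  by (simp add: cls_mem_iff)

lemma cls_eq_iff: "cls m x = cls m y \<longleftrightarrow> x - y \<in> filt (Suc m)"
proof
  assume "cls m x = cls m y"
  then show "x - y \<in> filt (Suc m)" using cls_self[of x m] cls_mem_iff by metis
next
  assume xy: "x - y \<in> filt (Suc m)"
  show "cls m x = cls m y"
  proof (rule Set.set_eqI)
    fix z
    have "z - y = (z - x) + (x - y)" "z - x = (z - y) - (x - y)" by simp_all
    then show "z \<in> cls m x \<longleftrightarrow> z \<in> cls m y"
      unfolding cls_mem_iff using filt_add[OF _ xy] filt_diff[OF _ xy] by metis
  qed
qed

lemma cls_0: "cls m 0 = filt (Suc m)"
  by (auto simp: cls_def)

lemma cls_rcoset: "filt (Suc m) +>\<^bsub>semigroup_ring S\<^esub> x = cls m x"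
  by (auto simp: a_r_coset_def' cls_def)

lemma cls_set_add: "cls m x <+>\<^bsub>semigroup_ring S\<^esub> cls m y = cls m (x + y)"
proof (rule Set.set_eqI)
  fix z
  have "z \<in> cls m x <+>\<^bsub>semigroup_ring S\<^esub> cls m y \<longleftrightarrow> (\<exists>h\<in>cls m x. \<exists>k\<in>cls m y. z = h + k)"
    by (auto simp: set_add_def')
  also have "\<dots> \<longleftrightarrow> z \<in> cls m (x + y)"
  proof
    assume "\<exists>h\<in>cls m x. \<exists>k\<in>cls m y. z = h + k"
    then obtain h k where hk: "h \<in> cls m x" "k \<in> cls m y" "z = h + k" by blast
    have "(h - x) + (k - y) \<in> filt (Suc m)" by (rule filt_add[OF hk(1,2)[unfolded cls_mem_iff]])
    moreover have "(h - x) + (k - y) = z - (x + y)" by (simp add: hk(3))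
    ultimately show "z \<in> cls m (x + y)" unfolding cls_mem_iff by simp
  next
    assume "z \<in> cls m (x + y)"
    then have "z - y \<in> cls m x" unfolding cls_mem_iff by (simp add: algebra_simps)
    moreover have "z = (z - y) + y" by simp
    ultimately show "\<exists>h\<in>cls m x. \<exists>k\<in>cls m y. z = h + k" using cls_self by blast
  qed
  finally show "z \<in> cls m x <+>\<^bsub>semigroup_ring S\<^esub> cls m y \<longleftrightarrow> z \<in> cls m (x + y)" .
qed

lemma semigroup_ring_finsum:
  assumes "finite A" "\<And>i. i \<in> A \<Longrightarrow> f i \<in> carrier (semigroup_ring S :: ('k::field) poly ring)"
  shows "(\<Oplus>\<^bsub>semigroup_ring S\<^esub>i\<in>A. f i) = (\<Sum>i\<in>A. f i)"
proof -
  interpret R: cring "semigroup_ring S :: 'k poly ring" by (rule cring_semigroup_ring)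
  show ?thesis
    using assms
  proof (induction A rule: finite_induct)
    case empty
    then show ?case by simp
  next
    case (insert x F)
    have "(\<Oplus>\<^bsub>semigroup_ring S\<^esub>i\<in>insert x F. f i) =
        f x \<oplus>\<^bsub>semigroup_ring S\<^esub> (\<Oplus>\<^bsub>semigroup_ring S\<^esub>i\<in>F. f i)"
      using insert.hyps insert.prems by (intro R.finsum_insert) blast+
    also have "(\<Oplus>\<^bsub>semigroup_ring S\<^esub>i\<in>F. f i) = (\<Sum>i\<in>F. f i)"
      using insert.prems by (intro insert.IH) blast
    finally show ?case using insert.hyps by simp
  qed
qed

lemma assoc_graded_simps:
  "carrier (semigroup_assoc_graded S d n :: (nat \<Rightarrow> ('k::field) poly set) ring) =
    {g. (\<forall>m. \<exists>x\<in>filt m. g m = cls m x) \<and> finite {m. g m \<noteq> filt (Suc m)}}"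
  "monoid.mult (semigroup_assoc_graded S d n :: (nat \<Rightarrow> 'k poly set) ring) =
    (\<lambda>g h m. \<Union>a\<in>Pi UNIV g. \<Union>b\<in>Pi UNIV h.
       cls m (\<Oplus>\<^bsub>semigroup_ring S\<^esub>i\<in>{..m}. a i * b (m - i)))"
  "monoid.one (semigroup_assoc_graded S d n :: (nat \<Rightarrow> 'k poly set) ring) = (\<lambda>m. if m = 0 then cls 0 1 else filt (Suc m))"
  "ring.zero (semigroup_assoc_graded S d n :: (nat \<Rightarrow> 'k poly set) ring) = (\<lambda>m. filt (Suc m))"
  "ring.add (semigroup_assoc_graded S d n :: (nat \<Rightarrow> 'k poly set) ring) = (\<lambda>g h m. g m <+>\<^bsub>semigroup_ring S\<^esub> h m)"
  unfolding semigroup_assoc_graded_def assoc_graded_ring_def maximal_ideal_eq_filt ideal_pow_eq_filt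
    graded_piece_def cls_rcoset semigroup_ring_simps
  by (simp_all add: image_iff)

definition graded_map :: "('k::field) mpol \<Rightarrow> nat \<Rightarrow> 'k poly set" where
  "graded_map f = (\<lambda>m. cls m (piece f m))"

lemma graded_map_eq_iff: "graded_map f = graded_map g \<longleftrightarrow> (\<forall>m. piece f m - piece g m \<in> filt (Suc m))"
  by (simp add: graded_map_def fun_eq_iff cls_eq_iff)

text \<open>The product in the graded ring is a union over all choices of representatives. Changing
  a factor by something one filtration step higher changes each product by an element of
  \<open>filt (Suc m)\<close>, so every choice contributes the same class.\<close>

lemma graded_map_mult_aux:
  assumes f: "Poly_Mapping.keys f \<subseteq> exps d" and g: "Poly_Mapping.keys g \<subseteq> exps d"
    and a: "a \<in> Pi UNIV (graded_map f)" and b: "b \<in> Pi UNIV (graded_map g)"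
  shows "cls m (\<Oplus>\<^bsub>semigroup_ring S\<^esub>i\<in>{..m}. a i * b (m - i)) = cls m (piece (f * g) m)"
proof -
  have a': "a i - piece f i \<in> filt (Suc i)" for i using a by (auto simp: graded_map_def cls_mem_iff)
  have b': "b i - piece g i \<in> filt (Suc i)" for i using b by (auto simp: graded_map_def cls_mem_iff)
  have ai: "a i \<in> filt i" for i
    using filt_add[OF subsetD[OF filt_Suc a'] piece_in_filt[OF f]] by simp
  have bi: "b i \<in> filt i" for i
    using filt_add[OF subsetD[OF filt_Suc b'] piece_in_filt[OF g]] by simp
  have "(\<Oplus>\<^bsub>semigroup_ring S\<^esub>i\<in>{..m}. a i * b (m - i)) = (\<Sum>i\<le>m. a i * b (m - i))"
    using filt_mult[OF ai bi] filt_subset_carrier by (intro semigroup_ring_finsum) blast+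
  moreover have "(\<Sum>i\<le>m. a i * b (m - i)) - piece (f * g) m =
      (\<Sum>i\<le>m. (a i - piece f i) * b (m - i) + piece f i * (b (m - i) - piece g (m - i)))"
    unfolding piece_mult sum_subtractf[symmetric] by (simp add: algebra_simps)
  moreover have "\<dots> \<in> filt (Suc m)"
  proof (rule filt_sum)
    fix i assume "i \<in> {..m}"
    then have "Suc i + (m - i) = Suc m" "i + Suc (m - i) = Suc m" by simp_all
    then show "(a i - piece f i) * b (m - i) + piece f i * (b (m - i) - piece g (m - i)) \<in> filt (Suc m)"
      using filt_mult[OF a' bi, of i "m - i"] filt_mult[OF piece_in_filt[OF f] b', of i "m - i"]
      by (intro filt_add) simp_all
  qed
  ultimately show ?thesis by (simp add: cls_eq_iff)
qed

lemma graded_map_hom: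
  "graded_map \<in> ring_hom (mpol_ring d) (semigroup_assoc_graded S d n :: (nat \<Rightarrow> ('k::field) poly set) ring)"
proof (rule ring_hom_memI)
  let ?G = "semigroup_assoc_graded S d n :: (nat \<Rightarrow> 'k poly set) ring"
  fix f :: "'k mpol" assume "f \<in> carrier (mpol_ring d)"
  then have f: "Poly_Mapping.keys f \<subseteq> exps d" by simp
  have "{m. graded_map f m \<noteq> filt (Suc m)} \<subseteq> {m. piece f m \<noteq> 0}"
    by (auto simp: graded_map_def cls_0)
  then have "finite {m. graded_map f m \<noteq> filt (Suc m)}" using finite_pieces by (rule finite_subset)
  then show "graded_map f \<in> carrier ?G"
    unfolding assoc_graded_simps using piece_in_filt[OF f] by (auto simp: graded_map_def)
  fix g :: "'k mpol" assume "g \<in> carrier (mpol_ring d)"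
  then have g: "Poly_Mapping.keys g \<subseteq> exps d" by simp
  show "graded_map (f \<oplus>\<^bsub>mpol_ring d\<^esub> g) = graded_map f \<oplus>\<^bsub>?G\<^esub> graded_map g"
    unfolding assoc_graded_simps by (simp add: graded_map_def piece_add cls_set_add)
  have "piece f \<in> Pi UNIV (graded_map f)" "piece g \<in> Pi UNIV (graded_map g)"
    by (simp_all add: graded_map_def cls_self)
  then have "(\<Union>a\<in>Pi UNIV (graded_map f). \<Union>b\<in>Pi UNIV (graded_map g).
      cls m (\<Oplus>\<^bsub>semigroup_ring S\<^esub>i\<in>{..m}. a i * b (m - i))) = cls m (piece (f * g) m)" for m
    using graded_map_mult_aux[OF f g] by blast
  then show "graded_map (f \<otimes>\<^bsub>mpol_ring d\<^esub> g) = graded_map f \<otimes>\<^bsub>?G\<^esub> graded_map g"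
    unfolding assoc_graded_simps mpol_ring_simps by (simp only: graded_map_def)
next
  show "graded_map \<one>\<^bsub>mpol_ring d\<^esub> =
      \<one>\<^bsub>(semigroup_assoc_graded S d n :: (nat \<Rightarrow> 'k poly set) ring)\<^esub>"
    unfolding assoc_graded_simps by (intro ext) (simp add: graded_map_def piece_one cls_0)
qed

text \<open>Only exponents of order exactly \<open>m\<close> matter modulo
  \<open>filt (Suc m)\<close>, and a longest factorization of such an exponent has degree
  \<open>m\<close>. That the other pieces vanish allows the lifts of different components to be
  added up.\<close>

lemma piece_lift:
  assumes x: "x \<in> filt m"
  shows "\<exists>f. Poly_Mapping.keys f \<subseteq> exps d \<and> piece f m - x \<in> filt (Suc m) \<and> (\<forall>k. k \<noteq> m \<longrightarrow> piece f k = 0)"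
proof -
  define A where "A = {s. Polynomial.coeff x s \<noteq> 0 \<and> ord s = m}"
  have fin: "finite A"
    unfolding A_def using MOST_coeff_eq_0[of x] by (auto simp: eventually_cofinite intro: finite_subset[rotated])
  have AS: "s \<in> S" if "s \<in> A" for s using that filtD[OF x] by (auto simp: A_def)
  have "\<exists>a. a \<in> exps d \<and> weight d n a = s \<and> total_deg d a = m" if "s \<in> A" for s
    using maxfac_exists[OF AS[OF that]] that unfolding A_def by blast
  then obtain c where c: "\<And>s. s \<in> A \<Longrightarrow> c s \<in> exps d \<and> weight d n (c s) = s \<and> total_deg d (c s) = m"
    by metis
  define f where "f = (\<Sum>s\<in>A. Poly_Mapping.single (c s) (Polynomial.coeff x s))"
  have keys: "Poly_Mapping.keys f \<subseteq> exps d"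
  proof
    fix a assume "a \<in> Poly_Mapping.keys f"
    then obtain s where "s \<in> A" "a \<in> Poly_Mapping.keys (Poly_Mapping.single (c s) (Polynomial.coeff x s))"
      unfolding f_def using keys_sum[of "\<lambda>s. Poly_Mapping.single (c s) (Polynomial.coeff x s)" A] by blast
    then show "a \<in> exps d" using c by (auto split: if_splits)
  qed
  have "piece f m = (\<Sum>s\<in>A. Polynomial.monom (Polynomial.coeff x s) s)"
    unfolding f_def piece_sum by (intro sum.cong refl) (simp add: piece_single c)
  then have coeff: "Polynomial.coeff (piece f m) t = (if t \<in> A then Polynomial.coeff x t else 0)" for t
    using fin by (simp add: coeff_sum coeff_monom sum.delta)
  have "piece f m - x \<in> filt (Suc m)"
    unfolding filt_def mem_Collect_eq
  proof (intro allI impI)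
    fix t assume "Polynomial.coeff (piece f m - x) t \<noteq> 0"
    then have "Polynomial.coeff x t \<noteq> 0" "t \<notin> A" by (auto simp: coeff split: if_splits)
    then show "t \<in> S \<and> Suc m \<le> ord t" using filtD[OF x, of t] by (auto simp: A_def)
  qed
  moreover have "piece f k = 0" if "k \<noteq> m" for k
    unfolding f_def piece_sum using c that by (intro sum.neutral) (auto simp: piece_single)
  ultimately show ?thesis using keys by blast
qed

lemma graded_map_surj:
  assumes "g \<in> carrier (semigroup_assoc_graded S d n :: (nat \<Rightarrow> ('k::field) poly set) ring)"
  shows "\<exists>f. Poly_Mapping.keys f \<subseteq> exps d \<and> graded_map f = g"
proof -
  have g: "\<exists>x\<in>filt m. g m = cls m x" and fin: "finite {m. g m \<noteq> filt (Suc m)}" for m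
    using assms unfolding assoc_graded_simps by blast+
  have "\<exists>f. Poly_Mapping.keys f \<subseteq> exps d \<and> cls m (piece f m) = g m \<and> (\<forall>k. k \<noteq> m \<longrightarrow> piece f k = 0)" for m
  proof -
    obtain x where x: "x \<in> filt m" "g m = cls m x" using g by blast
    show ?thesis using piece_lift[OF x(1)] unfolding x(2) cls_eq_iff .
  qed
  then obtain F where F: "\<And>m. Poly_Mapping.keys (F m) \<subseteq> exps d" "\<And>m. cls m (piece (F m) m) = g m"
    "\<And>m k. k \<noteq> m \<Longrightarrow> piece (F m) k = 0"
    by metis
  let ?A = "{m. g m \<noteq> filt (Suc m)}"
  define f where "f = (\<Sum>m\<in>?A. F m)"
  have "Poly_Mapping.keys f \<subseteq> exps d"
    unfolding f_def using keys_sum[of F ?A] F(1) by blast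
  moreover have "cls m (piece f m) = g m" for m
  proof -
    have "piece f m = (\<Sum>k\<in>?A. if k = m then piece (F m) m else 0)"
      unfolding f_def piece_sum using F(3) by (intro sum.cong) auto
    also have "\<dots> = (if m \<in> ?A then piece (F m) m else 0)"
      using fin by (simp add: sum.delta)
    finally show ?thesis using F(2) by (auto simp: cls_0)
  qed
  ultimately show ?thesis by (intro exI[of _ f]) (simp add: graded_map_def)
qed

text \<open>The ring axioms are transported along the surjection from the polynomial ring instead of
  being checked on families of cosets.\<close>

lemma cring_assoc_graded:
  "cring (semigroup_assoc_graded S d n :: (nat \<Rightarrow> ('k::field) poly set) ring)"
proof -
  let ?G = "semigroup_assoc_graded S d n :: (nat \<Rightarrow> 'k poly set) ring"
  interpret P: cring "mpol_ring d :: 'k mpol ring" by (rule cring_mpol_ring)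
  have img: "graded_map ` carrier (mpol_ring d) = carrier ?G"
  proof
    show "graded_map ` carrier (mpol_ring d) \<subseteq> carrier ?G"
      using ring_hom_closed[OF graded_map_hom] by blast
    show "carrier ?G \<subseteq> graded_map ` carrier (mpol_ring d)"
    proof
      fix g assume "g \<in> carrier ?G"
      then obtain f where "Poly_Mapping.keys f \<subseteq> exps d" "graded_map f = g" using graded_map_surj by blast
      then show "g \<in> graded_map ` carrier (mpol_ring d)" by (intro image_eqI[of _ _ f]) simp_all
    qed
  qed
  have zero: "graded_map \<zero>\<^bsub>mpol_ring d\<^esub> = \<zero>\<^bsub>?G\<^esub>"
    unfolding assoc_graded_simps by (simp add: graded_map_def cls_0)
  have "ring (?G \<lparr>carrier := graded_map ` carrier (mpol_ring d), zero := graded_map \<zero>\<^bsub>mpol_ring d\<^esub>\<rparr>)"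
    by (rule P.ring_hom_imp_img_ring[OF graded_map_hom])
  then have ring: "ring ?G" unfolding img zero by simp
  interpret G: ring ?G by (rule ring)
  show ?thesis
  proof (rule cring.intro[OF ring], unfold_locales)
    fix x y assume "x \<in> carrier ?G" "y \<in> carrier ?G"
    then obtain f g where "f \<in> carrier (mpol_ring d)" "g \<in> carrier (mpol_ring d)" "x = graded_map f" "y = graded_map g"
      unfolding img[symmetric] by blast
    then show "x \<otimes>\<^bsub>?G\<^esub> y = y \<otimes>\<^bsub>?G\<^esub> x"
      using ring_hom_mult[OF graded_map_hom, of f g] ring_hom_mult[OF graded_map_hom, of g f]
      by (simp add: mult.commute)
  qed
qed

end

subsection \<open>Cohen-Macaulayness of the associated graded ring\<close>

context semigroup_generators
begin

text \<open>The polynomial \<open>p\<close> evaluated at \<open>x_1\<close>.\<close>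

definition axis :: "('k::field) poly \<Rightarrow> 'k mpol" where
  "axis p = (\<Sum>i\<le>Polynomial.degree p. Poly_Mapping.single (Poly_Mapping.single 1 i) (Polynomial.coeff p i))"

lemma keys_axis: "Poly_Mapping.keys (axis p) \<subseteq> exps d"
proof
  fix a assume "a \<in> Poly_Mapping.keys (axis p)"
  then obtain i where "a \<in> Poly_Mapping.keys (Poly_Mapping.single (Poly_Mapping.single 1 i) (Polynomial.coeff p i))"
    unfolding axis_def
    using keys_sum[of "\<lambda>i. Poly_Mapping.single (Poly_Mapping.single 1 i) (Polynomial.coeff p i)" "{..Polynomial.degree p}"]
    by blast
  then have "a = Poly_Mapping.single 1 i" by (simp split: if_splits)
  then show "a \<in> exps d" using single_in_exps[OF d_pos] by simp
qed

lemma piece_axis: "piece (axis p) m = Polynomial.monom (Polynomial.coeff p m) (m * n 1)"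
proof -
  have "piece (axis p) m = (\<Sum>i\<le>Polynomial.degree p. if i = m then Polynomial.monom (Polynomial.coeff p m) (m * n 1) else 0)"
    unfolding axis_def piece_sum piece_single total_deg_single[OF d_pos] weight_single[OF d_pos]
    by (intro sum.cong) auto
  also have "\<dots> = (if m \<le> Polynomial.degree p then Polynomial.monom (Polynomial.coeff p m) (m * n 1) else 0)"
    by (simp add: sum.delta)
  also have "\<dots> = Polynomial.monom (Polynomial.coeff p m) (m * n 1)"
    by (simp add: coeff_eq_0)
  finally show ?thesis .
qed

lemma axis_X: "axis [:0, 1:] = xpow e1"
  unfolding axis_def e1_def xpow_def by (simp add: atMost_Suc)

text \<open>Sets all variables other than \<open>x_1\<close> to zero: on \<open>exps d\<close> the
  condition on weights holds only for powers of \<open>x_1\<close>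
  (\<open>pure_power_unique\<close>). In this form the result can be read off from the pieces of
  \<open>f\<close>, so that it descends to the graded ring.\<close>

definition axis_part :: "('k::field) mpol \<Rightarrow> 'k poly" where
  "axis_part = pm_eval (\<lambda>c. [:c:])
     (\<lambda>a. if weight d n a = total_deg d a * n 1 then Polynomial.monom 1 (total_deg d a) else 0)"

lemma axis_part_add: "axis_part (f + g) = axis_part f + axis_part g"
  unfolding axis_part_def by (rule pm_eval_add) simp_all

lemma axis_part_mult:
  fixes f g :: "('k::field) mpol"
  shows "axis_part (f * g) = axis_part f * axis_part g"
  unfolding axis_part_def
proof (rule pm_eval_mult)
  fix a b
  \<comment> \<open>The inequality between \<open>total_deg * n 1\<close> and \<open>weight\<close>
    is additive, so equality for the sum forces equality for both summands.\<close>
  have "weight d n (a + b) = total_deg d (a + b) * n 1 \<longleftrightarrow>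
      weight d n a = total_deg d a * n 1 \<and> weight d n b = total_deg d b * n 1"
    using total_deg_weight_le[of a] total_deg_weight_le[of b] by (simp add: distrib_right) linarith
  then show "(if weight d n (a + b) = total_deg d (a + b) * n 1 then Polynomial.monom 1 (total_deg d (a + b)) else 0) =
      (if weight d n a = total_deg d a * n 1 then Polynomial.monom 1 (total_deg d a) else 0) *
      (if weight d n b = total_deg d b * n 1 then Polynomial.monom 1 (total_deg d b) else (0 :: 'k poly))"
    by (simp add: mult_monom)
qed simp_all

lemma coeff_axis_part: "Polynomial.coeff (axis_part f) m =
    (\<Sum>a\<in>Poly_Mapping.keys f. if weight d n a = total_deg d a * n 1 \<and> total_deg d a = m then Poly_Mapping.lookup f a else 0)"
  unfolding axis_part_def pm_eval_def coeff_sum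
  by (intro sum.cong refl) simp

lemma coeff_axis_part_piece: "Polynomial.coeff (axis_part f) m = Polynomial.coeff (piece f m) (m * n 1)"
proof (induction f rule: pm_induct)
  case (3 a)
  show ?case
    by (auto simp: axis_part_def pm_eval_single piece_single)
qed (simp_all add: axis_part_add piece_add, simp add: axis_part_def)

lemma ord_mult_n1_le:
  assumes "s \<in> S"
  shows "ord s * n 1 \<le> s"
proof -
  obtain a where "weight d n a = s" "total_deg d a = ord s" using maxfac_exists[OF assms] by blast
  then show ?thesis using total_deg_weight_le[of a] by simp
qed

text \<open>The exponent \<open>m * n 1\<close> has order at most \<open>m\<close>, so it cannot
  occur in an element of \<open>filt (Suc m)\<close>.\<close>

lemma axis_part_cong:
  assumes "graded_map f = graded_map g"
  shows "axis_part f = axis_part g"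
proof (rule poly_eqI)
  fix m
  have pm: "piece f m - piece g m \<in> filt (Suc m)" using assms unfolding graded_map_eq_iff by blast
  have "Polynomial.coeff (piece f m - piece g m) (m * n 1) = 0"
  proof (rule ccontr)
    assume "Polynomial.coeff (piece f m - piece g m) (m * n 1) \<noteq> 0"
    then have "m * n 1 \<in> S" "Suc m \<le> ord (m * n 1)" using filtD[OF pm] by blast+
    then have "Suc m * n 1 \<le> m * n 1"
      using ord_mult_n1_le[of "m * n 1"] mult_right_mono[of "Suc m" "ord (m * n 1)" "n 1"] by linarith
    then show False using n1_pos by simp
  qed
  then show "Polynomial.coeff (axis_part f) m = Polynomial.coeff (axis_part g) m"
    by (simp add: coeff_axis_part_piece)
qed

lemma pure_power_unique:
  assumes a: "a \<in> exps d" "weight d n a = total_deg d a * n 1"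
  shows "a = Poly_Mapping.single 1 (total_deg d a)"
proof -
  have 0: "Poly_Mapping.lookup a i = 0" if i: "i \<in> {2..d}" for i
  proof (rule ccontr)
    assume nz: "Poly_Mapping.lookup a i \<noteq> 0"
    have id: "i \<in> {1..d}" using i by simp
    have "total_deg d a * n 1 < weight d n a"
      unfolding total_deg_def weight_def sum_distrib_right
    proof (rule sum_strict_mono_ex1)
      show "\<forall>i\<in>{1..d}. Poly_Mapping.lookup a i * n 1 \<le> Poly_Mapping.lookup a i * n i"
        using n_ge by (intro ballI mult_left_mono) auto
      show "\<exists>i\<in>{1..d}. Poly_Mapping.lookup a i * n 1 < Poly_Mapping.lookup a i * n i"
        using id nz multiplicity_less[OF i] by (intro bexI[of _ i] mult_strict_left_mono) auto
    qed simp
    then show False using a(2) by simp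
  qed
  have "total_deg d a = (\<Sum>i\<in>{1}. Poly_Mapping.lookup a i)"
    unfolding total_deg_def
  proof (rule sum.mono_neutral_right)
    show "{1} \<subseteq> {1..d}" using d_pos by blast
    show "\<forall>i\<in>{1..d} - {1}. Poly_Mapping.lookup a i = 0" using 0 by auto
  qed simp
  then have 1: "total_deg d a = Poly_Mapping.lookup a 1" by simp
  show ?thesis
  proof (rule exps_eqI[OF a(1) single_in_exps[OF d_pos]])
    fix i assume "i \<in> {1..d}"
    then show "Poly_Mapping.lookup a i = Poly_Mapping.lookup (Poly_Mapping.single 1 (total_deg d a)) i"
      using 0[of i] 1 by (cases "i = 1") (auto simp: lookup_single when_def)
  qed
qed

text \<open>The excess of \<open>weight\<close> over \<open>total_deg * n 1\<close> is additive and
  vanishes only on powers of \<open>x_1\<close>. An excess of at least 1 on every term of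
  \<open>f\<close> grows with the powers of \<open>f\<close>, while maximal factorizations have
  bounded excess; this makes the class of \<open>f\<close> nilpotent.\<close>

lemma axis_part_zero_excess:
  fixes f :: "('k::field) mpol"
  assumes f: "Poly_Mapping.keys f \<subseteq> exps d" "axis_part f = 0" and a: "a \<in> Poly_Mapping.keys f"
  shows "total_deg d a * n 1 + 1 \<le> weight d n a"
proof (rule ccontr)
  assume "\<not> ?thesis"
  then have w: "weight d n a = total_deg d a * n 1" using total_deg_weight_le[of a] by simp
  have ax: "a \<in> exps d" using f(1) a by blast
  have only: "b = a" if "b \<in> Poly_Mapping.keys f" "weight d n b = total_deg d b * n 1" "total_deg d b = total_deg d a" for b
    using pure_power_unique[OF ax w] pure_power_unique[of b] that f(1) by (metis subsetD)
  have "0 = Polynomial.coeff (axis_part f) (total_deg d a)" by (simp add: f(2))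
  also have "\<dots> = (\<Sum>b\<in>Poly_Mapping.keys f. if b = a then Poly_Mapping.lookup f b else 0)"
    unfolding coeff_axis_part using only w by (intro sum.cong refl if_cong) blast
  also have "\<dots> = Poly_Mapping.lookup f a" using a by (simp add: sum.delta)
  finally show False using a by (simp add: in_keys_iff)
qed

text \<open>In a maximal factorization \<open>n\<^sub>1\<close> copies of \<open>x\<^sub>i\<close> could be traded for \<open>n\<^sub>i\<close> copies of \<open>x\<^sub>1\<close>.\<close>

lemma maxfac_excess_bound:
  assumes a: "maxfac a"
  shows "weight d n a \<le> total_deg d a * n 1 + n 1 * (\<Sum>i=1..d. n i)"
proof -
  have ax: "a \<in> exps d" using a by (simp add: maxfac_def)
  have small: "Poly_Mapping.lookup a i \<le> n 1" if i: "i \<in> {2..d}" for i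
  proof (rule ccontr)
    assume "\<not> Poly_Mapping.lookup a i \<le> n 1"
    have id: "i \<in> {1..d}" using i by simp
    define c where "c = a - Poly_Mapping.single i (n 1)"
    have ac: "a = Poly_Mapping.single i (n 1) + c"
      unfolding c_def using \<open>\<not> Poly_Mapping.lookup a i \<le> n 1\<close>
      by (intro pm_le_iff_add) (auto simp: lookup_single when_def)
    let ?b = "Poly_Mapping.single 1 (n i) + c"
    have "?b \<in> exps d" using ax ac single_in_exps[OF d_pos] by (metis add_in_exps_iff)
    moreover have "weight d n ?b = weight d n a"
      unfolding ac weight_add weight_single[OF d_pos] weight_single[OF id] by simp
    ultimately have "total_deg d ?b \<le> total_deg d a" using a unfolding maxfac_def by blast
    then show False
      unfolding ac total_deg_add total_deg_single[OF d_pos] total_deg_single[OF id]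
      using multiplicity_less[OF i] by simp
  qed
  have "weight d n a \<le> (\<Sum>i=1..d. Poly_Mapping.lookup a i * n 1 + n 1 * n i)"
    unfolding weight_def
  proof (rule sum_mono)
    fix i assume "i \<in> {1..d}"
    then consider "i = 1" | "i \<in> {2..d}" by fastforce
    then show "Poly_Mapping.lookup a i * n i \<le> Poly_Mapping.lookup a i * n 1 + n 1 * n i"
    proof cases
      case 2
      have "Poly_Mapping.lookup a i * n i \<le> n 1 * n i" by (rule mult_right_mono[OF small[OF 2]]) simp
      then show ?thesis by (rule trans_le_add2)
    qed simp
  qed
  also have "\<dots> = total_deg d a * n 1 + n 1 * (\<Sum>i=1..d. n i)"
    by (simp add: total_deg_def sum.distrib sum_distrib_left sum_distrib_right)
  finally show ?thesis .
qed

abbreviation graded_ring :: "'k itself \<Rightarrow> (nat \<Rightarrow> ('k::field) poly set) ring" where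
  "graded_ring _ \<equiv> semigroup_assoc_graded S d n"

lemma graded_map_zero_iff:
  "graded_map f = \<zero>\<^bsub>graded_ring TYPE('k::field)\<^esub> \<longleftrightarrow> (\<forall>m. piece f m \<in> filt (Suc m))"
  using graded_map_eq_iff[of f 0] unfolding assoc_graded_simps by (simp add: graded_map_def cls_0)

text \<open>A factorization shorter than the order of its weight contributes one filtration step too
  high to be seen in its degree.\<close>

lemma graded_map_nonmax:
  assumes keys: "Poly_Mapping.keys f \<subseteq> exps d" and non: "\<And>a. a \<in> Poly_Mapping.keys f \<Longrightarrow> \<not> maxfac a"
  shows "graded_map f = \<zero>\<^bsub>graded_ring TYPE('k::field)\<^esub>"
  unfolding graded_map_zero_iff
proof
  fix m
  show "piece f m \<in> filt (Suc m)"
  proof (induction f rule: pm_induct)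
    case (3 a)
    have ax: "a \<in> exps d" using 3 keys by blast
    have "total_deg d a < ord (weight d n a)"
      using non[OF 3] total_deg_le_ord[OF ax] maxfac_iff_ord[of a] ax by auto
    then show ?case using weight_in_S[OF ax] by (auto simp: piece_single intro!: monom_in_filt)
  qed (simp_all add: piece_add filt_add)
qed

lemma keys_power_exps:
  fixes f :: "('k::field) mpol"
  assumes f: "Poly_Mapping.keys f \<subseteq> exps d" and exc: "\<And>a. a \<in> Poly_Mapping.keys f \<Longrightarrow> total_deg d a * n 1 + 1 \<le> weight d n a"
  shows "a \<in> Poly_Mapping.keys (f ^ k) \<Longrightarrow> a \<in> exps d \<and> total_deg d a * n 1 + k \<le> weight d n a"
proof (induction k arbitrary: a)
  case (Suc k)
  then obtain b c where bc: "b \<in> Poly_Mapping.keys f" "c \<in> Poly_Mapping.keys (f ^ k)" "a = b + c"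
    using keys_mult[of f "f ^ k"] by auto
  have "b \<in> exps d" using f bc(1) by blast
  then show ?case using Suc.IH[OF bc(2)] exc[OF bc(1)] by (simp add: bc(3) distrib_right)
qed simp

lemma graded_map_one: "graded_map 1 = \<one>\<^bsub>graded_ring TYPE('k::field)\<^esub>"
  by (rule ring_hom_one[OF graded_map_hom, unfolded mpol_ring_simps])

lemma graded_map_power:
  assumes f: "Poly_Mapping.keys f \<subseteq> exps d"
  shows "graded_map f [^]\<^bsub>graded_ring TYPE('k::field)\<^esub> k = graded_map (f ^ k) \<and> Poly_Mapping.keys (f ^ k) \<subseteq> exps d"
proof (induction k)
  case 0
  show ?case by (simp add: graded_map_one)
next
  case (Suc k)
  interpret P: cring "mpol_ring d :: 'k mpol ring" by (rule cring_mpol_ring)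
  have fk: "f ^ k \<in> carrier (mpol_ring d)" "f \<in> carrier (mpol_ring d)" using Suc f by simp_all
  have "graded_map f [^]\<^bsub>graded_ring TYPE('k)\<^esub> Suc k = graded_map (f ^ k * f)"
    using Suc ring_hom_mult[OF graded_map_hom fk] by simp
  moreover have "f ^ k * f \<in> carrier (mpol_ring d)" using P.m_closed[OF fk] by simp
  ultimately show ?case by (simp add: mult.commute)
qed

text \<open>The choice of a preimage is harmless by \<open>axis_part_cong\<close>.\<close>

definition graded_axis_part :: "(nat \<Rightarrow> ('k::field) poly set) \<Rightarrow> 'k poly" where
  "graded_axis_part g = axis_part (SOME f. Poly_Mapping.keys f \<subseteq> exps d \<and> graded_map f = g)"

lemma graded_axis_part_map:
  assumes "Poly_Mapping.keys f \<subseteq> exps d"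
  shows "graded_axis_part (graded_map f) = axis_part f"
proof -
  have "graded_map (SOME f'. Poly_Mapping.keys f' \<subseteq> exps d \<and> graded_map f' = graded_map f) = graded_map f"
    using someI[of "\<lambda>f'. Poly_Mapping.keys f' \<subseteq> exps d \<and> graded_map f' = graded_map f" f] assms by blast
  then show ?thesis unfolding graded_axis_part_def by (rule axis_part_cong)
qed

lemma graded_map_cong: "(\<And>m. piece f m = piece g m) \<Longrightarrow> graded_map f = graded_map g"
  by (simp add: graded_map_eq_iff)

lemma nil_extension_assoc_graded:
  "nil_extension (graded_ring TYPE('k::field)) (\<lambda>p. graded_map (axis p)) graded_axis_part"
proof -
  let ?G = "graded_ring TYPE('k)"
  have car: "axis p \<in> carrier (mpol_ring d)" for p :: "'k poly" using keys_axis[of p] by simp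
  have surj: "\<exists>f. Poly_Mapping.keys f \<subseteq> exps d \<and> g = graded_map f" if "g \<in> carrier ?G" for g
    using graded_map_surj[OF that] by blast
  interpret G: cring ?G by (rule cring_assoc_graded)
  interpret P: cring "mpol_ring d :: 'k mpol ring" by (rule cring_mpol_ring)
  show ?thesis
  proof (rule nil_extension.intro[OF cring_assoc_graded], rule nil_extension_axioms.intro)
    show "(\<lambda>p. graded_map (axis p)) \<in> ring_hom (ring_of_type_algebra :: 'k poly ring) ?G"
    proof (rule ring_hom_memI)
      fix p q :: "'k poly"
      show "graded_map (axis p) \<in> carrier ?G" by (rule ring_hom_closed[OF graded_map_hom car])
      have "graded_map (axis (p * q)) = graded_map (axis p * axis q)"
      proof (rule graded_map_cong)
        fix m
        have "(\<Sum>i\<le>m. Polynomial.monom (Polynomial.coeff p i) (i * n 1) *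
            Polynomial.monom (Polynomial.coeff q (m - i)) ((m - i) * n 1)) =
            (\<Sum>i\<le>m. Polynomial.monom (Polynomial.coeff p i * Polynomial.coeff q (m - i)) (m * n 1))"
          by (intro sum.cong refl) (simp add: mult_monom flip: distrib_right)
        also have "\<dots> = Polynomial.monom (Polynomial.coeff (p * q) m) (m * n 1)"
          by (rule poly_eqI) (simp add: coeff_sum coeff_mult)
        finally show "piece (axis (p * q)) m = piece (axis p * axis q) m"
          by (simp add: piece_axis piece_mult)
      qed
      then show "graded_map (axis (p \<otimes>\<^bsub>ring_of_type_algebra\<^esub> q)) = graded_map (axis p) \<otimes>\<^bsub>?G\<^esub> graded_map (axis q)"
        using ring_hom_mult[OF graded_map_hom car car] by simp
      have "graded_map (axis (p + q)) = graded_map (axis p + axis q)"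
        by (rule graded_map_cong) (simp add: piece_axis piece_add add_monom)
      then show "graded_map (axis (p \<oplus>\<^bsub>ring_of_type_algebra\<^esub> q)) = graded_map (axis p) \<oplus>\<^bsub>?G\<^esub> graded_map (axis q)"
        using ring_hom_add[OF graded_map_hom car car] by simp
    next
      have "graded_map (axis 1) = graded_map (1 :: 'k mpol)"
        by (rule graded_map_cong) (simp add: piece_axis piece_one monom_0 one_pCons coeff_pCons split: nat.split)
      then show "graded_map (axis \<one>\<^bsub>(ring_of_type_algebra :: 'k poly ring)\<^esub>) = \<one>\<^bsub>?G\<^esub>"
        by (simp add: graded_map_one)
    qed
    show "graded_axis_part \<in> ring_hom ?G (ring_of_type_algebra :: 'k poly ring)"
    proof (rule ring_hom_memI)
      fix g h assume "g \<in> carrier ?G" "h \<in> carrier ?G"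
      then obtain f f' where f: "Poly_Mapping.keys f \<subseteq> exps d" "g = graded_map f"
        and f': "Poly_Mapping.keys f' \<subseteq> exps d" "h = graded_map f'"
        using surj by blast
      have fc: "f \<in> carrier (mpol_ring d)" "f' \<in> carrier (mpol_ring d)" using f f' by simp_all
      have "f * f' \<in> carrier (mpol_ring d)" "f + f' \<in> carrier (mpol_ring d)"
        using P.m_closed[OF fc] P.a_closed[OF fc] by simp_all
      then have keys: "Poly_Mapping.keys (f * f') \<subseteq> exps d" "Poly_Mapping.keys (f + f') \<subseteq> exps d" by simp_all
      have "g \<otimes>\<^bsub>?G\<^esub> h = graded_map (f * f')" "g \<oplus>\<^bsub>?G\<^esub> h = graded_map (f + f')"
        using ring_hom_mult[OF graded_map_hom fc] ring_hom_add[OF graded_map_hom fc] by (simp_all add: f f')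
      then show "graded_axis_part (g \<otimes>\<^bsub>?G\<^esub> h) = graded_axis_part g \<otimes>\<^bsub>ring_of_type_algebra\<^esub> graded_axis_part h"
        "graded_axis_part (g \<oplus>\<^bsub>?G\<^esub> h) = graded_axis_part g \<oplus>\<^bsub>ring_of_type_algebra\<^esub> graded_axis_part h"
        using keys f f' by (simp_all add: graded_axis_part_map axis_part_mult axis_part_add)
    next
      have "\<one>\<^bsub>?G\<^esub> = graded_map (1 :: 'k mpol)" by (rule graded_map_one[symmetric])
      moreover have "axis_part (1 :: 'k mpol) = 1"
        using pm_eval_single[of "\<lambda>c::'k. [:c:]" "\<lambda>a. if weight d n a = total_deg d a * n 1 then Polynomial.monom 1 (total_deg d a) else 0" 0 1]
        by (simp add: axis_part_def monom_0 one_pCons)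
      ultimately show "graded_axis_part \<one>\<^bsub>?G\<^esub> = \<one>\<^bsub>(ring_of_type_algebra :: 'k poly ring)\<^esub>"
        by (simp add: graded_axis_part_map)
    qed simp
    show "graded_axis_part (graded_map (axis p)) = p" for p :: "'k poly"
      unfolding graded_axis_part_map[OF keys_axis]
      by (rule poly_eqI) (simp add: coeff_axis_part_piece piece_axis)
    show "\<exists>k::nat. u [^]\<^bsub>?G\<^esub> k = \<zero>\<^bsub>?G\<^esub>" if u: "u \<in> carrier ?G" "graded_axis_part u = 0" for u
    proof -
      obtain f where f: "Poly_Mapping.keys f \<subseteq> exps d" "u = graded_map f" using surj[OF u(1)] by blast
      have "axis_part f = 0" using u(2) graded_axis_part_map[OF f(1)] f(2) by simp
      note exc = axis_part_zero_excess[OF f(1) this]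
      \<comment> \<open>One more than the bound in \<open>maxfac_excess_bound\<close>: every term of
        the \<open>?k\<close>-th power has too much excess to be maximal.\<close>
      let ?k = "n 1 * (\<Sum>i=1..d. n i) + 1"
      note pw = graded_map_power[OF f(1), of ?k]
      have "graded_map (f ^ ?k) = \<zero>\<^bsub>?G\<^esub>"
      proof (rule graded_map_nonmax)
        show "Poly_Mapping.keys (f ^ ?k) \<subseteq> exps d" using pw by blast
        fix a assume "a \<in> Poly_Mapping.keys (f ^ ?k)"
        then have "total_deg d a * n 1 + ?k \<le> weight d n a"
          using keys_power_exps[of f a ?k, OF f(1) exc] by blast
        then show "\<not> maxfac a" using maxfac_excess_bound[of a] by linarith
      qed
      then show ?thesis using pw f(2) by metis
    qed
  qed
qed

text \<open>If \<open>a\<close> is maximal but \<open>a + e1\<close> is not, the class of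
  \<open>x^a\<close> is nonzero and killed by the class of \<open>x_1\<close>.\<close>

lemma cohen_macaulay_imp_ord_regular:
  assumes cm: "cohen_macaulay (graded_ring TYPE('k::field))"
  shows ord_regular
  unfolding ord_regular_def
proof (intro allI impI)
  let ?G = "graded_ring TYPE('k)"
  interpret N: nil_extension ?G "\<lambda>p. graded_map (axis p)" graded_axis_part
    by (rule nil_extension_assoc_graded)
  fix a assume a: "maxfac a"
  then have ax: "a \<in> exps d" by (simp add: maxfac_def)
  show "maxfac (a + e1)"
  proof (rule ccontr)
    assume non: "\<not> maxfac (a + e1)"
    let ?u = "graded_map (xpow a :: 'k mpol)"
    have ac: "(xpow a :: 'k mpol) \<in> carrier (mpol_ring d)" and ec: "(xpow e1 :: 'k mpol) \<in> carrier (mpol_ring d)"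
      using ax by simp_all
    have "graded_map (axis [:0, 1:]) \<otimes>\<^bsub>?G\<^esub> ?u = graded_map (xpow (e1 + a))"
      using ring_hom_mult[OF graded_map_hom ec ac] by (simp add: axis_X xpow_add)
    also have "\<dots> = \<zero>\<^bsub>?G\<^esub>"
      by (rule graded_map_nonmax) (use ax non in \<open>simp_all add: add.commute\<close>)
    finally have "?u = \<zero>\<^bsub>?G\<^esub>"
      by (rule N.cohen_macaulay_imp_regular[OF cm ring_hom_closed[OF graded_map_hom ac]])
    then have "piece (xpow a :: 'k mpol) (total_deg d a) \<in> filt (Suc (total_deg d a))"
      unfolding graded_map_zero_iff by blast
    then have "Polynomial.monom (1::'k) (weight d n a) \<in> filt (Suc (total_deg d a))"
      by (simp add: xpow_def piece_single)
    then have "Suc (total_deg d a) \<le> ord (weight d n a)"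
      using filtD[of "Polynomial.monom (1::'k) (weight d n a)" _ "weight d n a"] by simp
    then show False using a by (simp add: maxfac_iff_ord)
  qed
qed

lemma ord_add_mult:
  assumes reg: ord_regular and s: "s \<in> S"
  shows "s + k * n 1 \<in> S \<and> ord (s + k * n 1) = ord s + k"
proof (induction k)
  case (Suc k)
  have "n 1 \<in> S" using generator_in_S[OF d_pos] by blast
  then have "(s + k * n 1) + n 1 \<in> S" using Suc S_submonoid(2) by blast
  moreover have "ord ((s + k * n 1) + n 1) = ord s + k + 1"
    using reg Suc unfolding ord_regular_iff by simp
  moreover have "s + Suc k * n 1 = (s + k * n 1) + n 1" by simp
  ultimately show ?case by (simp only: add_Suc_right) simp
qed (use s in simp)

text \<open>Compare coefficients at \<open>s + j n\<^sub>1\<close>, where \<open>s\<close> is the least exponent occurring in the initial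
  part of \<open>f\<close> and \<open>j\<close> the order of vanishing of \<open>p\<close>.\<close>

lemma ord_regular_imp_regular:
  fixes p :: "('k::field) poly"
  assumes reg: ord_regular and p: "p \<noteq> 0" and f: "Poly_Mapping.keys f \<subseteq> exps d"
    and zero: "graded_map (axis p * f) = \<zero>\<^bsub>graded_ring TYPE('k)\<^esub>"
  shows "graded_map f = \<zero>\<^bsub>graded_ring TYPE('k)\<^esub>"
proof (rule ccontr)
  assume "\<not> ?thesis"
  then obtain m where m: "piece f m \<notin> filt (Suc m)" unfolding graded_map_zero_iff by blast
  have pf: "piece f m \<in> filt m" for m by (rule piece_in_filt[OF f])
  \<comment> \<open>Says that the basis class of \<open>t^s\<close> occurs in
    \<open>graded_map f\<close>: of \<open>piece f m\<close> only the exponents of order exactly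
    \<open>m\<close> survive.\<close>
  let ?U = "\<lambda>s. s \<in> S \<and> Polynomial.coeff (piece f (ord s)) s \<noteq> 0"
  obtain s where s: "Polynomial.coeff (piece f m) s \<noteq> 0" "\<not> (s \<in> S \<and> Suc m \<le> ord s)"
    using m unfolding filt_def by blast
  then have "s \<in> S" "ord s = m" using filtD[OF pf s(1)] by auto
  then have "?U s" using s(1) by simp
  define s0 where "s0 = (LEAST s. ?U s)"
  have s0: "?U s0" unfolding s0_def by (rule LeastI[of ?U, OF \<open>?U s\<close>])
  have s0_least: "\<not> ?U t" if "t < s0" for t using that not_less_Least unfolding s0_def by blast
  define j where "j = (LEAST j. Polynomial.coeff p j \<noteq> 0)"
  obtain i where "Polynomial.coeff p i \<noteq> 0" using p by (metis poly_eqI coeff_0)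
  then have j: "Polynomial.coeff p j \<noteq> 0" unfolding j_def by (rule LeastI)
  have j_least: "Polynomial.coeff p i = 0" if "i < j" for i using that not_less_Least unfolding j_def by blast
  let ?m = "ord s0 + j" and ?t = "s0 + j * n 1"
  have t: "?t \<in> S" "ord ?t = ?m" using ord_add_mult[OF reg, of s0 j] s0 by auto
  have summand: "Polynomial.coeff (Polynomial.monom (Polynomial.coeff p i) (i * n 1) * piece f (?m - i)) ?t =
      (if i = j then Polynomial.coeff p j * Polynomial.coeff (piece f (ord s0)) s0 else 0)" if i: "i \<le> ?m" for i
  proof -
    consider "i < j" | "i = j" | "j < i" by linarith
    then show ?thesis
    proof cases
      case 1
      then show ?thesis using j_least by simp
    next
      case 2
      then show ?thesis by (simp add: coeff_monom_mult)
    next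
      case 3
      \<comment> \<open>A nonzero contribution would come from
        \<open>r = s0 - (i - j) * n 1\<close>. Regularity gives it the order
        \<open>ord s0 - (i - j)\<close>, which is \<open>?m - i\<close>, so \<open>?U r\<close>
        would hold below the least element \<open>s0\<close>.\<close>
      have "Polynomial.coeff (piece f (?m - i)) (?t - i * n 1) = 0" if le: "i * n 1 \<le> ?t"
      proof (rule ccontr)
        assume nz: "Polynomial.coeff (piece f (?m - i)) (?t - i * n 1) \<noteq> 0"
        define r where "r = ?t - i * n 1"
        have r: "r \<in> S" using filtD[OF pf nz] by (simp add: r_def)
        have "i * n 1 = (i - j) * n 1 + j * n 1" using 3 by (simp flip: distrib_right)
        then have sr: "s0 = r + (i - j) * n 1" using le unfolding r_def by linarith
        then have "ord s0 = ord r + (i - j)" using ord_add_mult[OF reg r, of "i - j"] by simp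
        then have "?m - i = ord r" using 3 by simp
        then have "?U r" using r nz by (simp add: r_def)
        moreover have "r < s0" using sr 3 n1_pos by simp
        ultimately show False using s0_least by blast
      qed
      then show ?thesis using 3 by (simp add: coeff_monom_mult)
    qed
  qed
  have "Polynomial.coeff (piece (axis p * f) ?m) ?t =
      (\<Sum>i\<le>?m. if i = j then Polynomial.coeff p j * Polynomial.coeff (piece f (ord s0)) s0 else 0)"
    unfolding piece_mult piece_axis coeff_sum using summand by (intro sum.cong) auto
  also have "\<dots> = Polynomial.coeff p j * Polynomial.coeff (piece f (ord s0)) s0"
    by (simp add: sum.delta)
  finally have "Polynomial.coeff (piece (axis p * f) ?m) ?t \<noteq> 0" using j s0 by simp
  moreover have "piece (axis p * f) ?m \<in> filt (Suc ?m)" using zero unfolding graded_map_zero_iff by blast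
  ultimately have "Suc ?m \<le> ord ?t" using filtD by blast
  then show False using t(2) by simp
qed

lemma apery_decomposition:
  assumes "s \<in> S"
  shows "\<exists>w\<in>apery S (n 1). \<exists>k. s = w + k * n 1"
  using assms
proof (induction s rule: less_induct)
  case (less s)
  show ?case
  proof (cases "s \<in> apery S (n 1)")
    case True
    then show ?thesis by (intro bexI[of _ s] exI[of _ 0]) auto
  next
    case False
    then obtain y where y: "y \<in> S" "s = y + n 1" using less.prems by (auto simp: apery_def)
    then obtain w k where "w \<in> apery S (n 1)" "y = w + k * n 1"
      using less.IH[of y] n1_pos by auto
    then show ?thesis using y(2) by (intro bexI[of _ w] exI[of _ "Suc k"]) auto
  qed
qed

text \<open>Since \<open>ord\<close> grows by exactly \<open>k\<close> from \<open>w\<close> to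
  \<open>w + k * n 1\<close>, the class of \<open>t^(w + k * n 1)\<close> is the \<open>k\<close>-th
  power of the class of \<open>t^(n 1)\<close> times the class of \<open>t^w\<close>. So the classes
  of the finite Apery set span the graded ring over \<open>k[y]\<close>.\<close>

lemma ord_regular_imp_noetherian:
  assumes reg: ord_regular
  shows "noetherian_ring (graded_ring TYPE('k::field))"
proof -
  let ?G = "graded_ring TYPE('k)"
  define A where "A = apery S (n 1)"
  have finA: "finite A" unfolding A_def by (rule finite_apery)
  interpret N: nil_extension ?G "\<lambda>p. graded_map (axis p)" graded_axis_part
    by (rule nil_extension_assoc_graded)
  have AS: "w \<in> S" if "w \<in> A" for w using that by (simp add: A_def apery_def)
  have "\<exists>a. maxfac a \<and> weight d n a = w" if "w \<in> A" for w
    using maxfac_exists[OF AS[OF that]] by blast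
  then obtain c where c: "\<And>w. w \<in> A \<Longrightarrow> maxfac (c w) \<and> weight d n (c w) = w" by metis
  have cx: "c w \<in> exps d" if "w \<in> A" for w using c[OF that] by (simp add: maxfac_def)
  define b where "b = (\<lambda>w. graded_map (xpow (c w) :: 'k mpol))"
  have xc: "(xpow (c w) :: 'k mpol) \<in> carrier (mpol_ring d)" if "w \<in> A" for w using cx[OF that] by simp
  have b: "b w \<in> carrier ?G" if "w \<in> A" for w
    unfolding b_def by (rule ring_hom_closed[OF graded_map_hom xc[OF that]])
  note cp = N.combination_props[of A b, OF b finA]
  have span: "Poly_Mapping.keys f \<subseteq> exps d \<and> (\<exists>p. graded_map f = N.combination A b p)"
    if f: "Poly_Mapping.keys f \<subseteq> exps d" for f :: "'k mpol"
  proof (induction f rule: pm_induct)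
    case 1
    have "graded_map (0 :: 'k mpol) = \<zero>\<^bsub>?G\<^esub>" unfolding graded_map_zero_iff by simp
    then have "graded_map 0 = N.combination A b (\<lambda>j. 0)" by (simp add: cp(4))
    then show ?case by auto
  next
    case (2 g h)
    then obtain p q where pq: "graded_map g = N.combination A b p" "graded_map h = N.combination A b q" by blast
    have "graded_map (g + h) = graded_map g \<oplus>\<^bsub>?G\<^esub> graded_map h"
      using ring_hom_add[OF graded_map_hom, of g h] 2 by simp
    also have "\<dots> = N.combination A b (\<lambda>j. p j + q j)" by (simp add: pq cp(2))
    finally show ?case using 2 keys_add[of g h] by blast
  next
    case (3 a)
    then have ax: "a \<in> exps d" using f by blast
    let ?g = "Poly_Mapping.single a (Poly_Mapping.lookup f a)"
    have keys: "Poly_Mapping.keys ?g \<subseteq> exps d" using ax by simp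
    show ?case
    proof (cases "maxfac a")
      case False
      have "graded_map ?g = \<zero>\<^bsub>?G\<^esub>"
        by (rule graded_map_nonmax[OF keys]) (use False in \<open>auto split: if_splits\<close>)
      then have "graded_map ?g = N.combination A b (\<lambda>j. 0)" by (simp add: cp(4))
      then show ?thesis using keys by blast
    next
      case True
      obtain w k where w: "w \<in> A" "weight d n a = w + k * n 1"
        using apery_decomposition[OF weight_in_S[OF ax]] unfolding A_def by blast
      let ?p = "Polynomial.monom (Poly_Mapping.lookup f a) k"
      have "total_deg d a = ord (w + k * n 1)" using True w(2) by (simp add: maxfac_iff_ord)
      also have "\<dots> = total_deg d (c w) + k"
        using ord_add_mult[OF reg AS[OF w(1)], of k] c[OF w(1)] by (simp add: maxfac_iff_ord)
      finally have deg: "total_deg d a = total_deg d (c w) + k" .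
      have "graded_map ?g = graded_map (axis ?p * xpow (c w))"
      \<comment> \<open>Both sides have a single piece, in degree \<open>total_deg d a\<close>;
        \<open>deg\<close> makes the degrees agree.\<close>
      proof (rule graded_map_cong)
        fix m
        have "piece (axis ?p * xpow (c w)) m = (\<Sum>i\<le>m. if i = k then
            (if total_deg d (c w) = m - k then Polynomial.monom (Poly_Mapping.lookup f a) (k * n 1 + w) else 0) else 0)"
          unfolding piece_mult piece_axis xpow_def piece_single
          using c[OF w(1)] by (intro sum.cong refl) (auto simp: mult_monom)
        also have "\<dots> = (if total_deg d a = m then Polynomial.monom (Poly_Mapping.lookup f a) (weight d n a) else 0)"
          using deg w(2) by (auto simp: sum.delta add.commute)
        finally show "piece ?g m = piece (axis ?p * xpow (c w)) m" by (simp add: piece_single)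
      qed
      also have "\<dots> = graded_map (axis ?p) \<otimes>\<^bsub>?G\<^esub> b w"
        using ring_hom_mult[OF graded_map_hom, of "axis ?p" "xpow (c w)"] keys_axis[of ?p] xc[OF w(1)]
        by (simp add: b_def)
      also have "\<dots> = N.combination A b (\<lambda>j. if j = w then ?p else 0)" by (simp add: cp(5) w(1))
      finally show ?thesis using keys by blast
    qed
  qed
  show ?thesis
  proof (rule N.noetherianI[OF finA b])
    fix u assume "u \<in> carrier ?G"
    then obtain f where "Poly_Mapping.keys f \<subseteq> exps d" "graded_map f = u" using graded_map_surj by blast
    then show "\<exists>p. u = N.combination A b p" using span by blast
  qed
qed

lemma cohen_macaulay_iff: "cohen_macaulay (graded_ring TYPE('k::field)) \<longleftrightarrow> ord_regular"
proof
  let ?G = "graded_ring TYPE('k)"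
  assume reg: ord_regular
  interpret N: nil_extension ?G "\<lambda>p. graded_map (axis p)" graded_axis_part
    by (rule nil_extension_assoc_graded)
  show "cohen_macaulay ?G"
  proof (rule N.cohen_macaulayI[OF ord_regular_imp_noetherian[OF reg]])
    fix p :: "'k poly" and u
    assume p: "p \<noteq> 0" and u: "u \<in> carrier ?G" "graded_map (axis p) \<otimes>\<^bsub>?G\<^esub> u = \<zero>\<^bsub>?G\<^esub>"
    obtain f where f: "Poly_Mapping.keys f \<subseteq> exps d" "graded_map f = u" using graded_map_surj[OF u(1)] by blast
    have "graded_map (axis p * f) = \<zero>\<^bsub>?G\<^esub>"
      using ring_hom_mult[OF graded_map_hom, of "axis p" f] keys_axis[of p] f u(2) by simp
    then show "u = \<zero>\<^bsub>?G\<^esub>" using ord_regular_imp_regular[OF reg p f(1)] f(2) by simp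
  qed
qed (rule cohen_macaulay_imp_ord_regular)

end

theorem theorem3p12:
  fixes S :: "nat set" and d :: nat and n :: "nat \<Rightarrow> nat"
  assumes "numerical_semigroup S"
    and "minimally_generated S d n"
    and "\<And>i. i \<in> {2..d} \<Longrightarrow> n 1 < n i"
  shows
    "let I = (semigroup_ideal d n :: ('k::field) mpol set);
         C1 = (homogeneous_semigroup S d n \<and>
               cohen_macaulay (semigroup_assoc_graded S d n :: (nat \<Rightarrow> 'k poly set) ring));
         C2 = (\<forall>a\<in>exps d. \<forall>b\<in>exps d.
                 xpow a - xpow b \<in> I \<and> total_deg d a > total_deg d b \<longrightarrow>
                   weight d n a \<notin> apery S (n 1) \<and>
                   (maximal_factorization d n (weight d n (drop_first b)) (drop_first b) \<longrightarrow>
                      Poly_Mapping.lookup a 1 \<ge> Poly_Mapping.lookup b 1));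
         C3 = (\<exists>E. (\<forall>f\<in>E. is_binomial d f) \<and>
                 minimal_generating_set (mpol_ring d) E I \<and>
                 (\<forall>a\<in>exps d. \<forall>b\<in>exps d.
                    (xpow a - xpow b \<in> E \<or> xpow b - xpow a \<in> E) \<and>
                    total_deg d a > total_deg d b \<longrightarrow> Poly_Mapping.lookup a 1 \<noteq> 0));
         C4 = (\<exists>E. (\<forall>f\<in>E. is_binomial d f) \<and>
                 minimal_generating_set (mpol_ring d) E I \<and>
                 standard_basis d I E \<and>
                 (\<forall>a\<in>exps d. \<forall>b\<in>exps d.
                    (xpow a - xpow b \<in> E \<or> xpow b - xpow a \<in> E) \<and>
                    total_deg d a > total_deg d b \<longrightarrow> Poly_Mapping.lookup a 1 \<noteq> 0));
         C5 = (\<exists>G. minimal_groebner_basis d I G \<and>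
                 (\<forall>f\<in>G. is_binomial d f) \<and>
                 (\<forall>a\<in>exps d. \<forall>b\<in>exps d.
                    xpow a - xpow b \<in> G \<and>
                    \<not> homogeneous_mpol d (xpow a - xpow b :: 'k mpol) \<longrightarrow>
                      1 \<in> binomial_support d a b) \<and>
                 (\<forall>f\<in>G. \<not> (xpow (Poly_Mapping.single 1 1) divides\<^bsub>mpol_ring d\<^esub> lead_mon d f)))
     in (C1 \<longleftrightarrow> C2) \<and> (C2 \<longleftrightarrow> C3) \<and> (C3 \<longleftrightarrow> C4) \<and> (C4 \<longleftrightarrow> C5)"
proof -
  interpret semigroup_generators S d n
    by (rule semigroup_generators.intro[OF assms])
  have c1: "homogeneous_semigroup S d n \<and>
      cohen_macaulay (semigroup_assoc_graded S d n :: (nat \<Rightarrow> 'k poly set) ring) \<longleftrightarrow>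
      apery_homogeneous \<and> ord_regular"
    by (simp only: homogeneous_iff cohen_macaulay_iff)
  \<comment> \<open>Condition (3) is reached from the combinatorial condition by way of the Groebner
    basis of (5), from which a minimal generating subset is extracted.\<close>
  have c23: "\<exists>E :: 'k mpol set. good_generators E" if "apery_homogeneous \<and> ord_regular"
    using that good_groebner_basis_imp_generators[OF good_groebner_basis_nf_basis, where 'k='k] by blast
  have c32: "apery_homogeneous \<and> ord_regular" if "good_generators E" for E :: "'k mpol set"
    using good_generators_imp_apery_homogeneous[OF that] good_generators_imp_ord_regular[OF that] ..
  have c34: "good_generators E \<longleftrightarrow> good_standard_basis E" for E :: "'k mpol set"
    using good_generators_standard_basis[of E] unfolding good_generators_def good_standard_basis_def by blast
  have c25: "\<exists>G :: 'k mpol set. good_groebner_basis G" if "apery_homogeneous \<and> ord_regular"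
    using that good_groebner_basis_nf_basis[where 'k='k] by blast
  have c53: "\<exists>E :: 'k mpol set. good_generators E" if "good_groebner_basis G" for G :: "'k mpol set"
    using good_groebner_basis_imp_generators[OF that] by blast
  have c3: "apery_homogeneous \<and> ord_regular \<longleftrightarrow> (\<exists>E :: 'k mpol set. good_generators E)"
    using c23 c32 by blast
  moreover have "(\<exists>E :: 'k mpol set. good_generators E) \<longleftrightarrow> (\<exists>E :: 'k mpol set. good_standard_basis E)"
    by (simp only: c34)
  moreover have "(\<exists>E :: 'k mpol set. good_standard_basis E) \<longleftrightarrow> (\<exists>G :: 'k mpol set. good_groebner_basis G)"
    using c3 c25 c53 unfolding c34 by blast
  ultimately show ?thesis
    unfolding Let_def c1 factorization_condition_iff good_generators_def[symmetric] good_standard_basis_def[symmetric] good_groebner_basis_def[symmetric]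
    by (intro conjI refl)
qed

end
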